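(* Let $m\geq 2$, let $k_2,\dots,k_m\geq 2$ be integers, and let $P(z)\in\mathbb{K}[z]$ be a monic polynomial of degree $d\geq 2$ with zero coefficient of $z^{d-1}$. Let $Y=\{y_1y_2^{k_2}\cdots y_m^{k_m}=P(z)\}\subset\mathbb{K}^{m+1}$. Then the group $\mathrm{Aut}(Y)$ is generated by: 1) the proper torus $\mathbb{T}$ of $Y$; 2) the big unipotent subgroup $\mathbb{U}(\widehat{\partial})$ corresponding to the canonical locally nilpotent derivation $\widehat{\partial}$ on $Y$; 3) the additional quasitorus $\mathbb{D}$ of $Y$; 4) the symmetric group $S(Y)$ of $Y$.
   Context: $\mathbb{K}$ is an algebraically closed field of characteristic zero. Automorphisms of the variety $Y$ and of the algebra $\mathbb{K}[Y]$ are identified as usual, and the groups below are identified with their images in $\mathrm{Aut}(Y)$. Proper torus: $\mathbb{T}=\{(t_1,\dots,t_m)\in(\mathbb{K}^\times)^m\mid t_1t_2^{k_2}\cdots t_m^{k_m}=1\}$, acting on $Y$ by $y_i\mapsto t_iy_i$, $z\mapsto z$. Additional quasitorus: $\mathbb{D}=\{t\in\mathbb{K}^\times\mid P(tz)=t^dP(z)\}$, acting on $Y$ by $t\cdot(y_1,y_2,\dots,y_m,z)=(t^dy_1,y_2,\dots,y_m,tz)$. Symmetric group: $S(Y)\subset\mathrm{S}_m$ is the stabilizer of the monomial $y_1y_2^{k_2}\cdots y_m^{k_m}$ under permutations of $y_1,\dots,y_m$, acting on $Y$ by permuting the $y_i$ and fixing $z$. A derivation is locally nilpotent (LND) if each element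 is annihilated by some power of it. The canonical LND $\widehat{\partial}$ of $\mathbb{K}[Y]$ is given by $\widehat{\partial}(y_1)=P'(z)$, $\widehat{\partial}(z)=y_2^{k_2}\cdots y_m^{k_m}$, $\widehat{\partial}(y_j)=0$ for $j\geq2$. The big unipotent subgroup is $\mathbb{U}(\widehat{\partial})=\{\exp(f\widehat{\partial})\mid f\in\mathrm{Ker}\,\widehat{\partial}\}$, where $\mathrm{Ker}\,\widehat{\partial}=\mathbb{K}[y_2,\dots,y_m]$. *)

theory Defs
  imports
    "HOL-Computational_Algebra.Computational_Algebra"
    "HOL-Combinatorics.Permutations"
    "HOL-Library.Groups_Big_Fun"
    "HOL-Algebra.Bij"
    "HOL-Algebra.Generated_Groups"
begin

section \<open>Closed subsets of affine space and their automorphisms\<close>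

text \<open>
  A point \<open>(y, z)\<close> of the affine space of dimension \<open>m + 1\<close> has coordinates
  \<open>y 1, \<dots>, y m, z\<close>; the function \<open>y\<close> is required to be extensional on \<open>{1..m}\<close>,
  so that distinct pairs are distinct points.
\<close>

type_synonym 'a point = "(nat \<Rightarrow> 'a) \<times> 'a"

definition affine_space :: "nat \<Rightarrow> 'a point set" where
  "affine_space m = ({1..m} \<rightarrow>\<^sub>E UNIV) \<times> UNIV"

inductive_set polynomial_funs :: "nat \<Rightarrow> ('a::comm_ring_1 point \<Rightarrow> 'a) set" for m where
  const: "(\<lambda>p. c) \<in> polynomial_funs m"
| coord_y: "i \<in> {1..m} \<Longrightarrow> (\<lambda>p. fst p i) \<in> polynomial_funs m"
| coord_z: "(\<lambda>p. snd p) \<in> polynomial_funs m"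
| add: "f \<in> polynomial_funs m \<Longrightarrow> g \<in> polynomial_funs m \<Longrightarrow> (\<lambda>p. f p + g p) \<in> polynomial_funs m"
| mult: "f \<in> polynomial_funs m \<Longrightarrow> g \<in> polynomial_funs m \<Longrightarrow> (\<lambda>p. f p * g p) \<in> polynomial_funs m"

text \<open>The coordinate algebra, realised as the algebra of regular functions on \<open>X\<close>.\<close>

definition coord_ring :: "nat \<Rightarrow> 'a::comm_ring_1 point set \<Rightarrow> ('a point \<Rightarrow> 'a) set" where
  "coord_ring m X = (\<lambda>g. restrict g X) ` polynomial_funs m"

definition regular_maps :: "nat \<Rightarrow> 'a::comm_ring_1 point set \<Rightarrow> ('a point \<Rightarrow> 'a point) set" where
  "regular_maps m X = {\<phi> \<in> X \<rightarrow>\<^sub>E X.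
     (\<forall>i\<in>{1..m}. (\<lambda>p\<in>X. fst (\<phi> p) i) \<in> coord_ring m X) \<and>
     (\<lambda>p\<in>X. snd (\<phi> p)) \<in> coord_ring m X}"

definition automorphisms :: "nat \<Rightarrow> 'a::comm_ring_1 point set \<Rightarrow> ('a point \<Rightarrow> 'a point) set" where
  "automorphisms m X = {\<phi> \<in> Bij X.
     \<phi> \<in> regular_maps m X \<and> restrict (inv_into X \<phi>) X \<in> regular_maps m X}"

definition Aut :: "nat \<Rightarrow> 'a::comm_ring_1 point set \<Rightarrow> ('a point \<Rightarrow> 'a point) monoid" where
  "Aut m X = BijGroup X\<lparr>carrier := automorphisms m X\<rparr>"


section \<open>Derivations and exponentials\<close>

definition derivations ::
    "nat \<Rightarrow> 'a::comm_ring_1 point set \<Rightarrow> (('a point \<Rightarrow> 'a) \<Rightarrow> ('a point \<Rightarrow> 'a)) set" where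
  "derivations m X = {\<delta> \<in> coord_ring m X \<rightarrow>\<^sub>E coord_ring m X.
     (\<forall>f\<in>coord_ring m X. \<forall>g\<in>coord_ring m X.
        \<delta> (\<lambda>p\<in>X. f p + g p) = (\<lambda>p\<in>X. \<delta> f p + \<delta> g p)) \<and>
     (\<forall>c. \<forall>f\<in>coord_ring m X. \<delta> (\<lambda>p\<in>X. c * f p) = (\<lambda>p\<in>X. c * \<delta> f p)) \<and>
     (\<forall>f\<in>coord_ring m X. \<forall>g\<in>coord_ring m X.
        \<delta> (\<lambda>p\<in>X. f p * g p) = (\<lambda>p\<in>X. \<delta> f p * g p + f p * \<delta> g p))}"

definition locally_nilpotent ::
    "nat \<Rightarrow> 'a::comm_ring_1 point set \<Rightarrow> (('a point \<Rightarrow> 'a) \<Rightarrow> ('a point \<Rightarrow> 'a)) \<Rightarrow> bool" where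
  "locally_nilpotent m X \<delta> \<longleftrightarrow>
     (\<forall>f\<in>coord_ring m X. \<exists>n. (\<delta> ^^ n) f = (\<lambda>p\<in>X. 0))"

definition lnds ::
    "nat \<Rightarrow> 'a::comm_ring_1 point set \<Rightarrow> (('a point \<Rightarrow> 'a) \<Rightarrow> ('a point \<Rightarrow> 'a)) set" where
  "lnds m X = {\<delta> \<in> derivations m X. locally_nilpotent m X \<delta>}"

definition ker_der ::
    "nat \<Rightarrow> 'a::comm_ring_1 point set \<Rightarrow> (('a point \<Rightarrow> 'a) \<Rightarrow> ('a point \<Rightarrow> 'a)) \<Rightarrow> ('a point \<Rightarrow> 'a) set" where
  "ker_der m X \<delta> = {f \<in> coord_ring m X. \<delta> f = (\<lambda>p\<in>X. 0)}"

definition scale_der ::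
    "nat \<Rightarrow> 'a::comm_ring_1 point set \<Rightarrow> ('a point \<Rightarrow> 'a) \<Rightarrow>
     (('a point \<Rightarrow> 'a) \<Rightarrow> ('a point \<Rightarrow> 'a)) \<Rightarrow> (('a point \<Rightarrow> 'a) \<Rightarrow> ('a point \<Rightarrow> 'a))" where
  "scale_der m X f \<delta> = (\<lambda>g\<in>coord_ring m X. \<lambda>p\<in>X. f p * \<delta> g p)"

text \<open>
  The sum is \<^const>\<open>Sum_any\<close>, i.e. the sum over the finitely many nonzero terms;
  it is only meaningful for locally nilpotent \<open>\<delta>\<close>.
\<close>

definition exp_der ::
    "nat \<Rightarrow> 'a::field_char_0 point set \<Rightarrow> (('a point \<Rightarrow> 'a) \<Rightarrow> ('a point \<Rightarrow> 'a)) \<Rightarrow>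
     (('a point \<Rightarrow> 'a) \<Rightarrow> ('a point \<Rightarrow> 'a))" where
  "exp_der m X \<delta> = (\<lambda>g\<in>coord_ring m X. \<lambda>p\<in>X. Sum_any (\<lambda>n. (\<delta> ^^ n) g p / fact n))"

text \<open>
  The automorphisms of \<open>X\<close> whose comorphism \<open>g \<mapsto> g \<circ> \<phi>\<close> is \<open>exp (f \<delta>)\<close> for some \<open>f\<close> in the
  kernel of \<open>\<delta>\<close>.
\<close>

definition big_unipotent ::
    "nat \<Rightarrow> 'a::field_char_0 point set \<Rightarrow> (('a point \<Rightarrow> 'a) \<Rightarrow> ('a point \<Rightarrow> 'a)) \<Rightarrow>
     ('a point \<Rightarrow> 'a point) set" where
  "big_unipotent m X \<delta> = {\<phi> \<in> automorphisms m X. \<exists>f\<in>ker_der m X \<delta>.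
     \<forall>g\<in>coord_ring m X. compose X g \<phi> = exp_der m X (scale_der m X f \<delta>) g}"


section \<open>The hypersurface and its distinguished groups\<close>

definition monomial_tail :: "nat \<Rightarrow> (nat \<Rightarrow> nat) \<Rightarrow> (nat \<Rightarrow> 'a::comm_ring_1) \<Rightarrow> 'a" where
  "monomial_tail m k y = (\<Prod>j\<in>{2..m}. y j ^ k j)"

definition monomial :: "nat \<Rightarrow> (nat \<Rightarrow> nat) \<Rightarrow> (nat \<Rightarrow> 'a::comm_ring_1) \<Rightarrow> 'a" where
  "monomial m k y = y 1 * monomial_tail m k y"

definition Y_var :: "nat \<Rightarrow> (nat \<Rightarrow> nat) \<Rightarrow> 'a::comm_ring_1 poly \<Rightarrow> 'a point set" where
  "Y_var m k P = {(y, z) \<in> affine_space m. monomial m k y = poly P z}"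

definition canonical_lnd ::
    "nat \<Rightarrow> (nat \<Rightarrow> nat) \<Rightarrow> 'a::field_char_0 poly \<Rightarrow> (('a point \<Rightarrow> 'a) \<Rightarrow> ('a point \<Rightarrow> 'a))" where
  "canonical_lnd m k P = (THE \<delta>. \<delta> \<in> lnds m (Y_var m k P) \<and>
     \<delta> (\<lambda>(y, z)\<in>Y_var m k P. y 1) = (\<lambda>(y, z)\<in>Y_var m k P. poly (pderiv P) z) \<and>
     \<delta> (\<lambda>(y, z)\<in>Y_var m k P. z) = (\<lambda>(y, z)\<in>Y_var m k P. monomial_tail m k y) \<and>
     (\<forall>j\<in>{2..m}. \<delta> (\<lambda>(y, z)\<in>Y_var m k P. y j) = (\<lambda>p\<in>Y_var m k P. 0)))"

definition proper_torus :: "nat \<Rightarrow> (nat \<Rightarrow> nat) \<Rightarrow> 'a::field poly \<Rightarrow> ('a point \<Rightarrow> 'a point) set" where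
  "proper_torus m k P =
     (\<lambda>t. \<lambda>(y, z)\<in>Y_var m k P. (\<lambda>i\<in>{1..m}. t i * y i, z)) `
     {t \<in> {1..m} \<rightarrow>\<^sub>E (UNIV - {0}). monomial m k t = 1}"

definition additional_quasitorus ::
    "nat \<Rightarrow> (nat \<Rightarrow> nat) \<Rightarrow> 'a::field poly \<Rightarrow> ('a point \<Rightarrow> 'a point) set" where
  "additional_quasitorus m k P =
     (\<lambda>t. \<lambda>(y, z)\<in>Y_var m k P. (\<lambda>i\<in>{1..m}. if i = 1 then t ^ degree P * y 1 else y i, t * z)) `
     {t. t \<noteq> 0 \<and> pcompose P [:0, t:] = smult (t ^ degree P) P}"

text \<open>
  A permutation stabilizes the monomial iff permuting the arguments leaves the monomial function
  unchanged (over an infinite field, monomials and monomial functions are the same thing).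
\<close>

definition symmetric_group ::
    "nat \<Rightarrow> (nat \<Rightarrow> nat) \<Rightarrow> 'a::field poly \<Rightarrow> ('a point \<Rightarrow> 'a point) set" where
  "symmetric_group m k P =
     (\<lambda>\<pi>. \<lambda>(y, z)\<in>Y_var m k P. (\<lambda>i\<in>{1..m}. y (\<pi> i), z)) `
     {\<pi>. \<pi> permutes {1..m} \<and>
        (\<forall>y :: nat \<Rightarrow> 'a. monomial m k (\<lambda>i. y (\<pi> i)) = monomial m k y)}"


section \<open>\<open>Aut m X\<close> is a group\<close>

lemma polynomial_comp_regular:
  assumes "g \<in> polynomial_funs m" "\<phi> \<in> regular_maps m X"
  shows "(\<lambda>p\<in>X. g (\<phi> p)) \<in> coord_ring m X"
  using assms(1)
proof induction
  case (const c)
  show ?case unfolding coord_ring_def by (rule imageI, rule polynomial_funs.const)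
next
  case (coord_y i)
  then show ?case using assms(2) unfolding regular_maps_def by blast
next
  case coord_z
  then show ?case using assms(2) unfolding regular_maps_def by blast
next
  case (add f g)
  then obtain a b where "a \<in> polynomial_funs m" "(\<lambda>p\<in>X. f (\<phi> p)) = restrict a X"
    "b \<in> polynomial_funs m" "(\<lambda>p\<in>X. g (\<phi> p)) = restrict b X"
    unfolding coord_ring_def by blast
  then have "(\<lambda>p\<in>X. f (\<phi> p) + g (\<phi> p)) = restrict (\<lambda>p. a p + b p) X"
    "(\<lambda>p. a p + b p) \<in> polynomial_funs m"
    by (auto simp: fun_eq_iff restrict_def intro: polynomial_funs.add) metis+
  then show ?case unfolding coord_ring_def by blast
next
  case (mult f g)
  then obtain a b where "a \<in> polynomial_funs m" "(\<lambda>p\<in>X. f (\<phi> p)) = restrict a X"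
    "b \<in> polynomial_funs m" "(\<lambda>p\<in>X. g (\<phi> p)) = restrict b X"
    unfolding coord_ring_def by blast
  then have "(\<lambda>p\<in>X. f (\<phi> p) * g (\<phi> p)) = restrict (\<lambda>p. a p * b p) X"
    "(\<lambda>p. a p * b p) \<in> polynomial_funs m"
    by (auto simp: fun_eq_iff restrict_def intro: polynomial_funs.mult) metis+
  then show ?case unfolding coord_ring_def by blast
qed

lemma coord_ring_comp_regular:
  assumes "g \<in> coord_ring m X" "\<phi> \<in> regular_maps m X"
  shows "compose X g \<phi> \<in> coord_ring m X"
proof -
  obtain h where h: "h \<in> polynomial_funs m" "g = restrict h X"
    using assms(1) by (auto simp: coord_ring_def)
  have "\<phi> \<in> X \<rightarrow> X" using assms(2) by (auto simp: regular_maps_def PiE_def)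
  then have "compose X g \<phi> = (\<lambda>p\<in>X. h (\<phi> p))"
    by (auto simp: h compose_def restrict_def fun_eq_iff)
  then show ?thesis using polynomial_comp_regular[OF h(1) assms(2)] by simp
qed

lemma regular_maps_compose:
  assumes "\<phi> \<in> regular_maps m X" "\<psi> \<in> regular_maps m X"
  shows "compose X \<phi> \<psi> \<in> regular_maps m X"
proof -
  have f: "\<phi> \<in> X \<rightarrow> X" "\<psi> \<in> X \<rightarrow> X"
    using assms by (auto simp: regular_maps_def PiE_def)
  have y: "(\<lambda>p\<in>X. fst (compose X \<phi> \<psi> p) i) = compose X (\<lambda>p\<in>X. fst (\<phi> p) i) \<psi>" for i
    using f by (auto simp: compose_def restrict_def fun_eq_iff)
  have z: "(\<lambda>p\<in>X. snd (compose X \<phi> \<psi> p)) = compose X (\<lambda>p\<in>X. snd (\<phi> p)) \<psi>"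
    using f by (auto simp: compose_def restrict_def fun_eq_iff)
  have "compose X \<phi> \<psi> \<in> X \<rightarrow>\<^sub>E X"
    using f by (auto simp: compose_def PiE_def)
  moreover have "\<forall>i\<in>{1..m}. (\<lambda>p\<in>X. fst (compose X \<phi> \<psi> p) i) \<in> coord_ring m X"
    using assms unfolding y by (auto simp: regular_maps_def intro!: coord_ring_comp_regular)
  moreover have "(\<lambda>p\<in>X. snd (compose X \<phi> \<psi> p)) \<in> coord_ring m X"
    using assms unfolding z by (auto simp: regular_maps_def intro!: coord_ring_comp_regular)
  ultimately show ?thesis by (auto simp: regular_maps_def)
qed

lemma id_regular: "(\<lambda>p\<in>X. p) \<in> regular_maps m X"
proof -
  have y: "(\<lambda>p\<in>X. fst ((\<lambda>p\<in>X. p) p) i) = restrict (\<lambda>p. fst p i) X" for i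
    by (auto simp: restrict_def fun_eq_iff)
  have z: "(\<lambda>p\<in>X. snd ((\<lambda>p\<in>X. p) p)) = restrict (\<lambda>p. snd p) X"
    by (auto simp: restrict_def fun_eq_iff)
  have "(\<lambda>p\<in>X. p) \<in> X \<rightarrow>\<^sub>E X" by auto
  then show ?thesis
    unfolding regular_maps_def coord_ring_def mem_Collect_eq y z
    using polynomial_funs.coord_y polynomial_funs.coord_z by blast
qed

lemma automorphisms_subgroup: "subgroup (automorphisms m X) (BijGroup X)"
proof -
  interpret G: group "BijGroup X" by (rule group_BijGroup)
  have inv: "inv\<^bsub>BijGroup X\<^esub> \<phi> = restrict (inv_into X \<phi>) X" if "\<phi> \<in> Bij X" for \<phi>
    using that by (rule inv_BijGroup)
  have aut: "\<phi> \<in> automorphisms m X \<longleftrightarrow> \<phi> \<in> carrier (BijGroup X) \<and>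
      \<phi> \<in> regular_maps m X \<and> inv\<^bsub>BijGroup X\<^esub> \<phi> \<in> regular_maps m X" for \<phi>
    using inv[of \<phi>] by (auto simp: automorphisms_def BijGroup_def)
  have mult: "\<phi> \<otimes>\<^bsub>BijGroup X\<^esub> \<psi> = compose X \<phi> \<psi>"
    if "\<phi> \<in> carrier (BijGroup X)" "\<psi> \<in> carrier (BijGroup X)" for \<phi> \<psi>
    using that by (simp add: BijGroup_def)
  have one: "\<one>\<^bsub>BijGroup X\<^esub> \<in> regular_maps m X"
    using id_regular by (simp add: BijGroup_def)
  show ?thesis
  proof
    show "automorphisms m X \<subseteq> carrier (BijGroup X)" by (auto simp: aut)
    show "\<one>\<^bsub>BijGroup X\<^esub> \<in> automorphisms m X" using one by (simp add: aut)
    fix \<phi> assume \<phi>: "\<phi> \<in> automorphisms m X"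
    then show "inv\<^bsub>BijGroup X\<^esub> \<phi> \<in> automorphisms m X" by (simp add: aut)
    fix \<psi> assume \<psi>: "\<psi> \<in> automorphisms m X"
    have "inv\<^bsub>BijGroup X\<^esub> (\<phi> \<otimes>\<^bsub>BijGroup X\<^esub> \<psi>) = inv\<^bsub>BijGroup X\<^esub> \<psi> \<otimes>\<^bsub>BijGroup X\<^esub> inv\<^bsub>BijGroup X\<^esub> \<phi>"
      using \<phi> \<psi> by (simp add: aut G.inv_mult_group)
    then show "\<phi> \<otimes>\<^bsub>BijGroup X\<^esub> \<psi> \<in> automorphisms m X"
      using \<phi> \<psi> regular_maps_compose unfolding aut
      by (metis G.inv_closed G.m_closed mult)
  qed
qed

lemma group_Aut: "group (Aut m X)"
  unfolding Aut_def
  by (rule subgroup.subgroup_is_group[OF automorphisms_subgroup group_BijGroup])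

end

theory Submission
  imports Defs "HOL-Library.Poly_Mapping"
begin

text \<open>
  Call the affine space with coordinates \<open>y 2, \<dots>, y m\<close> the base, and let \<open>\<partial>\<close> be the canonical
  derivation. Where no coordinate vanishes, \<open>y 1 = P z / tail\<close> with \<open>tail = \<Prod> y j ^ k j\<close>, so regular functions
  become Laurent polynomials in \<open>z, y 2, \<dots>, y m\<close>. Division by \<open>P\<close> with remainder writes every regular function as a
  combination of monomials \<open>y 1 ^ a \<cdot> \<Prod> y j ^ b j \<cdot> z ^ r\<close> with \<open>r < d\<close>. In the lexicographic order with
  \<open>z\<close> first their Laurent expansions have distinct leading exponents. Hence the expansion is
  injective, and the leading exponents that occur form an explicit set \<open>lead_expos\<close>.

  The key step (\<open>lnd_vertical\<close>) is that every locally nilpotent derivation \<open>D\<close> annihilates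
  \<open>y 2, \<dots>, y m\<close>. The largest homogeneous part of \<open>D\<close> has the form \<open>\<chi> u \<mapsto> \<langle>p, u\<rangle> \<chi> (u + e)\<close> on Laurent
  monomials. Nilpotency makes \<open>p\<close> proportional to a vector \<open>n\<close> of natural numbers with \<open>\<langle>n, e\<rangle> = -1\<close>,
  and \<open>D\<close> keeps leading exponents inside \<open>lead_expos\<close>. Because \<open>d \<ge> 2\<close> and all \<open>k j \<ge> 2\<close>, this leaves
  only the direction of \<open>z\<close> (\<open>extremal_part_vertical\<close>): every part of \<open>D\<close> lowers the degree in \<open>z\<close>,
  whereas no nonzero regular function has negative degree in \<open>z\<close>.

  Let \<open>\<phi>\<close> be an automorphism and apply this to the conjugate of \<open>\<partial>\<close> by \<open>\<phi>\<close>. It follows that \<open>\<phi>\<close> carries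
  the coordinates of the base to functions on the base, and that the conjugate is a multiple of \<open>\<partial>\<close>.
  Comparing the two derivations gives \<open>z \<circ> \<phi> = a z + \<beta>\<close> and \<open>tail \<circ> \<phi> = c \<cdot> tail\<close> with constants \<open>a, c\<close>
  and \<open>\<beta>\<close> on the base (\<open>automorphism_constants\<close>). Factors of monomials are monomials, so \<open>\<phi>\<close> permutes
  \<open>y 2, \<dots>, y m\<close> up to scalars (\<open>automorphism_permutation\<close>). The equation of \<open>Y\<close> and the absence of
  \<open>z ^ (d - 1)\<close> in \<open>P\<close> then force the tail to divide \<open>\<beta>\<close> and \<open>P (a z) = a ^ d P z\<close>
  (\<open>automorphism_translation\<close>). A map of this shape is an exponential of a multiple of \<open>\<partial>\<close>, followed
  by an element of the additional quasitorus, a permutation and an element of the torus; the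
  coordinate \<open>y 1\<close> is determined by the others (\<open>automorphism_factorization\<close>).

  The derivation \<open>\<partial>\<close> and its exponentials are both obtained from its flow, a family of polynomial maps
  of \<open>Y\<close> (\<open>canonical_lnd_eq\<close>, \<open>shear_big_unipotent\<close>).
\<close>

section \<open>Laurent polynomials with lexicographically ordered exponents\<close>

type_synonym expo = "nat \<Rightarrow>\<^sub>0 int"
type_synonym 'a laurent = "expo \<Rightarrow>\<^sub>0 'a"

abbreviation lookup :: "('b \<Rightarrow>\<^sub>0 'c::zero) \<Rightarrow> 'b \<Rightarrow> 'c" where "lookup \<equiv> Poly_Mapping.lookup"
abbreviation keys :: "('b \<Rightarrow>\<^sub>0 'c::zero) \<Rightarrow> 'b set" where "keys \<equiv> Poly_Mapping.keys"
abbreviation single :: "'b \<Rightarrow> 'c \<Rightarrow> ('b \<Rightarrow>\<^sub>0 'c::zero)" where "single \<equiv> Poly_Mapping.single"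
abbreviation scal :: "'a::zero \<Rightarrow> 'a laurent" where "scal c \<equiv> single 0 c"
abbreviation lmonom :: "expo \<Rightarrow> 'a::zero_neq_one laurent" where "lmonom u \<equiv> single u 1"

lemma lookup_single_if: "lookup (single u c) v = (if v = u then c else 0)"
  by (simp add: lookup_single)

lemma poly_mapping_sum_single: "(f :: 'b \<Rightarrow>\<^sub>0 'c::comm_monoid_add) = (\<Sum>u\<in>keys f. single u (lookup f u))"
proof (rule poly_mapping_eqI)
  fix k
  have "(\<Sum>u\<in>keys f. lookup (single u (lookup f u)) k) = (\<Sum>u\<in>keys f. if u = k then lookup f k else 0)"
    by (rule sum.cong) (auto simp: lookup_single_if)
  also have "\<dots> = lookup f k" by (auto simp: in_keys_iff)
  finally show "lookup f k = lookup (\<Sum>u\<in>keys f. single u (lookup f u)) k" by (simp add: lookup_sum)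
qed

lemma poly_mapping_single_induct [case_names zero single add]:
  fixes f :: "'b \<Rightarrow>\<^sub>0 'c::comm_monoid_add"
  assumes "Q 0" "\<And>u c. Q (single u c)" "\<And>f g. Q f \<Longrightarrow> Q g \<Longrightarrow> Q (f + g)"
  shows "Q f"
proof -
  have "Q (\<Sum>u\<in>I. single u (lookup f u))" if "finite I" for I
    using that by induction (auto intro: assms)
  then show ?thesis using poly_mapping_sum_single[of f] finite_keys by metis
qed

text \<open>
  The order on exponents compares the entry at the smallest differing index. Index \<open>0\<close> is used for
  \<open>z\<close>, so the degree in \<open>z\<close> takes precedence.
\<close>

lemma lex_le_0:
  assumes "(a :: expo) \<le> b" shows "lookup a 0 \<le> lookup b 0"
proof (cases "a = b")
  case False
  then have "a < b" using assms by simp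
  then obtain k where k: "lookup a k < lookup b k" "\<forall>i<k. lookup a i = lookup b i"
    by (auto simp: less_poly_mapping.rep_eq less_fun_def)
  then show ?thesis by (cases "k = 0") auto
qed simp

lemma lex_nonneg_le_zero:
  assumes "(a :: expo) \<le> 0" "\<And>i. lookup a i \<ge> 0" shows "a = 0"
proof (rule ccontr)
  assume "a \<noteq> 0"
  then have "a < 0" using assms by simp
  then obtain i where "lookup a i < 0" by (auto simp: less_poly_mapping.rep_eq less_fun_def)
  then show False using assms(2)[of i] by simp
qed

subsection \<open>Evaluation\<close>

definition nonvanishing :: "(nat \<Rightarrow> 'a::zero) \<Rightarrow> bool" where "nonvanishing t \<longleftrightarrow> (\<forall>i. t i \<noteq> 0)"

definition char_val :: "(nat \<Rightarrow> 'a::field) \<Rightarrow> expo \<Rightarrow> 'a" where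
  "char_val t u = (\<Prod>i\<in>keys u. t i powi lookup u i)"

definition leval :: "(nat \<Rightarrow> 'a::field) \<Rightarrow> 'a laurent \<Rightarrow> 'a" where
  "leval t f = (\<Sum>u\<in>keys f. lookup f u * char_val t u)"

lemma char_val_superset: "finite I \<Longrightarrow> keys u \<subseteq> I \<Longrightarrow> char_val t u = (\<Prod>i\<in>I. t i powi lookup u i)"
  unfolding char_val_def by (rule prod.mono_neutral_left) (auto simp: in_keys_iff)

lemma char_val_0 [simp]: "char_val t 0 = 1" by (simp add: char_val_def)

lemma char_val_add: "nonvanishing t \<Longrightarrow> char_val t (u + v) = char_val t u * char_val t v"
  using char_val_superset[of "keys u \<union> keys v" u t] char_val_superset[of "keys u \<union> keys v" v t]
    char_val_superset[of "keys u \<union> keys v" "u + v" t] Poly_Mapping.keys_add[of u v]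
  by (simp add: prod.distrib[symmetric] lookup_add nonvanishing_def power_int_add)

lemma char_val_single [simp]: "char_val t (single i n) = t i powi n"
  using char_val_superset[of "{i}" "single i n" t] by simp


lemma char_val_mult: "char_val (\<lambda>i. s i * t i) u = char_val s u * char_val t u"
  by (simp add: char_val_def prod.distrib power_int_mult_distrib)

lemma leval_superset: "finite I \<Longrightarrow> keys f \<subseteq> I \<Longrightarrow> leval t f = (\<Sum>u\<in>I. lookup f u * char_val t u)"
  unfolding leval_def by (rule sum.mono_neutral_left) (auto simp: in_keys_iff)

lemma leval_0 [simp]: "leval t 0 = 0" by (simp add: leval_def)

lemma leval_add: "leval t (f + g) = leval t f + leval t g"
  using leval_superset[of "keys f \<union> keys g" f t] leval_superset[of "keys f \<union> keys g" g t]
    leval_superset[of "keys f \<union> keys g" "f + g" t] Poly_Mapping.keys_add[of f g]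
  by (simp add: sum.distrib[symmetric] lookup_add algebra_simps)

lemma leval_single [simp]: "leval t (single u c) = c * char_val t u"
  using leval_superset[of "{u}" "single u c" t] by simp

lemma leval_1 [simp]: "leval t 1 = 1"
  using leval_single[of t 0 1] by (simp del: leval_single)

lemma leval_sum: "leval t (sum f I) = (\<Sum>i\<in>I. leval t (f i))"
  by (induction I rule: infinite_finite_induct) (auto simp: leval_add)

text \<open>
  Negative exponents occur, so the points are restricted to those without vanishing coordinates.
\<close>

lemma leval_mult: "nonvanishing t \<Longrightarrow> leval t (f * g) = leval t f * leval t g"
proof (induction f rule: poly_mapping_single_induct)
  case (single u c)
  then show ?case
    by (induction g rule: poly_mapping_single_induct)
      (auto simp: mult_single char_val_add leval_add algebra_simps)
qed (auto simp: leval_add algebra_simps)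

lemma leval_uminus: "leval t (- f) = - leval t f"
  using leval_add[of t f "- f"] by (simp add: eq_neg_iff_add_eq_0 add.commute)

lemma leval_diff: "leval t (f - g) = leval t f - leval t g"
  using leval_add[of t f "- g"] by (simp add: leval_uminus)

lemma leval_power: "nonvanishing t \<Longrightarrow> leval t (f ^ n) = leval t f ^ n"
  by (induction n) (auto simp: leval_mult)

lemma leval_prod: "nonvanishing t \<Longrightarrow> leval t (prod f I) = (\<Prod>i\<in>I. leval t (f i))"
  by (induction I rule: infinite_finite_induct) (auto simp: leval_mult)

lemma two_powi_inject: "(2 :: 'a::field_char_0) powi a = 2 powi b \<longleftrightarrow> a = b"
proof
  assume eq: "(2 :: 'a) powi a = 2 powi b"
  have pow: "k = 0" if "(2::'a) ^ k = 1" for k :: nat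
  proof -
    have "of_nat (2 ^ k) = (of_nat 1 :: 'a)" using that by simp
    then show ?thesis unfolding of_nat_eq_iff by simp
  qed
  have "(2 :: 'a) powi (a - b) = 1" using eq by (simp add: power_int_diff)
  then show "a = b"
    using pow[of "nat (a - b)"] pow[of "nat (b - a)"]
    by (cases "a \<ge> b") (auto simp: power_int_def inverse_eq_1_iff field_simps power_inverse[symmetric])
qed simp

text \<open>
  This is Dedekind's independence of characters: translating the argument by a point at which two
  characters differ and subtracting shortens a vanishing combination.
\<close>

lemma leval_eq_0D:
  fixes f :: "'a::field_char_0 laurent"
  assumes "\<And>t. nonvanishing t \<Longrightarrow> leval t f = 0"
  shows "f = 0"
  using assms
proof (induction "card (keys f)" arbitrary: f rule: less_induct)
  case less
  show ?case
  proof (rule ccontr)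
    assume "f \<noteq> 0"
    then obtain u where u: "u \<in> keys f" by (metis keys_eq_empty all_not_in_conv poly_mapping_eqI in_keys_iff lookup_zero)
    show False
    proof (cases "keys f = {u}")
      case True
      have "leval (\<lambda>_. 1) f = lookup f u * char_val (\<lambda>_. 1) u"
        using True by (simp add: leval_def)
      moreover have "leval (\<lambda>_. 1) f = 0" "char_val (\<lambda>_. 1) u = (1::'a)"
        using less.prems[of "\<lambda>_. 1"] by (auto simp: nonvanishing_def char_val_def)
      ultimately show False using u by (auto simp: in_keys_iff)
    next
      case False
      then obtain v where v: "v \<in> keys f" "v \<noteq> u" using u by auto
      then obtain i where i: "lookup v i \<noteq> lookup u i" by (metis poly_mapping_eqI)
      \<comment> \<open>Distinct powers of \<open>2\<close> are distinct in characteristic zero, so \<open>s\<close> separates \<open>u\<close> and \<open>v\<close>.\<close>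
      define s :: "nat \<Rightarrow> 'a" where "s = (\<lambda>j. if j = i then 2 else 1)"
      have s: "nonvanishing s" by (auto simp: nonvanishing_def s_def)
      have sv: "char_val s w = 2 powi lookup w i" for w
      proof -
        have "char_val s w = (\<Prod>j\<in>insert i (keys w). if j = i then 2 powi lookup w i else 1)"
          unfolding char_val_superset[of "insert i (keys w)" w s, OF finite.insertI[OF finite_keys] subset_insertI]
          by (rule prod.cong) (auto simp: s_def)
        then show ?thesis by simp
      qed
      have ne: "char_val s v \<noteq> char_val s u"
      proof
        assume "char_val s v = char_val s u"
        then show False using i unfolding sv by (simp add: two_powi_inject)
      qed
      define g where "g = Poly_Mapping.mapp (\<lambda>w c. c * (char_val s w - char_val s u)) f"
      have lg: "lookup g w = lookup f w * (char_val s w - char_val s u)" for w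
        by (auto simp: g_def lookup_mapp when_def in_keys_iff)
      have "u \<notin> keys g" by (simp add: in_keys_iff lg)
      moreover have kg: "keys g \<subseteq> keys f" by (auto simp: in_keys_iff lg)
      ultimately have "card (keys g) < card (keys f)" using u by (intro psubset_card_mono) auto
      moreover have "leval t g = 0" if t: "nonvanishing t" for t
      proof -
        have "nonvanishing (\<lambda>i. s i * t i)" using s t by (auto simp: nonvanishing_def)
        then have 1: "leval (\<lambda>i. s i * t i) f = 0" "leval t f = 0" using less.prems t by auto
        have "leval t g = (\<Sum>w\<in>keys f. lookup f w * (char_val s w - char_val s u) * char_val t w)"
          using leval_superset[OF _ kg, of t] by (simp add: lg)
        also have "\<dots> = leval (\<lambda>i. s i * t i) f - char_val s u * leval t f"
          by (simp add: leval_def char_val_mult sum_subtractf[symmetric] sum_distrib_left algebra_simps)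
        finally show ?thesis using 1 by simp
      qed
      ultimately have "g = 0" using less.hyps by blast
      then have "lookup g v = 0" by simp
      then show False using v ne by (auto simp: lg in_keys_iff)
    qed
  qed
qed

lemma leval_inject:
  fixes f g :: "'a::field_char_0 laurent"
  assumes "\<And>t. nonvanishing t \<Longrightarrow> leval t f = leval t g"
  shows "f = g"
  using leval_eq_0D[of "f - g"] assms by (auto simp: leval_diff)

subsection \<open>Euler derivations\<close>

definition euler :: "nat \<Rightarrow> 'a::comm_ring_1 laurent \<Rightarrow> 'a laurent" where
  "euler i f = Poly_Mapping.mapp (\<lambda>u c. of_int (lookup u i) * c) f"

lemma lookup_euler: "lookup (euler i f) u = of_int (lookup u i) * lookup f u"
  by (auto simp: euler_def lookup_mapp when_def in_keys_iff)

lemma euler_add: "euler i (f + g) = euler i f + euler i g"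
  by (rule poly_mapping_eqI) (simp add: lookup_euler lookup_add algebra_simps)

lemma euler_0 [simp]: "euler i 0 = 0"
  by (rule poly_mapping_eqI) (simp add: lookup_euler)

lemma euler_single [simp]: "euler i (single u c) = single u (of_int (lookup u i) * c)"
  by (rule poly_mapping_eqI) (simp add: lookup_euler lookup_single_if)

lemma euler_mult: "euler i (f * g) = euler i f * g + f * euler i g"
proof (induction f rule: poly_mapping_single_induct)
  case (single u c)
  then show ?case
  proof (induction g rule: poly_mapping_single_induct)
    case (single v d)
    then show ?case by (simp add: mult_single lookup_add algebra_simps flip: single_add)
  qed (auto simp: euler_add algebra_simps)
qed (auto simp: euler_add algebra_simps)

subsection \<open>Leading exponents\<close>

text \<open>
  The coefficient \<open>c\<close> may vanish. Admitting this makes the notion additive in \<open>f\<close> and compatible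
  with products, without having to exclude cancellation.
\<close>

definition lead :: "'a::zero laurent \<Rightarrow> expo \<Rightarrow> 'a \<Rightarrow> bool" where
  "lead f u c \<longleftrightarrow> (\<forall>v\<in>keys f. v \<le> u) \<and> lookup f u = c"

lemma lead_single: "lead (single u c) u c"
  by (auto simp: lead_def)

lemma lead_add: "lead f u c \<Longrightarrow> lead g u c' \<Longrightarrow> lead (f + g) u (c + c')"
  using Poly_Mapping.keys_add[of f g] by (auto simp: lead_def lookup_add)

lemma lead_sum: "finite I \<Longrightarrow> (\<And>i. i \<in> I \<Longrightarrow> lead (f i) u (c i)) \<Longrightarrow> lead (sum f I) u (sum c I)"
  by (induction I rule: finite_induct) (auto intro: lead_add simp: lead_def[of 0])

lemma lead_less: "lead f v c \<Longrightarrow> v < u \<Longrightarrow> lead f u 0"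
  by (force simp: lead_def in_keys_iff)

lemma lead_keys_le: "lead f u c \<Longrightarrow> v \<in> keys f \<Longrightarrow> v \<le> u"
  by (auto simp: lead_def)

text \<open>
  When only one pair of exponents contributes to \<open>u + v\<close>, no cancellation can happen there.
\<close>

lemma lookup_mult_unique:
  fixes f g :: "('b::cancel_comm_monoid_add) \<Rightarrow>\<^sub>0 'a::comm_ring_1"
  assumes "\<And>a b. a \<in> keys f \<Longrightarrow> b \<in> keys g \<Longrightarrow> a + b = u + v \<Longrightarrow> a = u"
  shows "lookup (f * g) (u + v) = lookup f u * lookup g v"
proof -
  have f: "f * g = (\<Sum>a\<in>keys f. \<Sum>b\<in>keys g. single (a + b) (lookup f a * lookup g b))"
    by (subst (1) poly_mapping_sum_single[of f], subst (1) poly_mapping_sum_single[of g])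
      (simp add: sum_product mult_single)
  have "lookup (f * g) (u + v) = (\<Sum>a\<in>keys f. \<Sum>b\<in>keys g. if a = u then if b = v then lookup f u * lookup g v else 0 else 0)"
    unfolding f lookup_sum
    by (intro sum.cong refl) (use assms in \<open>auto simp: lookup_single_if\<close>)
  also have "\<dots> = (\<Sum>a\<in>keys f. if a = u then (\<Sum>b\<in>keys g. if b = v then lookup f u * lookup g v else 0) else 0)"
    by (intro sum.cong refl) auto
  also have "\<dots> = lookup f u * lookup g v" by (auto simp: in_keys_iff)
  finally show ?thesis .
qed

lemma lead_mult:
  fixes f g :: "'a::comm_ring_1 laurent"
  assumes "lead f u c" "lead g v d"
  shows "lead (f * g) (u + v) (c * d)"
  unfolding lead_def
proof
  show "\<forall>w\<in>keys (f * g). w \<le> u + v"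
    using assms Poly_Mapping.keys_mult[of f g] by (fastforce simp: lead_def intro: add_mono)
  have "a = u" if "a \<in> keys f" "b \<in> keys g" "a + b = u + v" for a b
    using that assms add_less_le_mono[of a u b v] by (force simp: lead_def le_less)
  then show "lookup (f * g) (u + v) = c * d"
    using assms lookup_mult_unique[of f g u v] by (simp add: lead_def)
qed

lemma lead_1: "lead (1 :: 'a::comm_ring_1 laurent) 0 1"
  using lead_single[of 0 "1::'a"] by simp


lemma lead_unique: "lead f u c \<Longrightarrow> lead f v d \<Longrightarrow> c \<noteq> 0 \<Longrightarrow> d \<noteq> 0 \<Longrightarrow> u = v"
  by (metis antisym in_keys_iff lead_def)

lemma lead_zero: "lead 0 u c \<Longrightarrow> c = 0" by (simp add: lead_def)


text \<open>
  The sum of the largest exponents of \<open>f\<close> and \<open>g\<close> and the sum of the smallest ones both occur in the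
  product, without cancellation.
\<close>

lemma factor_of_monomial:
  fixes f g :: "'a::idom laurent"
  assumes fg: "f * g = single w c" and c: "c \<noteq> 0"
  shows "\<exists>u a. a \<noteq> 0 \<and> f = single u a"
proof -
  have "f \<noteq> 0" "g \<noteq> 0" using fg c by (metis lookup_single_eq lookup_zero mult_zero_left mult_zero_right)+
  then have ne: "keys f \<noteq> {}" "keys g \<noteq> {}" by (metis in_keys_iff lookup_zero poly_mapping_eqI ex_in_conv)+
  define u u' v v' where uv: "u = Max (keys f)" "u' = Min (keys f)" "v = Max (keys g)" "v' = Min (keys g)"
  have mem: "u \<in> keys f" "u' \<in> keys f" "v \<in> keys g" "v' \<in> keys g" using ne by (auto simp: uv)
  have "a = u" if "a \<in> keys f" "b \<in> keys g" "a + b = u + v" for a b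
    using that add_less_le_mono[of a u b v] Max_ge[OF finite_keys that(1)] Max_ge[OF finite_keys that(2)]
    by (fastforce simp: le_less uv)
  then have "lookup (f * g) (u + v) = lookup f u * lookup g v" by (rule lookup_mult_unique)
  then have "lookup (f * g) (u + v) \<noteq> 0" using mem by (simp add: in_keys_iff)
  then have 1: "u + v = w" unfolding fg by (simp add: lookup_single_if split: if_splits)
  have "a = u'" if "a \<in> keys f" "b \<in> keys g" "a + b = u' + v'" for a b
    using that add_less_le_mono[of u' a v' b] Min_le[OF finite_keys that(1)] Min_le[OF finite_keys that(2)]
    by (fastforce simp: le_less uv)
  then have "lookup (f * g) (u' + v') = lookup f u' * lookup g v'" by (rule lookup_mult_unique)
  then have "lookup (f * g) (u' + v') \<noteq> 0" using mem by (simp add: in_keys_iff)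
  then have 2: "u' + v' = w" unfolding fg by (simp add: lookup_single_if split: if_splits)
  have "u' \<le> u" "v' \<le> v" using mem by (auto simp: uv)
  then have "u' = u" using 1 2 add_less_le_mono[of u' u v' v] by (fastforce simp: le_less)
  have "a = u" if "a \<in> keys f" for a
    using Max_ge[OF finite_keys that] Min_le[OF finite_keys that] \<open>u' = u\<close> unfolding uv by (metis antisym)
  then have "keys f = {u}" using mem by auto
  then have "f = single u (lookup f u)" using poly_mapping_sum_single[of f] by simp
  then show ?thesis using mem by (metis in_keys_iff)
qed

section \<open>Normal forms of regular functions\<close>

text \<open>
  Functions on the base are functions of the coordinate vector alone, so that they can also be
  evaluated at vectors that do not come from a point of the hypersurface.
\<close>

inductive_set base_polys :: "nat \<Rightarrow> ((nat \<Rightarrow> 'a::comm_ring_1) \<Rightarrow> 'a) set" for m where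
  const: "(\<lambda>y. c) \<in> base_polys m"
| coord: "j \<in> {2..m} \<Longrightarrow> (\<lambda>y. y j) \<in> base_polys m"
| add: "f \<in> base_polys m \<Longrightarrow> g \<in> base_polys m \<Longrightarrow> (\<lambda>y. f y + g y) \<in> base_polys m"
| mult: "f \<in> base_polys m \<Longrightarrow> g \<in> base_polys m \<Longrightarrow> (\<lambda>y. f y * g y) \<in> base_polys m"

lemma base_polys_cong:
  assumes "f \<in> base_polys m" "\<And>j. j \<in> {2..m} \<Longrightarrow> y j = y' j" shows "f y = f y'"
  using assms by induction auto

lemma base_polys_sum: "(\<And>i. i \<in> I \<Longrightarrow> f i \<in> base_polys m) \<Longrightarrow> (\<lambda>y. \<Sum>i\<in>I. f i y) \<in> base_polys m"
  by (induction I rule: infinite_finite_induct) (auto intro: base_polys.intros)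

lemma base_polys_prod: "(\<And>i. i \<in> I \<Longrightarrow> f i \<in> base_polys m) \<Longrightarrow> (\<lambda>y. \<Prod>i\<in>I. f i y) \<in> base_polys m"
  by (induction I rule: infinite_finite_induct) (auto intro: base_polys.intros)

lemma base_polys_power: "f \<in> base_polys m \<Longrightarrow> (\<lambda>y. f y ^ n) \<in> base_polys m"
  by (induction n) (auto intro: base_polys.intros)

lemma base_polys_tail: "monomial_tail m k \<in> base_polys m"
  unfolding monomial_tail_def[abs_def] by (intro base_polys_prod base_polys_power base_polys.coord)

lemma base_polys_polynomial_funs: "f \<in> base_polys m \<Longrightarrow> (\<lambda>p. f (fst p)) \<in> polynomial_funs m"
  by (induction rule: base_polys.induct) (auto intro: polynomial_funs.intros)

text \<open>
  Restriction to a line through the origin; it serves to extend identities from the torus of the base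
  to the origin.
\<close>

lemma base_polys_diagonal: "f \<in> base_polys m \<Longrightarrow> \<exists>q. \<forall>\<tau>. f (\<lambda>_. \<tau>) = poly q \<tau>"
proof (induction rule: base_polys.induct)
  case (const c)
  show ?case by (rule exI[of _ "[:c:]"]) simp
next
  case (coord j)
  show ?case by (rule exI[of _ "[:0, 1:]"]) simp
next
  case (add f g)
  then obtain q r where "\<forall>\<tau>. f (\<lambda>_. \<tau>) = poly q \<tau>" "\<forall>\<tau>. g (\<lambda>_. \<tau>) = poly r \<tau>" by blast
  then show ?case by (intro exI[of _ "q + r"]) simp
next
  case (mult f g)
  then obtain q r where "\<forall>\<tau>. f (\<lambda>_. \<tau>) = poly q \<tau>" "\<forall>\<tau>. g (\<lambda>_. \<tau>) = poly r \<tau>" by blast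
  then show ?case by (intro exI[of _ "q * r"]) simp
qed

lemma poly_eq_on_nonzero:
  fixes p q :: "'a::field_char_0 poly"
  assumes "\<And>x. x \<noteq> 0 \<Longrightarrow> poly p x = poly q x" shows "p = q"
proof -
  have "poly ([:0, 1:] * p) x = poly ([:0, 1:] * q) x" for x
    using assms[of x] by (cases "x = 0") auto
  then have "[:0, 1:] * p = [:0, 1:] * q" by (simp add: poly_eq_poly_eq_iff[symmetric] fun_eq_iff)
  then show ?thesis by simp
qed

locale suspension =
  fixes m :: nat and k :: "nat \<Rightarrow> nat" and P :: "'a::field_char_0 poly" and d :: nat
  assumes m2: "m \<ge> 2" and k2: "\<And>j. j \<in> {2..m} \<Longrightarrow> k j \<ge> 2"
    and deg_P: "degree P = d" and d2: "d \<ge> 2" and monic: "lead_coeff P = 1"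
begin

abbreviation Y :: "'a point set" where "Y \<equiv> Y_var m k P"
abbreviation R :: "('a point \<Rightarrow> 'a) set" where "R \<equiv> coord_ring m Y"
abbreviation tail :: "(nat \<Rightarrow> 'a) \<Rightarrow> 'a" where "tail \<equiv> monomial_tail m k"

lemma Y_iff: "p \<in> Y \<longleftrightarrow> fst p \<in> {1..m} \<rightarrow>\<^sub>E UNIV \<and> fst p 1 * tail (fst p) = poly P (snd p)"
  by (auto simp: Y_var_def affine_space_def monomial_def case_prod_beta)

lemma Y_eq: "p \<in> Y \<Longrightarrow> fst p 1 * tail (fst p) = poly P (snd p)"
  by (simp add: Y_iff)

lemma tail_cong: "(\<And>j. j \<in> {2..m} \<Longrightarrow> y j = y' j) \<Longrightarrow> tail y = tail y'"
  by (simp add: monomial_tail_def)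

lemma P_expand: "poly P x = (\<Sum>i\<le>d. coeff P i * x ^ i)"
  using poly_altdef[of P x] deg_P by simp

lemma P_reduce: "x ^ d = poly P x - (\<Sum>i<d. coeff P i * x ^ i)"
  using monic deg_P by (simp add: P_expand lessThan_Suc_atMost[symmetric])

text \<open>
  The part of the hypersurface with nonvanishing \<open>y 2, \<dots>, y m, z\<close>, parametrised by \<open>t 0\<close> for \<open>z\<close> and
  \<open>t j\<close> for \<open>y j\<close>.
\<close>

definition torus_point :: "(nat \<Rightarrow> 'a) \<Rightarrow> 'a point" where
  "torus_point t = ((\<lambda>i\<in>{1..m}. if i = 1 then poly P (t 0) / tail t else t i), t 0)"

lemma snd_torus_point [simp]: "snd (torus_point t) = t 0" by (simp add: torus_point_def)

lemma fst_torus_point [simp]: "j \<in> {2..m} \<Longrightarrow> fst (torus_point t) j = t j"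
  by (auto simp: torus_point_def)

lemma fst_torus_point_1 [simp]: "fst (torus_point t) 1 = poly P (t 0) / tail t"
  "fst (torus_point t) (Suc 0) = poly P (t 0) / tail t"
  using m2 by (auto simp: torus_point_def)

lemma tail_torus_point [simp]: "tail (fst (torus_point t)) = tail t"
  by (rule tail_cong) simp

lemma tail_nonzero: "nonvanishing t \<Longrightarrow> tail t \<noteq> 0"
  by (auto simp: monomial_tail_def nonvanishing_def)

lemma torus_point_in_Y: "nonvanishing t \<Longrightarrow> torus_point t \<in> Y"
  by (auto simp: Y_iff tail_nonzero) (auto simp: torus_point_def)

subsection \<open>Regular functions\<close>

definition regular :: "('a point \<Rightarrow> 'a) \<Rightarrow> bool" where
  "regular f \<longleftrightarrow> (\<exists>g\<in>polynomial_funs m. \<forall>p\<in>Y. f p = g p)"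

lemma regular_iff: "regular f \<longleftrightarrow> restrict f Y \<in> R"
proof
  assume "regular f"
  then obtain g where g: "g \<in> polynomial_funs m" "\<forall>p\<in>Y. f p = g p" by (auto simp: regular_def)
  then have "restrict f Y = restrict g Y" by auto
  then show "restrict f Y \<in> R" using g by (auto simp: coord_ring_def)
next
  assume "restrict f Y \<in> R"
  then obtain g where "g \<in> polynomial_funs m" "restrict f Y = restrict g Y" by (auto simp: coord_ring_def)
  then show "regular f" unfolding regular_def by (metis restrict_apply')
qed

lemma coord_ring_iff: "f \<in> R \<longleftrightarrow> regular f \<and> f \<in> extensional Y"
proof
  assume "f \<in> R"
  moreover from this have e: "f \<in> extensional Y" by (auto simp: coord_ring_def)
  ultimately show "regular f \<and> f \<in> extensional Y" by (simp add: regular_iff extensional_restrict)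
next
  assume "regular f \<and> f \<in> extensional Y"
  then show "f \<in> R" by (metis regular_iff extensional_restrict)
qed

lemma regular_cong: "regular f \<Longrightarrow> (\<And>p. p \<in> Y \<Longrightarrow> g p = f p) \<Longrightarrow> regular g"
  by (force simp: regular_def)

lemma regular_polynomial: "f \<in> polynomial_funs m \<Longrightarrow> regular f" by (auto simp: regular_def)
lemma regular_const: "regular (\<lambda>p. c)" by (intro regular_polynomial polynomial_funs.intros)
lemma regular_z: "regular (\<lambda>p. snd p)" by (intro regular_polynomial polynomial_funs.intros)
lemma regular_y: "i \<in> {1..m} \<Longrightarrow> regular (\<lambda>p. fst p i)" by (intro regular_polynomial polynomial_funs.intros)
lemma regular_base: "f \<in> base_polys m \<Longrightarrow> regular (\<lambda>p. f (fst p))"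
  by (intro regular_polynomial base_polys_polynomial_funs)

lemma regular_add:
  assumes "regular f" "regular g" shows "regular (\<lambda>p. f p + g p)"
proof -
  obtain a b where "a \<in> polynomial_funs m" "\<forall>p\<in>Y. f p = a p" "b \<in> polynomial_funs m" "\<forall>p\<in>Y. g p = b p"
    using assms by (auto simp: regular_def)
  then show ?thesis unfolding regular_def by (intro bexI[OF _ polynomial_funs.add[of a _ b]]) auto
qed

lemma regular_mult:
  assumes "regular f" "regular g" shows "regular (\<lambda>p. f p * g p)"
proof -
  obtain a b where "a \<in> polynomial_funs m" "\<forall>p\<in>Y. f p = a p" "b \<in> polynomial_funs m" "\<forall>p\<in>Y. g p = b p"
    using assms by (auto simp: regular_def)
  then show ?thesis unfolding regular_def by (intro bexI[OF _ polynomial_funs.mult[of a _ b]]) auto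
qed

lemma regular_sum: "(\<And>i. i \<in> I \<Longrightarrow> regular (f i)) \<Longrightarrow> regular (\<lambda>p. \<Sum>i\<in>I. f i p)"
  by (induction I rule: infinite_finite_induct) (auto intro: regular_add regular_const)

lemma regular_prod: "(\<And>i. i \<in> I \<Longrightarrow> regular (f i)) \<Longrightarrow> regular (\<lambda>p. \<Prod>i\<in>I. f i p)"
  by (induction I rule: infinite_finite_induct) (auto intro: regular_mult regular_const)

lemma regular_power: "regular f \<Longrightarrow> regular (\<lambda>p. f p ^ n)"
  by (induction n) (auto intro: regular_mult regular_const)

lemma regular_poly: "regular f \<Longrightarrow> regular (\<lambda>p. poly q (f p))"
  unfolding poly_altdef by (intro regular_sum regular_mult regular_const regular_power)

lemma regular_diff: "regular f \<Longrightarrow> regular g \<Longrightarrow> regular (\<lambda>p. f p - g p)"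
  using regular_add[of f "\<lambda>p. - 1 * g p"] regular_mult[OF regular_const[of "- 1"], of g] by simp

subsection \<open>Normal monomials\<close>

text \<open>
  The exponent vector with entry \<open>r\<close> for \<open>z\<close> and entries \<open>b j\<close> for the base, all others being \<open>0\<close>.
\<close>

definition expo :: "int \<Rightarrow> (nat \<Rightarrow> int) \<Rightarrow> expo" where
  "expo r b = Abs_poly_mapping (\<lambda>i. if i = 0 then r else if i \<in> {2..m} then b i else 0)"

lemma lookup_expo: "lookup (expo r b) i = (if i = 0 then r else if i \<in> {2..m} then b i else 0)"
proof -
  have "finite {i. (if i = 0 then r else if i \<in> {2..m} then b i else 0) \<noteq> 0}"
    by (rule finite_subset[of _ "{0..m}"]) (auto split: if_splits)
  then show ?thesis by (simp add: expo_def)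
qed

lemma char_val_expo:
  "char_val t (expo r b) = t 0 powi r * (\<Prod>j\<in>{2..m}. t j powi b j)"
proof -
  have "char_val t (expo r b) = (\<Prod>i\<in>insert 0 {2..m}. t i powi lookup (expo r b) i)"
    by (rule char_val_superset) (auto simp: in_keys_iff lookup_expo split: if_splits)
  also have "\<dots> = t 0 powi r * (\<Prod>j\<in>{2..m}. t j powi b j)"
    by (auto simp: lookup_expo intro!: prod.cong)
  finally show ?thesis .
qed

text \<open>
  A monomial \<open>y 1 ^ a \<cdot> \<Prod> y j ^ b j \<cdot> z ^ r\<close> with \<open>r < d\<close> has leading exponent \<open>s\<close> with \<open>s 0 = a d + r\<close> and
  \<open>s j = b j - a k j\<close>. Division with remainder recovers \<open>a\<close>, \<open>r\<close> and \<open>b\<close> from \<open>s\<close>, so distinct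
  monomials have distinct leading exponents, and these are the vectors described here.
\<close>

definition lead_expos :: "expo set" where
  "lead_expos = {s. lookup s 0 \<ge> 0 \<and>
     (\<forall>j\<in>{2..m}. lookup s j + int (k j) * (lookup s 0 div int d) \<ge> 0) \<and>
     (\<forall>i. i \<notin> insert 0 {2..m} \<longrightarrow> lookup s i = 0)}"

definition normal_monomial :: "nat \<Rightarrow> (nat \<Rightarrow> nat) \<Rightarrow> nat \<Rightarrow> 'a point \<Rightarrow> 'a" where
  "normal_monomial a b r p = fst p 1 ^ a * (\<Prod>j\<in>{2..m}. fst p j ^ b j) * snd p ^ r"

text \<open>
  The normal monomial with leading exponent \<open>s\<close>.
\<close>

definition basis_fun :: "expo \<Rightarrow> 'a point \<Rightarrow> 'a" where
  "basis_fun s = normal_monomial (nat (lookup s 0 div int d))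
     (\<lambda>j. nat (lookup s j + int (k j) * (lookup s 0 div int d))) (nat (lookup s 0 mod int d))"

text \<open>
  A Laurent polynomial serves here merely as a finitely supported family of coefficients indexed by
  leading exponents.
\<close>

definition combination :: "'a laurent \<Rightarrow> 'a point \<Rightarrow> 'a" where
  "combination c p = (\<Sum>s\<in>keys c. lookup c s * basis_fun s p)"

lemma normal_monomial_cong:
  "(\<And>j. j \<in> {2..m} \<Longrightarrow> b j = b' j) \<Longrightarrow> normal_monomial a b r = normal_monomial a b' r"
  by (rule ext) (simp add: normal_monomial_def)

lemma basis_fun_expo:
  assumes "r < d"
  shows "expo (int (a * d + r)) (\<lambda>j. int (b j) - int (k j * a)) \<in> lead_expos"
    and "basis_fun (expo (int (a * d + r)) (\<lambda>j. int (b j) - int (k j * a))) = normal_monomial a b r"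
proof -
  let ?s = "expo (int (a * d + r)) (\<lambda>j. int (b j) - int (k j * a))"
  have q: "lookup ?s 0 div int d = int a" "lookup ?s 0 mod int d = int r"
    using assms by (simp_all add: lookup_expo flip: zdiv_int zmod_int del: of_nat_add of_nat_mult)
  show "?s \<in> lead_expos" unfolding lead_expos_def mem_Collect_eq q by (auto simp: lookup_expo)
  show "basis_fun ?s = normal_monomial a b r"
    unfolding basis_fun_def q by (simp, rule normal_monomial_cong) (auto simp: lookup_expo)
qed

definition has_nf :: "('a point \<Rightarrow> 'a) \<Rightarrow> bool" where
  "has_nf f \<longleftrightarrow> (\<exists>c. keys c \<subseteq> lead_expos \<and> (\<forall>p\<in>Y. f p = combination c p))"

lemma combination_superset:
  "finite I \<Longrightarrow> keys c \<subseteq> I \<Longrightarrow> combination c p = (\<Sum>s\<in>I. lookup c s * basis_fun s p)"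
  unfolding combination_def by (rule sum.mono_neutral_left) (auto simp: in_keys_iff)

lemma combination_add: "combination (c + c') p = combination c p + combination c' p"
  using combination_superset[of "keys c \<union> keys c'" c p] combination_superset[of "keys c \<union> keys c'" c' p]
    combination_superset[of "keys c \<union> keys c'" "c + c'" p] Poly_Mapping.keys_add[of c c']
  by (simp add: sum.distrib[symmetric] lookup_add algebra_simps)

lemma has_nf_cong: "has_nf f \<Longrightarrow> (\<And>p. p \<in> Y \<Longrightarrow> g p = f p) \<Longrightarrow> has_nf g"
  by (force simp: has_nf_def)

lemma has_nf_add:
  assumes "has_nf f" "has_nf g" shows "has_nf (\<lambda>p. f p + g p)"
proof -
  obtain c c' where c: "keys c \<subseteq> lead_expos" "\<forall>p\<in>Y. f p = combination c p"
    "keys c' \<subseteq> lead_expos" "\<forall>p\<in>Y. g p = combination c' p"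
    using assms by (auto simp: has_nf_def)
  have "keys (c + c') \<subseteq> lead_expos" using c Poly_Mapping.keys_add[of c c'] by blast
  then show ?thesis unfolding has_nf_def using c by (intro exI[of _ "c + c'"]) (auto simp: combination_add)
qed

lemma has_nf_basis: "s \<in> lead_expos \<Longrightarrow> has_nf (\<lambda>p. c * basis_fun s p)"
  unfolding has_nf_def using combination_superset[of "{s}" "single s c"]
  by (intro exI[of _ "single s c"]) auto

lemma has_nf_0: "has_nf (\<lambda>p. 0)"
  unfolding has_nf_def by (intro exI[of _ 0]) (auto simp: combination_def)

lemma has_nf_sum: "(\<And>i. i \<in> I \<Longrightarrow> has_nf (f i)) \<Longrightarrow> has_nf (\<lambda>p. \<Sum>i\<in>I. f i p)"
  by (induction I rule: infinite_finite_induct) (auto intro: has_nf_add has_nf_0)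

lemma has_nf_monomial: "r < d \<Longrightarrow> has_nf (\<lambda>p. c * normal_monomial a b r p)"
  using has_nf_basis[OF basis_fun_expo(1)] basis_fun_expo(2) by metis

text \<open>
  By linearity a multiplier needs to be tested on normal monomials only.
\<close>

lemma has_nf_multiplier:
  assumes "\<And>c a b r. r < d \<Longrightarrow> has_nf (\<lambda>p. g p * (c * normal_monomial a b r p))" "has_nf f"
  shows "has_nf (\<lambda>p. g p * f p)"
proof -
  obtain c where c: "keys c \<subseteq> lead_expos" "\<forall>p\<in>Y. f p = combination c p"
    using assms by (auto simp: has_nf_def)
  have "has_nf (\<lambda>p. \<Sum>s\<in>keys c. g p * (lookup c s * basis_fun s p))"
    unfolding basis_fun_def using d2 by (intro has_nf_sum assms(1)) (simp add: nat_less_iff)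
  then show ?thesis
    by (rule has_nf_cong) (use c in \<open>simp add: combination_def sum_distrib_left\<close>)
qed

text \<open>
  Multiplication by \<open>z\<close> leaves the normal monomials only at \<open>z ^ (d - 1)\<close>; there the equation of the
  hypersurface replaces \<open>z ^ d\<close> by \<open>y 1\<close> times the tail and lower powers of \<open>z\<close>.
\<close>

lemma has_nf_times_polynomial: "g \<in> polynomial_funs m \<Longrightarrow> has_nf f \<Longrightarrow> has_nf (\<lambda>p. g p * f p)"
proof (induction arbitrary: f rule: polynomial_funs.induct)
  case (const c)
  show ?case
  proof (rule has_nf_multiplier[OF _ const])
    fix c' :: 'a and a b r assume "r < d"
    then show "has_nf (\<lambda>p. c * (c' * normal_monomial a b r p))"
      using has_nf_monomial[of r "c * c'" a b] by (simp add: mult.assoc)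
  qed
next
  case (coord_y i)
  show ?case
  proof (rule has_nf_multiplier[OF _ coord_y(2)])
    fix c :: 'a and a b r assume r: "r < d"
    show "has_nf (\<lambda>p. fst p i * (c * normal_monomial a b r p))"
    proof (cases "i = 1")
      case True
      then show ?thesis using has_nf_monomial[OF r, of c "Suc a" b]
        by (simp add: normal_monomial_def algebra_simps)
    next
      case False
      then have i: "i \<in> {2..m}" using coord_y by auto
      have "fst p i * (c * normal_monomial a b r p) = c * normal_monomial a (b(i := Suc (b i))) r p"
        for p :: "'a point"
      proof -
        have "(\<Prod>j\<in>{2..m}. fst p j ^ (b(i := Suc (b i))) j) = fst p i * (\<Prod>j\<in>{2..m}. fst p j ^ b j)"
          using i by (simp add: prod.remove[of _ i] mult.assoc)
        then show ?thesis unfolding normal_monomial_def by (simp only: mult_ac)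
      qed
      then show ?thesis using has_nf_monomial[OF r, of c a "b(i := Suc (b i))"]
        by (elim has_nf_cong)
    qed
  qed
next
  case coord_z
  show ?case
  proof (rule has_nf_multiplier[OF _ coord_z])
    fix c :: 'a and a b r assume r: "r < d"
    show "has_nf (\<lambda>p. snd p * (c * normal_monomial a b r p))"
    proof (cases "Suc r = d")
      case False
      then show ?thesis using has_nf_monomial[of "Suc r" c a b] r
        by (simp add: normal_monomial_def algebra_simps)
    next
      case True
      have "has_nf (\<lambda>p. c * normal_monomial (Suc a) (\<lambda>j. b j + k j) 0 p +
          (\<Sum>i<d. - c * coeff P i * normal_monomial a b i p))"
        by (rule has_nf_add[OF has_nf_monomial has_nf_sum[OF has_nf_monomial]]) (use d2 in auto)
      then show ?thesis
      proof (rule has_nf_cong)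
        fix p :: "'a point" assume p: "p \<in> Y"
        define w where "w = c * fst p 1 ^ a * (\<Prod>j\<in>{2..m}. fst p j ^ b j)"
        have "snd p * (c * normal_monomial a b r p) = w * (snd p ^ r * snd p)"
          unfolding normal_monomial_def w_def by (simp only: mult_ac)
        also have "snd p ^ r * snd p = snd p ^ d" using True by (metis power_Suc2)
        also have "w * snd p ^ d = w * (fst p 1 * tail (fst p)) - (\<Sum>i<d. w * (coeff P i * snd p ^ i))"
          by (simp only: Y_eq[OF p] P_reduce right_diff_distrib sum_distrib_left)
        also have "w * (fst p 1 * tail (fst p)) = c * normal_monomial (Suc a) (\<lambda>j. b j + k j) 0 p"
          unfolding normal_monomial_def w_def monomial_tail_def power_add prod.distrib
          by (simp add: mult_ac)
        also have "(\<Sum>i<d. w * (coeff P i * snd p ^ i)) = - (\<Sum>i<d. - c * coeff P i * normal_monomial a b i p)"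
          unfolding sum_negf[symmetric]
          by (rule sum.cong) (simp_all add: normal_monomial_def w_def mult_ac)
        finally show "snd p * (c * normal_monomial a b r p) = c * normal_monomial (Suc a) (\<lambda>j. b j + k j) 0 p +
          (\<Sum>i<d. - c * coeff P i * normal_monomial a b i p)" by simp
      qed
    qed
  qed
next
  case (add g h)
  then show ?case using has_nf_add[OF add.IH(1)[OF add.prems] add.IH(2)[OF add.prems]]
    by (simp add: algebra_simps)
next
  case (mult g h)
  then show ?case using mult.IH(1)[OF mult.IH(2)[OF mult.prems]] by (simp add: algebra_simps)
qed

lemma regular_has_nf: "regular f \<Longrightarrow> has_nf f"
proof -
  assume "regular f"
  then obtain g where g: "g \<in> polynomial_funs m" "\<forall>p\<in>Y. f p = g p" by (auto simp: regular_def)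
  have "has_nf (\<lambda>p. 1)"
    using has_nf_monomial[of 0 1 0 "\<lambda>_. 0"] d2 by (simp add: normal_monomial_def)
  from has_nf_times_polynomial[OF g(1) this] show ?thesis by (rule has_nf_cong) (use g in auto)
qed

subsection \<open>Laurent expansions\<close>

definition P_laurent :: "'a laurent" where
  "P_laurent = (\<Sum>i\<le>d. single (expo (int i) (\<lambda>_. 0)) (coeff P i))"

lemma leval_P: "leval t P_laurent = poly P (t 0)"
  by (simp add: P_laurent_def leval_sum P_expand char_val_expo)

lemma expo_less: "r < r' \<Longrightarrow> expo r b < expo r' b'"
  by (auto simp: less_poly_mapping.rep_eq less_fun_def lookup_expo intro!: exI[of _ 0])

lemma expo_add: "expo r b + expo r' b' = expo (r + r') (\<lambda>j. b j + b' j)"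
  by (rule poly_mapping_eqI) (auto simp: lookup_add lookup_expo)

lemma expo_0: "expo 0 (\<lambda>_. 0) = 0"
  by (rule poly_mapping_eqI) (auto simp: lookup_expo)

lemma lead_P: "lead P_laurent (expo (int d) (\<lambda>_. 0)) 1"
proof -
  have "lead P_laurent (expo (int d) (\<lambda>_. 0)) (\<Sum>i\<le>d. if i = d then 1 else 0)"
    unfolding P_laurent_def
  proof (rule lead_sum)
    fix i assume "i \<in> {..d}"
    then consider "i = d" | "i < d" by fastforce
    then show "lead (single (expo (int i) (\<lambda>_. 0)) (coeff P i)) (expo (int d) (\<lambda>_. 0)) (if i = d then 1 else 0)"
    proof cases
      case 1
      then show ?thesis using monic deg_P lead_single[of "expo (int d) (\<lambda>_. 0)" 1] by simp
    next
      case 2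
      then show ?thesis using lead_less[OF lead_single expo_less[of "int i" "int d"]] by simp
    qed
  qed simp
  then show ?thesis by simp
qed

lemma lead_P_power: "lead (P_laurent ^ a) (expo (int (a * d)) (\<lambda>_. 0)) 1"
proof (induction a)
  case 0
  show ?case using lead_1 by (simp add: expo_0)
next
  case (Suc a)
  show ?case using lead_mult[OF lead_P Suc] by (simp add: expo_add)
qed

definition basis_laurent :: "expo \<Rightarrow> 'a laurent" where
  "basis_laurent s = lmonom (expo (lookup s 0 mod int d) (lookup s)) * P_laurent ^ nat (lookup s 0 div int d)"

lemma lead_expos_div: "s \<in> lead_expos \<Longrightarrow> lookup s 0 div int d \<ge> 0"
  by (auto simp: lead_expos_def intro!: div_int_pos_iff[THEN iffD2])

lemma lead_basis:
  assumes s: "s \<in> lead_expos" shows "lead (basis_laurent s) s 1"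
proof -
  have "expo (lookup s 0 mod int d) (lookup s) + expo (int (nat (lookup s 0 div int d) * d)) (\<lambda>_. 0) = s"
    using s lead_expos_div[OF s]
    by (intro poly_mapping_eqI) (auto simp: expo_add lookup_expo lead_expos_def)
  then show ?thesis using lead_mult[OF lead_single[of "expo (lookup s 0 mod int d) (lookup s)" 1] lead_P_power]
    unfolding basis_laurent_def by (metis mult_1)
qed

text \<open>
  Multiplying both sides by a power of the tail clears the denominator of \<open>y 1\<close>.
\<close>

lemma leval_basis:
  assumes t: "nonvanishing t" and s: "s \<in> lead_expos"
  shows "leval t (basis_laurent s) = basis_fun s (torus_point t)"
proof -
  define a where "a = nat (lookup s 0 div int d)"
  define r where "r = nat (lookup s 0 mod int d)"
  have a: "lookup s 0 div int d = int a" and r: "lookup s 0 mod int d = int r"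
    using lead_expos_div[OF s] d2 by (auto simp: a_def r_def)
  have b: "t j powi lookup s j * t j ^ (k j * a) = t j ^ nat (lookup s j + int (k j) * int a)" if "j \<in> {2..m}" for j
  proof -
    have nn: "lookup s j + int (k j) * int a \<ge> 0" using s that by (auto simp: lead_expos_def a)
    have "t j powi lookup s j * t j powi int (k j * a) = t j powi (lookup s j + int (k j) * int a)"
      using t by (simp add: power_int_add nonvanishing_def)
    also have "\<dots> = t j ^ nat (lookup s j + int (k j) * int a)" using nn by (simp add: power_int_def)
    finally show ?thesis by (simp only: power_int_of_nat)
  qed
  have "leval t (basis_laurent s) * tail t ^ a = t 0 ^ r * poly P (t 0) ^ a *
      (\<Prod>j\<in>{2..m}. t j powi lookup s j * t j ^ (k j * a))"
    unfolding basis_laurent_def a r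
    by (simp add: leval_mult[OF t] leval_power[OF t] leval_P char_val_expo monomial_tail_def
        prod.distrib power_mult prod_power_distrib)
  also have "\<dots> = basis_fun s (torus_point t) * tail t ^ a"
    using tail_nonzero[OF t] unfolding basis_fun_def a r normal_monomial_def
    by (simp add: b power_divide)
  finally show ?thesis using tail_nonzero[OF t] by simp
qed

definition combination_laurent :: "'a laurent \<Rightarrow> 'a laurent" where
  "combination_laurent c = (\<Sum>s\<in>keys c. scal (lookup c s) * basis_laurent s)"

lemma leval_combination:
  assumes "nonvanishing t" "keys c \<subseteq> lead_expos"
  shows "leval t (combination_laurent c) = combination c (torus_point t)"
  unfolding combination_laurent_def combination_def leval_sum
  by (rule sum.cong) (use assms in \<open>auto simp: leval_mult leval_basis\<close>)

text \<open>
  The leading exponents of the basis are distinct, so the largest one cannot cancel.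
\<close>

lemma lead_combination:
  assumes c: "keys c \<subseteq> lead_expos" "c \<noteq> 0"
  shows "\<exists>u\<in>keys c. lead (combination_laurent c) u (lookup c u) \<and> (\<forall>s\<in>keys c. s \<le> u)"
proof -
  define u where "u = Max (keys c)"
  have ne: "keys c \<noteq> {}" using c(2) by (metis in_keys_iff lookup_zero poly_mapping_eqI ex_in_conv)
  have u: "u \<in> keys c" "\<And>s. s \<in> keys c \<Longrightarrow> s \<le> u" using ne by (auto simp: u_def)
  have "lead (combination_laurent c) u (\<Sum>s\<in>keys c. if s = u then lookup c u else 0)"
    unfolding combination_laurent_def
  proof (rule lead_sum)
    fix s assume s: "s \<in> keys c"
    have "lead (scal (lookup c s) * basis_laurent s) s (lookup c s)"
      using lead_mult[OF lead_single lead_basis, of s 0 "lookup c s"] s c by auto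
    then show "lead (scal (lookup c s) * basis_laurent s) u (if s = u then lookup c u else 0)"
      using u(2)[OF s] lead_less by (cases "s = u") (auto simp: le_less)
  qed simp
  moreover have "(\<Sum>s\<in>keys c. if s = u then lookup c u else 0) = lookup c u" using u by simp
  ultimately show ?thesis using u by auto
qed

definition laurent :: "('a point \<Rightarrow> 'a) \<Rightarrow> 'a laurent" where
  "laurent f = (THE b. \<forall>t. nonvanishing t \<longrightarrow> leval t b = f (torus_point t))"

lemma laurent_eqI:
  assumes "\<And>t. nonvanishing t \<Longrightarrow> leval t b = f (torus_point t)" shows "laurent f = b"
  unfolding laurent_def by (rule the_equality) (use assms in \<open>auto intro: leval_inject\<close>)

lemma regular_nf:
  assumes "regular f"
  obtains c where "keys c \<subseteq> lead_expos" "\<And>p. p \<in> Y \<Longrightarrow> f p = combination c p"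
    "laurent f = combination_laurent c"
proof -
  obtain c where c: "keys c \<subseteq> lead_expos" "\<And>p. p \<in> Y \<Longrightarrow> f p = combination c p"
    using regular_has_nf[OF assms] by (auto simp: has_nf_def)
  have "laurent f = combination_laurent c"
    by (rule laurent_eqI) (simp add: leval_combination c torus_point_in_Y)
  then show ?thesis using that c by blast
qed

lemma leval_laurent:
  assumes "regular f" "nonvanishing t" shows "leval t (laurent f) = f (torus_point t)"
  by (rule regular_nf[OF assms(1)]) (simp add: assms leval_combination torus_point_in_Y)

lemma laurent_add: "regular f \<Longrightarrow> regular g \<Longrightarrow> laurent (\<lambda>p. f p + g p) = laurent f + laurent g"
  by (rule laurent_eqI) (simp add: leval_add leval_laurent)

lemma laurent_mult: "regular f \<Longrightarrow> regular g \<Longrightarrow> laurent (\<lambda>p. f p * g p) = laurent f * laurent g"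
  by (rule laurent_eqI) (simp add: leval_mult leval_laurent)

lemma laurent_const: "laurent (\<lambda>p. c) = scal c"
  by (rule laurent_eqI) simp

lemma laurent_z: "laurent (\<lambda>p. snd p) = lmonom (single 0 1)"
  by (rule laurent_eqI) (simp only: leval_single char_val_single snd_torus_point power_int_1_right mult_1)

lemma laurent_y: "j \<in> {2..m} \<Longrightarrow> laurent (\<lambda>p. fst p j) = lmonom (single j 1)"
  by (rule laurent_eqI) simp

lemma laurent_tail: "laurent (\<lambda>p. tail (fst p)) = lmonom (expo 0 (\<lambda>j. int (k j)))"
  by (rule laurent_eqI) (simp add: char_val_expo monomial_tail_def)

lemma laurent_y1: "laurent (\<lambda>p. fst p 1) = lmonom (expo 0 (\<lambda>j. - int (k j))) * P_laurent"
  by (rule laurent_eqI)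
    (simp add: leval_mult leval_P char_val_expo monomial_tail_def power_int_minus prod_inversef[symmetric] divide_inverse mult.commute)

lemma laurent_cong: "(\<And>p. p \<in> Y \<Longrightarrow> f p = g p) \<Longrightarrow> laurent f = laurent g"
  unfolding laurent_def using torus_point_in_Y by metis

lemma laurent_eq_0D:
  assumes f: "regular f" "laurent f = 0" and p: "p \<in> Y" shows "f p = 0"
proof -
  obtain c where c: "keys c \<subseteq> lead_expos" "\<And>p. p \<in> Y \<Longrightarrow> f p = combination c p"
    "laurent f = combination_laurent c" using regular_nf[OF f(1)] by blast
  have "c = 0"
  proof (rule ccontr)
    assume "c \<noteq> 0"
    from lead_combination[OF c(1) this] obtain u where "u \<in> keys c" "lead (combination_laurent c) u (lookup c u)" by blast
    then show False using f(2) c(3) by (auto simp: lead_def in_keys_iff)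
  qed
  then show ?thesis using c(2)[OF p] by (simp add: combination_def)
qed

text \<open>
  Density of the torus points, by the injectivity of the Laurent expansion. This includes the points
  at which the tail and \<open>P\<close> both vanish and \<open>Y\<close> may be singular.
\<close>

lemma regular_eq_on_torus:
  assumes "regular f" "regular g" "\<And>t. nonvanishing t \<Longrightarrow> f (torus_point t) = g (torus_point t)" "p \<in> Y"
  shows "f p = g p"
proof -
  have "laurent (\<lambda>p. f p - g p) = 0" by (rule laurent_eqI) (simp add: assms)
  then have "f p - g p = 0" by (rule laurent_eq_0D[OF regular_diff[OF assms(1,2)] _ assms(4)])
  then show ?thesis by simp
qed

lemma laurent_inject:
  assumes "regular f" "regular g" "laurent f = laurent g" "p \<in> Y" shows "f p = g p"
  using leval_laurent[OF assms(1)] leval_laurent[OF assms(2)]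
  by (intro regular_eq_on_torus[OF assms(1,2) _ assms(4)]) (simp add: assms(3))

lemma lead_laurent:
  assumes "regular f" "laurent f \<noteq> 0"
  shows "\<exists>s\<in>lead_expos. \<exists>c. c \<noteq> 0 \<and> lead (laurent f) s c"
proof -
  obtain c where c: "keys c \<subseteq> lead_expos" "laurent f = combination_laurent c"
    using regular_nf[OF assms(1)] by blast
  then have "c \<noteq> 0" using assms(2) by (auto simp: combination_laurent_def)
  from lead_combination[OF c(1) this] c show ?thesis by (metis in_keys_iff subsetD)
qed

lemma lead_in_lead_expos:
  assumes "regular f" "lead (laurent f) u c" "c \<noteq> 0" shows "u \<in> lead_expos"
proof -
  have "laurent f \<noteq> 0" using assms lead_zero by metis
  from lead_laurent[OF assms(1) this] show ?thesis using assms lead_unique by blast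
qed

text \<open>
  The leading exponents determine the degree in \<open>z\<close>, and the normal monomials of degree below \<open>d\<close>
  are those without \<open>y 1\<close>.
\<close>

lemma regular_small_degree:
  assumes f: "regular f" and small: "\<And>u. u \<in> keys (laurent f) \<Longrightarrow> lookup u 0 < int n" and n: "n \<le> d"
  shows "\<exists>r. (\<forall>i. r i \<in> base_polys m) \<and> (\<forall>p\<in>Y. f p = (\<Sum>i<n. r i (fst p) * snd p ^ i))"
proof -
  obtain c where c: "keys c \<subseteq> lead_expos" "\<And>p. p \<in> Y \<Longrightarrow> f p = combination c p"
    "laurent f = combination_laurent c" using regular_nf[OF f] by blast
  define r where "r i y = (\<Sum>s\<in>{s\<in>keys c. lookup s 0 = int i}. lookup c s * (\<Prod>j\<in>{2..m}. y j ^ nat (lookup s j)))"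
    for i and y :: "nat \<Rightarrow> 'a"
  have r: "r i \<in> base_polys m" for i
    unfolding r_def by (intro base_polys_sum base_polys.mult base_polys.const base_polys_prod base_polys_power base_polys.coord)
  have lt: "0 \<le> lookup s 0 \<and> lookup s 0 < int n" if s: "s \<in> keys c" for s
  proof -
    have "c \<noteq> 0" using s by auto
    from lead_combination[OF c(1) this] obtain u where
      u: "u \<in> keys c" "lead (combination_laurent c) u (lookup c u)" "\<forall>s\<in>keys c. s \<le> u" by blast
    then have "u \<in> keys (laurent f)" using c(3) by (auto simp: lead_def in_keys_iff)
    then show ?thesis using small[of u] lex_le_0[of s u] u(3) s c(1) by (auto simp: lead_expos_def)
  qed
  have "f p = (\<Sum>i<n. r i (fst p) * snd p ^ i)" if p: "p \<in> Y" for p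
  proof -
    have b: "basis_fun s p = (\<Prod>j\<in>{2..m}. fst p j ^ nat (lookup s j)) * snd p ^ nat (lookup s 0)" if "s \<in> keys c" for s
      using lt[OF that] n by (simp add: basis_fun_def normal_monomial_def div_pos_pos_trivial mod_pos_pos_trivial)
    have "f p = (\<Sum>s\<in>keys c. lookup c s * ((\<Prod>j\<in>{2..m}. fst p j ^ nat (lookup s j)) * snd p ^ nat (lookup s 0)))"
      using c(2)[OF p] b by (simp add: combination_def)
    also have "\<dots> = (\<Sum>i<n. \<Sum>s\<in>{s\<in>keys c. nat (lookup s 0) = i}. lookup c s * ((\<Prod>j\<in>{2..m}. fst p j ^ nat (lookup s j)) * snd p ^ nat (lookup s 0)))"
      by (rule sum.group[symmetric]) (use lt in \<open>auto simp: nat_less_iff\<close>)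
    also have "\<dots> = (\<Sum>i<n. r i (fst p) * snd p ^ i)"
    proof (rule sum.cong[OF refl])
      fix i
      have "{s\<in>keys c. nat (lookup s 0) = i} = {s\<in>keys c. lookup s 0 = int i}" using lt by force
      then show "(\<Sum>s\<in>{s\<in>keys c. nat (lookup s 0) = i}. lookup c s * ((\<Prod>j\<in>{2..m}. fst p j ^ nat (lookup s j)) * snd p ^ nat (lookup s 0)))
         = r i (fst p) * snd p ^ i"
        by (simp add: r_def sum_distrib_right mult.assoc)
    qed
    finally show ?thesis .
  qed
  then show ?thesis using r by blast
qed

lemma regular_degree_zero:
  assumes "regular f" "\<And>u. u \<in> keys (laurent f) \<Longrightarrow> lookup u 0 \<le> 0"
  obtains b where "b \<in> base_polys m" "\<And>p. p \<in> Y \<Longrightarrow> f p = b (fst p)"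
  using regular_small_degree[OF assms(1), of 1] assms(2) d2 by force

text \<open>
  The leading exponents of \<open>f\<close> and \<open>g\<close> add up to zero, and \<open>lead_expos\<close> contains no pair of opposite
  vectors except \<open>0\<close>. So \<open>0\<close> is the largest index in the combination that represents \<open>f\<close>; as the
  smallest element of \<open>lead_expos\<close> it is the only index.
\<close>

lemma regular_unit_const:
  assumes f: "regular f" and g: "regular g" and fg: "\<And>p. p \<in> Y \<Longrightarrow> f p * g p = 1"
  shows "\<exists>c. c \<noteq> 0 \<and> (\<forall>p\<in>Y. f p = c)"
proof -
  have l: "laurent f * laurent g = 1"
    using laurent_mult[OF f g] laurent_cong[of "\<lambda>p. f p * g p" "\<lambda>p. 1"] fg laurent_const[of 1] by simp
  then have "laurent f \<noteq> 0" "laurent g \<noteq> 0" by auto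
  then obtain s a s' a' where s: "s \<in> lead_expos" "a \<noteq> 0" "lead (laurent f) s a"
    "s' \<in> lead_expos" "a' \<noteq> 0" "lead (laurent g) s' a'"
    using lead_laurent f g by meson
  have "s + s' = 0" using lead_unique[OF lead_mult[OF s(3,6)], of 0 1] lead_1 s l by auto
  then have e: "lookup s i + lookup s' i = 0" for i by (metis lookup_add lookup_zero)
  have "lookup s 0 \<ge> 0" "lookup s' 0 \<ge> 0" using s by (auto simp: lead_expos_def)
  then have z: "lookup s 0 = 0" "lookup s' 0 = 0" using e[of 0] by linarith+
  have "lookup s i \<ge> 0" "lookup s' i \<ge> 0" for i
    using s z by (cases "i \<in> insert 0 {2..m}"; auto simp: lead_expos_def)+
  then have "lookup s i = 0" for i using e[of i] by (simp add: add_nonneg_eq_0_iff)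
  then have "s = 0" by (intro poly_mapping_eqI) simp
  obtain c where c: "keys c \<subseteq> lead_expos" "\<And>p. p \<in> Y \<Longrightarrow> f p = combination c p"
    "laurent f = combination_laurent c" using regular_nf[OF f] by blast
  then have "c \<noteq> 0" using \<open>laurent f \<noteq> 0\<close> by (auto simp: combination_laurent_def)
  from lead_combination[OF c(1) this] obtain u where
    u: "u \<in> keys c" "lead (combination_laurent c) u (lookup c u)" "\<forall>s\<in>keys c. s \<le> u" by blast
  then have "u = 0" using lead_unique[of "laurent f" u "lookup c u" s a] s c(3) \<open>s = 0\<close> by (auto simp: in_keys_iff)
  have "v = 0" if v: "v \<in> keys c" for v
  proof (rule lex_nonneg_le_zero)
    show "v \<le> 0" using u v \<open>u = 0\<close> by auto
    then have "lookup v 0 = 0" using lex_le_0[of v 0] v c(1) by (auto simp: lead_expos_def)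
    then show "lookup v i \<ge> 0" for i using c(1) v by (cases "i \<in> insert 0 {2..m}") (auto simp: lead_expos_def)
  qed
  then have "keys c = {0}" using u by auto
  then have "combination c p = lookup c 0" for p
    by (simp add: combination_def basis_fun_def normal_monomial_def)
  then show ?thesis using c(2) \<open>keys c = {0}\<close> by (intro exI[of _ "lookup c 0"]) (auto simp: in_keys_iff)
qed

end

section \<open>The flow of the canonical derivation\<close>

lemma coeff_offset_poly_0: "coeff (offset_poly p z) 0 = poly p z"
  using poly_offset_poly[of p z 0] by (simp add: poly_0_coeff_0)

lemma coeff_offset_poly_1: "coeff (offset_poly p z) 1 = poly (pderiv p) z"
proof (induction p)
  case (pCons a p)
  then show ?case
    by (simp add: offset_poly_pCons pderiv_pCons coeff_offset_poly_0 flip: One_nat_def)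
      (simp add: coeff_offset_poly_0 add.commute)
qed (simp add: offset_poly_0)

lemma coeff_offset_poly_polynomial:
  fixes p :: "'a::comm_ring_1 poly"
  shows "\<exists>q. \<forall>z. coeff (offset_poly p z) i = poly q z"
proof (induction p arbitrary: i)
  case 0
  show ?case by (rule exI[of _ 0]) (simp add: offset_poly_0)
next
  case (pCons a p)
  obtain q where q: "\<And>z. coeff (offset_poly p z) i = poly q z" using pCons.IH[of i] by blast
  show ?case
  proof (cases i)
    case 0
    then show ?thesis by (intro exI[of _ "[:0, 1:] * q + [:a:]"]) (simp add: offset_poly_pCons q[symmetric])
  next
    case (Suc j)
    obtain r where r: "\<And>z. coeff (offset_poly p z) j = poly r z" using pCons.IH[of j] by blast
    show ?thesis using q r Suc by (intro exI[of _ "[:0, 1:] * q + r"]) (simp add: offset_poly_pCons)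
  qed
qed

context suspension
begin

lemma regular_coeff_offset: "regular (\<lambda>p. coeff (offset_poly P (snd p)) i)"
proof -
  obtain q where q: "\<And>z. coeff (offset_poly P z) i = poly q z" using coeff_offset_poly_polynomial by blast
  show ?thesis unfolding q by (intro regular_poly regular_z)
qed

lemma regular_tail: "regular (\<lambda>p. tail (fst p))" by (intro regular_base base_polys_tail)

text \<open>
  The flow \<open>z \<mapsto> z + \<tau> tail\<close> fixes the base and must send \<open>y 1\<close> to \<open>P (z + \<tau> tail) / tail\<close>. Expanding \<open>P\<close>
  around \<open>z\<close> and using \<open>y 1 = P z / tail\<close> leaves only terms divisible by the tail, which gives a
  polynomial expression that makes sense on all of \<open>Y\<close>.
\<close>

definition flow :: "'a \<Rightarrow> 'a point \<Rightarrow> 'a point" where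
  "flow \<tau> p = ((\<lambda>i\<in>{1..m}. if i = 1
      then fst p 1 + (\<Sum>i\<in>{1..d}. \<tau> ^ i * (tail (fst p) ^ (i - 1) * coeff (offset_poly P (snd p)) i))
      else fst p i), snd p + \<tau> * tail (fst p))"

lemma snd_flow: "snd (flow \<tau> p) = snd p + \<tau> * tail (fst p)" by (simp add: flow_def)

lemma fst_flow: "j \<in> {2..m} \<Longrightarrow> fst (flow \<tau> p) j = fst p j" by (auto simp: flow_def)

lemma fst_flow_1: "fst (flow \<tau> p) 1 = fst p 1 + (\<Sum>i\<in>{1..d}. \<tau> ^ i * (tail (fst p) ^ (i - 1) * coeff (offset_poly P (snd p)) i))"
  using m2 by (simp add: flow_def)

lemma tail_flow: "tail (fst (flow \<tau> p)) = tail (fst p)" by (rule tail_cong) (rule fst_flow)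

lemma base_flow: "b \<in> base_polys m \<Longrightarrow> b (fst (flow \<tau> p)) = b (fst p)"
  by (erule base_polys_cong) (rule fst_flow)

lemma flow_in_Y: assumes p: "p \<in> Y" shows "flow \<tau> p \<in> Y"
proof -
  let ?h = "\<lambda>i. coeff (offset_poly P (snd p)) i"
  have "poly P (snd p + \<tau> * tail (fst p)) = poly (offset_poly P (snd p)) (\<tau> * tail (fst p))"
    by (simp add: poly_offset_poly)
  also have "\<dots> = (\<Sum>i\<in>insert 0 {1..d}. ?h i * (\<tau> * tail (fst p)) ^ i)"
    unfolding poly_altdef by (rule sum.cong) (auto simp: deg_P)
  also have "\<dots> = poly P (snd p) + (\<Sum>i\<in>{1..d}. ?h i * (\<tau> * tail (fst p)) ^ i)"
    by (simp add: coeff_offset_poly_0)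
  also have "(\<Sum>i\<in>{1..d}. ?h i * (\<tau> * tail (fst p)) ^ i) =
      (\<Sum>i\<in>{1..d}. \<tau> ^ i * (tail (fst p) ^ (i - 1) * ?h i)) * tail (fst p)"
    unfolding sum_distrib_right
  proof (rule sum.cong[OF refl])
    fix i assume "i \<in> {1..d}"
    then obtain j where "i = Suc j" by (cases i) auto
    then show "?h i * (\<tau> * tail (fst p)) ^ i = \<tau> ^ i * (tail (fst p) ^ (i - 1) * ?h i) * tail (fst p)"
      by (simp add: power_mult_distrib mult_ac)
  qed
  finally have "fst (flow \<tau> p) 1 * tail (fst (flow \<tau> p)) = poly P (snd (flow \<tau> p))"
    unfolding tail_flow snd_flow fst_flow_1 distrib_right Y_eq[OF p] by simp
  moreover have "fst (flow \<tau> p) \<in> {1..m} \<rightarrow>\<^sub>E UNIV" by (simp add: flow_def)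
  ultimately show ?thesis by (simp only: Y_iff)
qed

lemma Y_eqI:
  assumes "p \<in> Y" "q \<in> Y" "fst p 1 = fst q 1" "\<And>j. j \<in> {2..m} \<Longrightarrow> fst p j = fst q j" "snd p = snd q"
  shows "p = q"
proof -
  have "fst p = fst q"
  proof (rule PiE_ext[of _ "{1..m}" "\<lambda>_. UNIV"])
    show "fst p i = fst q i" if "i \<in> {1..m}" for i using that assms by (cases "i = 1") auto
  qed (use assms in \<open>auto simp: Y_iff\<close>)
  then show ?thesis using assms(5) by (rule prod_eqI)
qed

lemma flow_0: assumes p: "p \<in> Y" shows "flow 0 p = p"
proof (rule Y_eqI)
  have "(\<Sum>i\<in>{1..d}. 0 ^ i * (tail (fst p) ^ (i - 1) * coeff (offset_poly P (snd p)) i)) = 0"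
    by (rule sum.neutral) auto
  then show "fst (flow 0 p) 1 = fst p 1" unfolding fst_flow_1 by simp
qed (simp_all add: p flow_in_Y fst_flow snd_flow)

text \<open>
  Where the tail vanishes, \<open>y 1\<close> moves linearly with constant velocity; elsewhere it is determined by
  the other coordinates.
\<close>

lemma flow_add: assumes p: "p \<in> Y" shows "flow s (flow t p) = flow (s + t) p"
proof (rule Y_eqI)
  have z: "snd (flow s (flow t p)) = snd (flow (s + t) p)"
    by (simp add: snd_flow tail_flow algebra_simps)
  then show "snd (flow s (flow t p)) = snd (flow (s + t) p)" .
  show "fst (flow s (flow t p)) 1 = fst (flow (s + t) p) 1"
  proof (cases "tail (fst p) = 0")
    case False
    have "fst (flow s (flow t p)) 1 * tail (fst p) = fst (flow (s + t) p) 1 * tail (fst p)"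
      using Y_eq[OF flow_in_Y[OF flow_in_Y[OF p]], of s t] Y_eq[OF flow_in_Y[OF p], of "s + t"] z
      by (simp add: tail_flow)
    then show ?thesis using False by simp
  next
    case True
    have S: "(\<Sum>i\<in>{1..d}. \<tau> ^ i * (0 ^ (i - 1) * h i)) = \<tau> * h 1" for \<tau> and h :: "nat \<Rightarrow> 'a"
    proof -
      have "(\<Sum>i\<in>{1..d}. \<tau> ^ i * (0 ^ (i - 1) * h i)) = (\<Sum>i\<in>{1..d}. if i = 1 then \<tau> * h 1 else 0)"
        by (rule sum.cong) auto
      also have "\<dots> = \<tau> * h 1" using d2 by simp
      finally show ?thesis .
    qed
    show ?thesis unfolding fst_flow_1 tail_flow snd_flow True mult_zero_right add_0_right S
      by (simp add: algebra_simps)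
  qed
qed (simp_all add: flow_in_Y p fst_flow)

text \<open>
  A function along an orbit of the flow is a polynomial in the time \<open>\<tau>\<close>.
\<close>

definition taylor :: "('a point \<Rightarrow> 'a) \<Rightarrow> 'a point \<Rightarrow> 'a poly" where
  "taylor f p = (THE q. \<forall>\<tau>. poly q \<tau> = f (flow \<tau> p))"

lemma taylor_eqI: "(\<And>\<tau>. poly q \<tau> = f (flow \<tau> p)) \<Longrightarrow> taylor f p = q"
  unfolding taylor_def
  by (rule the_equality) (auto simp: poly_eq_poly_eq_iff[symmetric] fun_eq_iff)

text \<open>
  The degree in \<open>\<tau>\<close> is bounded uniformly over \<open>Y\<close>; this makes the derivation below locally nilpotent.
\<close>

lemma regular_taylor_exists:
  assumes "regular f"
  shows "\<exists>q N. (\<forall>i. regular (\<lambda>p. coeff (q p) i)) \<and>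
    (\<forall>p\<in>Y. degree (q p) \<le> N \<and> (\<forall>\<tau>. poly (q p) \<tau> = f (flow \<tau> p)))"
proof -
  have "\<exists>q N. (\<forall>i. regular (\<lambda>p. coeff (q p) i)) \<and>
    (\<forall>p\<in>Y. degree (q p) \<le> N \<and> (\<forall>\<tau>. poly (q p) \<tau> = g (flow \<tau> p)))"
    if "g \<in> polynomial_funs m" for g
    using that
  proof induction
    case (const c)
    have "regular (\<lambda>p. coeff [:c:] i)" for i by (rule regular_const)
    then show ?case by (intro exI[of _ "\<lambda>_. [:c:]"] exI[of _ 0]) auto
  next
    case (coord_y i)
    show ?case
    proof (cases "i = 1")
      case False
      then have i: "i \<in> {2..m}" using coord_y by auto
      have "regular (\<lambda>p. coeff [:fst p i:] j)" for j
        using regular_y[OF coord_y] regular_const[of 0] by (cases j) auto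
      then show ?thesis using i by (intro exI[of _ "\<lambda>p. [:fst p i:]"] exI[of _ 0]) (auto simp: fst_flow)
    next
      case True
      define q where "q p = [:fst p 1:] + (\<Sum>i\<in>{1..d}. monom (tail (fst p) ^ (i - 1) * coeff (offset_poly P (snd p)) i) i)"
        for p :: "'a point"
      have "regular (\<lambda>p. coeff (q p) j)" for j
      proof -
        have r1: "regular (\<lambda>p. coeff [:fst p 1:] j)"
          using regular_y[of 1] m2 regular_const[of 0] by (cases j) auto
        have "regular (\<lambda>p. if i = j then tail (fst p) ^ (i - 1) * coeff (offset_poly P (snd p)) i else 0)" for i
          using regular_mult[OF regular_power[OF regular_tail] regular_coeff_offset, of "i - 1" i] regular_const[of 0]
          by (cases "i = j") simp_all
        then show ?thesis
          unfolding q_def coeff_add coeff_sum coeff_monom using r1 by (intro regular_add regular_sum) auto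
      qed
      moreover have "degree (q p) \<le> d" for p
        unfolding q_def by (intro degree_add_le degree_sum_le) (auto intro: order_trans[OF degree_monom_le])
      moreover have "poly (q p) \<tau> = fst (flow \<tau> p) 1" for p \<tau>
        unfolding q_def fst_flow_1 by (simp add: poly_sum poly_monom mult_ac)
      ultimately show ?thesis using True by blast
    qed
  next
    case coord_z
    have "regular (\<lambda>p. coeff [:snd p, tail (fst p):] j)" for j
    proof (cases j)
      case 0
      then show ?thesis using regular_z by simp
    next
      case (Suc i)
      then show ?thesis using regular_tail regular_const[of 0] by (cases i) auto
    qed
    moreover have "degree [:snd p, tail (fst p):] \<le> 1" for p by simp
    ultimately show ?case
      by (intro exI[of _ "\<lambda>p. [:snd p, tail (fst p):]"] exI[of _ 1]) (simp add: snd_flow)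
  next
    case (add f g)
    then obtain q N q' N' where
      "\<forall>i. regular (\<lambda>p. coeff (q p) i)" "\<forall>p\<in>Y. degree (q p) \<le> N \<and> (\<forall>\<tau>. poly (q p) \<tau> = f (flow \<tau> p))"
      "\<forall>i. regular (\<lambda>p. coeff (q' p) i)" "\<forall>p\<in>Y. degree (q' p) \<le> N' \<and> (\<forall>\<tau>. poly (q' p) \<tau> = g (flow \<tau> p))"
      by blast
    then show ?case
      by (intro exI[of _ "\<lambda>p. q p + q' p"] exI[of _ "max N N'"])
        (auto intro!: regular_add degree_add_le intro: max.coboundedI1 max.coboundedI2)
  next
    case (mult f g)
    then obtain q N q' N' where q:
      "\<forall>i. regular (\<lambda>p. coeff (q p) i)" "\<forall>p\<in>Y. degree (q p) \<le> N \<and> (\<forall>\<tau>. poly (q p) \<tau> = f (flow \<tau> p))"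
      "\<forall>i. regular (\<lambda>p. coeff (q' p) i)" "\<forall>p\<in>Y. degree (q' p) \<le> N' \<and> (\<forall>\<tau>. poly (q' p) \<tau> = g (flow \<tau> p))"
      by blast
    have "regular (\<lambda>p. coeff (q p * q' p) i)" for i
      unfolding coeff_mult using q by (intro regular_sum regular_mult) auto
    moreover have "degree (q p * q' p) \<le> N + N'" if "p \<in> Y" for p
      using q that by (intro order_trans[OF degree_mult_le] add_mono) auto
    moreover have "poly (q p * q' p) \<tau> = f (flow \<tau> p) * g (flow \<tau> p)" if "p \<in> Y" for p \<tau>
      using q that by simp
    ultimately show ?case
      by (intro exI[of _ "\<lambda>p. q p * q' p"] exI[of _ "N + N'"] conjI allI ballI)
  qed
  moreover obtain g where g: "g \<in> polynomial_funs m" "\<And>p. p \<in> Y \<Longrightarrow> f p = g p"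
    using assms by (auto simp: regular_def)
  ultimately obtain q N where "\<forall>i. regular (\<lambda>p. coeff (q p) i)"
    "\<forall>p\<in>Y. degree (q p) \<le> N \<and> (\<forall>\<tau>. poly (q p) \<tau> = g (flow \<tau> p))" by blast
  then show ?thesis using g(2)[OF flow_in_Y] by (intro exI[of _ q] exI[of _ N]) simp
qed

lemma regular_taylor:
  assumes "regular f"
  shows "p \<in> Y \<Longrightarrow> poly (taylor f p) \<tau> = f (flow \<tau> p)"
    and "regular (\<lambda>p. coeff (taylor f p) i)"
    and "\<exists>N. \<forall>p\<in>Y. degree (taylor f p) \<le> N"
proof -
  obtain q N where q: "\<And>i. regular (\<lambda>p. coeff (q p) i)"
    "\<And>p. p \<in> Y \<Longrightarrow> degree (q p) \<le> N" "\<And>p \<tau>. p \<in> Y \<Longrightarrow> poly (q p) \<tau> = f (flow \<tau> p)"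
    using regular_taylor_exists[OF assms] by blast
  have t: "taylor f p = q p" if "p \<in> Y" for p using q(3)[OF that] by (rule taylor_eqI)
  show "p \<in> Y \<Longrightarrow> poly (taylor f p) \<tau> = f (flow \<tau> p)" using t q(3) by simp
  show "regular (\<lambda>p. coeff (taylor f p) i)" using q(1)[of i] by (rule regular_cong) (simp add: t)
  show "\<exists>N. \<forall>p\<in>Y. degree (taylor f p) \<le> N"
    by (intro exI[of _ N]) (simp add: t q(2))
qed

lemma taylor_cong: "p \<in> Y \<Longrightarrow> (\<And>q. q \<in> Y \<Longrightarrow> f q = g q) \<Longrightarrow> taylor f p = taylor g p"
  unfolding taylor_def using flow_in_Y by simp

lemma taylor_restrict: "p \<in> Y \<Longrightarrow> taylor (restrict f Y) p = taylor f p"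
  by (rule taylor_cong) auto

lemma taylor_add: "regular f \<Longrightarrow> regular g \<Longrightarrow> p \<in> Y \<Longrightarrow> taylor (\<lambda>p. f p + g p) p = taylor f p + taylor g p"
  by (rule taylor_eqI) (simp add: regular_taylor(1))

lemma taylor_mult: "regular f \<Longrightarrow> regular g \<Longrightarrow> p \<in> Y \<Longrightarrow> taylor (\<lambda>p. f p * g p) p = taylor f p * taylor g p"
  by (rule taylor_eqI) (simp add: regular_taylor(1))

lemma taylor_base: "b \<in> base_polys m \<Longrightarrow> taylor (\<lambda>p. b (fst p)) p = [:b (fst p):]"
  by (rule taylor_eqI) (simp add: base_flow)

lemma taylor_const: "taylor (\<lambda>p. c) p = [:c:]"
  by (rule taylor_eqI) simp

lemma taylor_z: "taylor (\<lambda>p. snd p) p = [:snd p, tail (fst p):]"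
  by (rule taylor_eqI) (simp add: snd_flow)

lemma taylor_at_0: "regular f \<Longrightarrow> p \<in> Y \<Longrightarrow> coeff (taylor f p) 0 = f p"
  using regular_taylor(1)[of f p 0] by (simp add: flow_0 poly_0_coeff_0)

definition flow_deriv :: "('a point \<Rightarrow> 'a) \<Rightarrow> 'a point \<Rightarrow> 'a" where
  "flow_deriv = (\<lambda>f\<in>R. \<lambda>p\<in>Y. coeff (taylor f p) 1)"

lemma coord_ring_restrict: "f \<in> R \<Longrightarrow> restrict f Y = f"
  by (simp add: coord_ring_iff extensional_restrict)

lemma flow_deriv_apply: "regular f \<Longrightarrow> p \<in> Y \<Longrightarrow> flow_deriv (restrict f Y) p = coeff (taylor f p) 1"
  by (simp add: flow_deriv_def regular_iff[symmetric] taylor_restrict)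

lemma flow_deriv_coord_ring: "f \<in> R \<Longrightarrow> flow_deriv f \<in> R"
  unfolding flow_deriv_def by (auto simp: coord_ring_iff regular_taylor intro: regular_cong[OF regular_taylor(2)])

text \<open>
  By the flow property, the Taylor polynomial at a point of the orbit is the translated one.
\<close>

lemma taylor_flow_deriv:
  assumes f: "f \<in> R" and p: "p \<in> Y"
  shows "taylor (flow_deriv f) p = pderiv (taylor f p)"
proof (rule taylor_eqI)
  fix \<tau>
  have rf: "regular f" using f by (simp add: coord_ring_iff)
  have "taylor f (flow \<tau> p) = offset_poly (taylor f p) \<tau>"
    by (rule taylor_eqI) (simp add: poly_offset_poly regular_taylor(1)[OF rf p] flow_add[OF p] add.commute)
  then show "poly (pderiv (taylor f p)) \<tau> = flow_deriv f (flow \<tau> p)"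
    using f flow_in_Y[OF p] coeff_offset_poly_1[of "taylor f p" \<tau>] by (simp add: flow_deriv_def)
qed

lemma flow_deriv_power:
  assumes f: "f \<in> R"
  shows "(flow_deriv ^^ n) f \<in> R"
    and "p \<in> Y \<Longrightarrow> (flow_deriv ^^ n) f p = fact n * coeff (taylor f p) n"
proof -
  have 1: "(flow_deriv ^^ n) f \<in> R \<and> (\<forall>p\<in>Y. taylor ((flow_deriv ^^ n) f) p = (pderiv ^^ n) (taylor f p))"
    using f by (induction n) (auto simp: flow_deriv_coord_ring taylor_flow_deriv)
  then show "(flow_deriv ^^ n) f \<in> R" by simp
  assume p: "p \<in> Y"
  then have "(flow_deriv ^^ n) f p = coeff ((pderiv ^^ n) (taylor f p)) 0"
    using 1 taylor_at_0[OF _ p, of "(flow_deriv ^^ n) f"] by (simp add: coord_ring_iff)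
  then show "(flow_deriv ^^ n) f p = fact n * coeff (taylor f p) n"
    by (simp add: coeff_higher_pderiv pochhammer_fact)
qed

lemma flow_deriv_restrict: "regular f \<Longrightarrow> flow_deriv (restrict f Y) = (\<lambda>p\<in>Y. coeff (taylor f p) 1)"
  by (simp add: flow_deriv_def regular_iff[symmetric]) (auto simp: taylor_restrict)

lemma flow_deriv_derivation: "flow_deriv \<in> derivations m Y"
proof -
  have R: "regular f" "flow_deriv f p = coeff (taylor f p) 1" if "f \<in> R" "p \<in> Y" for f p
    using that by (auto simp: coord_ring_iff flow_deriv_def)
  have "flow_deriv \<in> R \<rightarrow>\<^sub>E R"
    using flow_deriv_coord_ring by (auto simp: flow_deriv_def)
  moreover have "flow_deriv (\<lambda>p\<in>Y. f p + g p) = (\<lambda>p\<in>Y. flow_deriv f p + flow_deriv g p)"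
    if f: "f \<in> R" and g: "g \<in> R" for f g
  proof -
    have r: "regular f" "regular g" using f g by (simp_all add: coord_ring_iff)
    show ?thesis unfolding flow_deriv_restrict[OF regular_add[OF r]]
      by (rule restrict_ext) (simp only: taylor_add[OF r] coeff_add R(2)[OF f] R(2)[OF g])
  qed
  moreover have "flow_deriv (\<lambda>p\<in>Y. f p * g p) = (\<lambda>p\<in>Y. flow_deriv f p * g p + f p * flow_deriv g p)"
    if f: "f \<in> R" and g: "g \<in> R" for f g
  proof -
    have r: "regular f" "regular g" using f g by (simp_all add: coord_ring_iff)
    show ?thesis unfolding flow_deriv_restrict[OF regular_mult[OF r]]
      by (rule restrict_ext)
        (simp add: taylor_mult[OF r] R(2)[OF f] R(2)[OF g] coeff_mult taylor_at_0 r)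
  qed
  moreover have "flow_deriv (\<lambda>p\<in>Y. c * f p) = (\<lambda>p\<in>Y. c * flow_deriv f p)"
    if f: "f \<in> R" for f c
  proof -
    have r: "regular f" using f by (simp add: coord_ring_iff)
    show ?thesis unfolding flow_deriv_restrict[OF regular_mult[OF regular_const r]]
      by (rule restrict_ext) (simp add: taylor_mult[OF regular_const r] taylor_const R(2)[OF f])
  qed
  ultimately show ?thesis by (simp add: derivations_def)
qed

lemma flow_deriv_lnd: "flow_deriv \<in> lnds m Y"
  unfolding lnds_def locally_nilpotent_def mem_Collect_eq
proof (intro conjI flow_deriv_derivation ballI)
  fix f assume f: "f \<in> R"
  then obtain N where N: "\<forall>p\<in>Y. degree (taylor f p) \<le> N"
    using regular_taylor(3)[of f] by (auto simp: coord_ring_iff)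
  have "(flow_deriv ^^ Suc N) f = (\<lambda>p\<in>Y. 0)"
  proof (rule extensionalityI[of _ Y])
    show "(flow_deriv ^^ Suc N) f \<in> extensional Y"
      using flow_deriv_power(1)[OF f, of "Suc N"] unfolding coord_ring_iff by blast
    fix p assume p: "p \<in> Y"
    then have "degree (taylor f p) < Suc N" using N by (simp add: le_imp_less_Suc)
    then have "coeff (taylor f p) (Suc N) = 0" by (rule coeff_eq_0)
    then show "(flow_deriv ^^ Suc N) f p = (\<lambda>p\<in>Y. 0) p"
      using flow_deriv_power(2)[OF f p, of "Suc N"] p by simp
  qed simp
  then show "\<exists>n. (flow_deriv ^^ n) f = (\<lambda>p\<in>Y. 0)" by blast
qed

lemma derivation_closed: "D \<in> derivations m Y \<Longrightarrow> regular f \<Longrightarrow> D (restrict f Y) \<in> R"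
  by (auto simp: derivations_def regular_iff)

lemma derivation_regular: "D \<in> derivations m Y \<Longrightarrow> regular f \<Longrightarrow> regular (D (restrict f Y))"
  using derivation_closed coord_ring_iff by blast

lemma derivation_add:
  assumes "D \<in> derivations m Y" "regular f" "regular g"
  shows "D (\<lambda>p\<in>Y. f p + g p) = (\<lambda>p\<in>Y. D (restrict f Y) p + D (restrict g Y) p)"
proof -
  have "restrict f Y \<in> R" "restrict g Y \<in> R" using assms regular_iff by blast+
  then have "D (\<lambda>p\<in>Y. restrict f Y p + restrict g Y p) = (\<lambda>p\<in>Y. D (restrict f Y) p + D (restrict g Y) p)"
    using assms(1) unfolding derivations_def by blast
  moreover have "(\<lambda>p\<in>Y. restrict f Y p + restrict g Y p) = (\<lambda>p\<in>Y. f p + g p)" by auto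
  ultimately show ?thesis by simp
qed

lemma derivation_mult:
  assumes "D \<in> derivations m Y" "regular f" "regular g"
  shows "D (\<lambda>p\<in>Y. f p * g p) = (\<lambda>p\<in>Y. D (restrict f Y) p * g p + f p * D (restrict g Y) p)"
proof -
  have "restrict f Y \<in> R" "restrict g Y \<in> R" using assms regular_iff by blast+
  then have "D (\<lambda>p\<in>Y. restrict f Y p * restrict g Y p) =
      (\<lambda>p\<in>Y. D (restrict f Y) p * restrict g Y p + restrict f Y p * D (restrict g Y) p)"
    using assms(1) unfolding derivations_def by blast
  moreover have "(\<lambda>p\<in>Y. restrict f Y p * restrict g Y p) = (\<lambda>p\<in>Y. f p * g p)" by auto
  moreover have "(\<lambda>p\<in>Y. D (restrict f Y) p * restrict g Y p + restrict f Y p * D (restrict g Y) p) =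
    (\<lambda>p\<in>Y. D (restrict f Y) p * g p + f p * D (restrict g Y) p)" by auto
  ultimately show ?thesis by simp
qed

lemma derivation_const:
  assumes D: "D \<in> derivations m Y" shows "D (\<lambda>p\<in>Y. c) = (\<lambda>p\<in>Y. 0)"
proof -
  have r: "restrict (\<lambda>p. 1) Y \<in> R" using regular_const regular_iff by blast
  have "D (\<lambda>p\<in>Y. 1 * 1) = (\<lambda>p\<in>Y. D (\<lambda>p\<in>Y. 1) p * 1 + 1 * D (\<lambda>p\<in>Y. 1) p)"
    by (rule derivation_mult[OF D regular_const regular_const])
  then have eq: "D (\<lambda>p\<in>Y. 1) = (\<lambda>p\<in>Y. D (\<lambda>p\<in>Y. 1) p + D (\<lambda>p\<in>Y. 1) p)"
    by (simp only: mult_1_left mult_1_right)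
  have one: "D (\<lambda>p\<in>Y. 1) p = 0" if p: "p \<in> Y" for p
    using fun_cong[OF eq, of p] unfolding restrict_apply'[OF p] by (metis add_cancel_right_right)
  have "D (\<lambda>p\<in>Y. c * restrict (\<lambda>p. 1) Y p) = (\<lambda>p\<in>Y. c * D (restrict (\<lambda>p. 1) Y) p)"
    using D r unfolding derivations_def by blast
  moreover have "(\<lambda>p\<in>Y. c * restrict (\<lambda>p. 1) Y p) = (\<lambda>p\<in>Y. c)" by auto
  ultimately have "D (\<lambda>p\<in>Y. c) = (\<lambda>p\<in>Y. c * D (\<lambda>p\<in>Y. 1) p)" by simp
  also have "\<dots> = (\<lambda>p\<in>Y. 0)" by (rule restrict_ext) (simp add: one)
  finally show ?thesis .
qed

text \<open>
  The coordinate functions generate the algebra.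
\<close>

lemma derivation_eqI:
  assumes D: "D \<in> derivations m Y" "D' \<in> derivations m Y"
    and y: "\<And>i. i \<in> {1..m} \<Longrightarrow> D (\<lambda>p\<in>Y. fst p i) = D' (\<lambda>p\<in>Y. fst p i)"
    and z: "D (\<lambda>p\<in>Y. snd p) = D' (\<lambda>p\<in>Y. snd p)"
  shows "D = D'"
proof (rule extensionalityI[of _ "R"])
  show "D \<in> extensional (R)" "D' \<in> extensional (R)"
    using D by (auto simp: derivations_def PiE_def)
  have "D (restrict f Y) = D' (restrict f Y)" if "f \<in> polynomial_funs m" for f
    using that
  proof induction
    case (const c)
    show ?case by (simp only: derivation_const[OF D(1)] derivation_const[OF D(2)])
  next
    case (add f g)
    then show ?case
      by (simp only: derivation_add[OF D(1)] derivation_add[OF D(2)] regular_polynomial)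
  next
    case (mult f g)
    then show ?case
      by (simp only: derivation_mult[OF D(1)] derivation_mult[OF D(2)] regular_polynomial)
  next
    case (coord_y i)
    then show ?case by (rule y)
  next
    case coord_z
    show ?case by (rule z)
  qed
  then show "D f = D' f" if "f \<in> R" for f using that by (auto simp: coord_ring_def)
qed

lemma flow_deriv_y1: "flow_deriv (\<lambda>p\<in>Y. fst p 1) = (\<lambda>p\<in>Y. poly (pderiv P) (snd p))"
proof (rule extensionalityI[of _ Y])
  have r: "regular (\<lambda>p. fst p 1)" using m2 by (intro regular_y) auto
  show "flow_deriv (\<lambda>p\<in>Y. fst p 1) \<in> extensional Y"
    using flow_deriv_coord_ring r regular_iff coord_ring_iff by blast
  fix p assume p: "p \<in> Y"
  define q where "q = [:fst p 1:] + (\<Sum>i\<in>{1..d}. monom (tail (fst p) ^ (i - 1) * coeff (offset_poly P (snd p)) i) i)"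
  have "taylor (\<lambda>p. fst p 1) p = q"
    by (rule taylor_eqI) (simp only: q_def fst_flow_1 poly_sum poly_monom poly_add, simp add: mult_ac)
  moreover have "coeff q 1 = (\<Sum>i\<in>{1..d}. if i = 1 then coeff (offset_poly P (snd p)) 1 else 0)"
    unfolding q_def coeff_add coeff_sum coeff_monom by (simp add: if_distrib cong: if_cong)
  then have "coeff q 1 = poly (pderiv P) (snd p)" using d2 coeff_offset_poly_1[of P "snd p"] by simp
  ultimately show "flow_deriv (\<lambda>p\<in>Y. fst p 1) p = (\<lambda>p\<in>Y. poly (pderiv P) (snd p)) p"
    using flow_deriv_apply[OF r p] p by simp
qed auto

lemma flow_deriv_z: "flow_deriv (\<lambda>p\<in>Y. snd p) = (\<lambda>p\<in>Y. tail (fst p))"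
proof (rule extensionalityI[of _ Y])
  show "flow_deriv (\<lambda>p\<in>Y. snd p) \<in> extensional Y"
    using flow_deriv_coord_ring regular_z regular_iff coord_ring_iff by blast
qed (auto simp: flow_deriv_apply[OF regular_z] taylor_z)

lemma flow_deriv_base: "b \<in> base_polys m \<Longrightarrow> flow_deriv (\<lambda>p\<in>Y. b (fst p)) = (\<lambda>p\<in>Y. 0)"
proof (rule extensionalityI[of _ Y])
  assume b: "b \<in> base_polys m"
  show "flow_deriv (\<lambda>p\<in>Y. b (fst p)) \<in> extensional Y"
    using flow_deriv_coord_ring regular_base[OF b] regular_iff coord_ring_iff by blast
  show "flow_deriv (\<lambda>p\<in>Y. b (fst p)) p = (\<lambda>p\<in>Y. 0) p" if "p \<in> Y" for p
    using that by (simp add: flow_deriv_apply[OF regular_base[OF b]] taylor_base[OF b])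
qed auto

text \<open>
  The derivation of the flow has the prescribed values on the coordinates, which determine it.
\<close>

lemma canonical_lnd_eq: "canonical_lnd m k P = flow_deriv"
proof -
  have fy: "flow_deriv (\<lambda>p\<in>Y. fst p j) = (\<lambda>p\<in>Y. 0)" if "j \<in> {2..m}" for j
    using flow_deriv_base[OF base_polys.coord[OF that]] .
  show ?thesis
    unfolding canonical_lnd_def case_prod_beta
  proof (rule the_equality)
    show "flow_deriv \<in> lnds m Y \<and>
      flow_deriv (\<lambda>p\<in>Y. fst p 1) = (\<lambda>p\<in>Y. poly (pderiv P) (snd p)) \<and>
      flow_deriv (\<lambda>p\<in>Y. snd p) = (\<lambda>p\<in>Y. tail (fst p)) \<and>
      (\<forall>j\<in>{2..m}. flow_deriv (\<lambda>p\<in>Y. fst p j) = (\<lambda>p\<in>Y. 0))"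
      using flow_deriv_lnd flow_deriv_y1 flow_deriv_z fy by blast
  next
    fix D assume D: "D \<in> lnds m Y \<and>
      D (\<lambda>p\<in>Y. fst p 1) = (\<lambda>p\<in>Y. poly (pderiv P) (snd p)) \<and>
      D (\<lambda>p\<in>Y. snd p) = (\<lambda>p\<in>Y. tail (fst p)) \<and>
      (\<forall>j\<in>{2..m}. D (\<lambda>p\<in>Y. fst p j) = (\<lambda>p\<in>Y. 0))"
    show "D = flow_deriv"
    proof (rule derivation_eqI)
      show "D \<in> derivations m Y" using D by (simp add: lnds_def)
      show "D (\<lambda>p\<in>Y. fst p i) = flow_deriv (\<lambda>p\<in>Y. fst p i)" if "i \<in> {1..m}" for i
        using D that flow_deriv_y1 fy[of i] by (cases "i = 1") auto
    qed (use D flow_deriv_z flow_deriv_derivation in auto)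
  qed
qed

subsection \<open>Exponentials\<close>

lemma regular_map_intro:
  assumes "\<And>p. p \<in> Y \<Longrightarrow> \<phi> p \<in> Y" "\<And>i. i \<in> {1..m} \<Longrightarrow> regular (\<lambda>p. fst (\<phi> p) i)" "regular (\<lambda>p. snd (\<phi> p))"
  shows "restrict \<phi> Y \<in> regular_maps m Y"
proof -
  have "(\<lambda>p\<in>Y. fst (restrict \<phi> Y p) i) = (\<lambda>p\<in>Y. fst (\<phi> p) i)" for i by auto
  moreover have "(\<lambda>p\<in>Y. snd (restrict \<phi> Y p)) = (\<lambda>p\<in>Y. snd (\<phi> p))" by auto
  ultimately show ?thesis using assms by (auto simp: regular_maps_def regular_iff)
qed

lemma automorphism_intro:
  assumes "\<And>p. p \<in> Y \<Longrightarrow> \<phi> p \<in> Y" "\<And>i. i \<in> {1..m} \<Longrightarrow> regular (\<lambda>p. fst (\<phi> p) i)" "regular (\<lambda>p. snd (\<phi> p))"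
    and "\<And>p. p \<in> Y \<Longrightarrow> \<psi> p \<in> Y" "\<And>i. i \<in> {1..m} \<Longrightarrow> regular (\<lambda>p. fst (\<psi> p) i)" "regular (\<lambda>p. snd (\<psi> p))"
    and inv: "\<And>p. p \<in> Y \<Longrightarrow> \<psi> (\<phi> p) = p" "\<And>p. p \<in> Y \<Longrightarrow> \<phi> (\<psi> p) = p"
  shows "restrict \<phi> Y \<in> automorphisms m Y"
proof -
  have bij: "bij_betw (restrict \<phi> Y) Y Y"
    by (rule bij_betw_byWitness[of _ \<psi>]) (use assms in auto)
  have "inv_into Y (restrict \<phi> Y) p = \<psi> p" if "p \<in> Y" for p
    by (rule inv_into_f_eq) (use that assms bij in \<open>auto simp: bij_betw_def\<close>)
  then have "restrict (inv_into Y (restrict \<phi> Y)) Y = restrict \<psi> Y" by auto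
  then show ?thesis
    using bij regular_map_intro[OF assms(1-3)] regular_map_intro[OF assms(4-6)]
    by (simp add: automorphisms_def Bij_def)
qed

definition shear :: "((nat \<Rightarrow> 'a) \<Rightarrow> 'a) \<Rightarrow> 'a point \<Rightarrow> 'a point" where
  "shear b = (\<lambda>p\<in>Y. flow (b (fst p)) p)"

lemma shear_automorphism: assumes b: "b \<in> base_polys m" shows "shear b \<in> automorphisms m Y"
proof -
  have bn: "(\<lambda>y. - b y) \<in> base_polys m" using base_polys.mult[OF base_polys.const[of "- 1"] b] by simp
  have reg: "regular (\<lambda>p. fst (flow (b (fst p)) p) i)" "regular (\<lambda>p. snd (flow (b (fst p)) p))"
    if "i \<in> {1..m}" "b \<in> base_polys m" for i b
  proof -
    show "regular (\<lambda>p. snd (flow (b (fst p)) p))"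
      unfolding snd_flow by (intro regular_add regular_z regular_mult regular_base base_polys_tail that)
    show "regular (\<lambda>p. fst (flow (b (fst p)) p) i)"
    proof (cases "i = 1")
      case True
      show ?thesis unfolding True fst_flow_1
        by (intro regular_add regular_sum regular_mult regular_power regular_tail regular_coeff_offset
            regular_base that regular_y) (use m2 in auto)
    next
      case False
      then show ?thesis using that fst_flow[of i] regular_y[of i] by auto
    qed
  qed
  have 1: "1 \<in> {1..m}" using m2 by auto
  show ?thesis unfolding shear_def
  proof (rule automorphism_intro[of _ "\<lambda>p. flow (- b (fst p)) p"])
    show "flow (- b (fst (flow (b (fst p)) p))) (flow (b (fst p)) p) = p" if "p \<in> Y" for p
      using that by (simp add: base_flow[OF b] flow_add flow_0)
    show "flow (b (fst (flow (- b (fst p)) p))) (flow (- b (fst p)) p) = p" if "p \<in> Y" for p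
      using that by (simp add: base_flow[OF b] flow_add flow_0)
  qed (use flow_in_Y in \<open>auto intro: reg(1)[OF _ b] reg(2)[OF 1 b] reg(1)[OF _ bn] reg(2)[OF 1 bn]\<close>)
qed

lemma scaled_flow_deriv_power:
  assumes b: "b \<in> base_polys m" and g: "g \<in> R"
  shows "(scale_der m Y (\<lambda>p\<in>Y. b (fst p)) flow_deriv ^^ n) g = (\<lambda>p\<in>Y. b (fst p) ^ n * (flow_deriv ^^ n) g p)"
proof (induction n)
  case 0
  show ?case using coord_ring_restrict[OF g] by simp
next
  case (Suc n)
  let ?h = "(flow_deriv ^^ n) g"
  have h: "?h \<in> R" by (rule flow_deriv_power(1)[OF g])
  have bn: "(\<lambda>y. b y ^ n) \<in> base_polys m" by (rule base_polys_power[OF b])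
  have r: "regular (\<lambda>p. b (fst p) ^ n)" "regular ?h" using regular_base[OF bn] h by (simp_all add: coord_ring_iff)
  have "flow_deriv (\<lambda>p\<in>Y. b (fst p) ^ n * ?h p) =
      (\<lambda>p\<in>Y. flow_deriv (\<lambda>p\<in>Y. b (fst p) ^ n) p * ?h p + b (fst p) ^ n * flow_deriv (restrict ?h Y) p)"
    by (rule derivation_mult[OF flow_deriv_derivation r])
  also have "\<dots> = (\<lambda>p\<in>Y. b (fst p) ^ n * flow_deriv ?h p)"
    unfolding coord_ring_restrict[OF h] using flow_deriv_base[OF bn] by auto
  finally have "flow_deriv (\<lambda>p\<in>Y. b (fst p) ^ n * ?h p) = (\<lambda>p\<in>Y. b (fst p) ^ n * flow_deriv ?h p)" .
  moreover have "(\<lambda>p\<in>Y. b (fst p) ^ n * ?h p) \<in> R"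
    using regular_mult[OF r] regular_iff by blast
  ultimately have "scale_der m Y (\<lambda>p\<in>Y. b (fst p)) flow_deriv (\<lambda>p\<in>Y. b (fst p) ^ n * ?h p) =
      (\<lambda>p\<in>Y. b (fst p) ^ Suc n * flow_deriv ?h p)"
    by (simp add: scale_der_def) (auto simp: mult.assoc)
  then show ?case by (simp only: funpow.simps o_apply Suc)
qed

text \<open>
  A function \<open>b\<close> on the base is constant along the flow. The exponential series of \<open>b \<partial>\<close> applied to \<open>g\<close> is
  therefore the Taylor polynomial of \<open>g\<close> evaluated at the time \<open>b\<close>.
\<close>

lemma shear_big_unipotent:
  assumes b: "b \<in> base_polys m" shows "shear b \<in> big_unipotent m Y (canonical_lnd m k P)"
proof -
  let ?f = "\<lambda>p\<in>Y. b (fst p)"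
  have "?f \<in> ker_der m Y flow_deriv"
    using regular_base[OF b] flow_deriv_base[OF b] by (simp add: ker_der_def regular_iff)
  moreover have "compose Y g (shear b) = exp_der m Y (scale_der m Y ?f flow_deriv) g" if g: "g \<in> R" for g
  proof (rule extensionalityI[of _ Y])
    fix p assume p: "p \<in> Y"
    have rg: "regular g" using g by (simp add: coord_ring_iff)
    have "exp_der m Y (scale_der m Y ?f flow_deriv) g p = Sum_any (\<lambda>n. coeff (taylor g p) n * b (fst p) ^ n)"
      using g p by (simp add: exp_der_def scaled_flow_deriv_power[OF b g] flow_deriv_power(2)[OF g p] mult.commute)
    also have "\<dots> = (\<Sum>n\<le>degree (taylor g p). coeff (taylor g p) n * b (fst p) ^ n)"
      by (rule Sum_any.expand_superset) (auto intro: le_degree)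
    also have "\<dots> = g (flow (b (fst p)) p)"
      using regular_taylor(1)[OF rg p, of "b (fst p)"] by (simp add: poly_altdef)
    finally show "compose Y g (shear b) p = exp_der m Y (scale_der m Y ?f flow_deriv) g p"
      using p by (simp add: compose_def shear_def)
  qed (use g in \<open>auto simp: compose_def exp_der_def\<close>)
  ultimately show ?thesis
    using shear_automorphism[OF b] by (auto simp: big_unipotent_def canonical_lnd_eq)
qed

end

section \<open>Locally nilpotent derivations annihilate the base\<close>

context suspension
begin

definition coords :: "nat set" where "coords = insert 0 {2..m}"

definition coordinate :: "nat \<Rightarrow> 'a point \<Rightarrow> 'a" where
  "coordinate i p = (if i = 0 then snd p else fst p i)"

lemma finite_coords [simp]: "finite coords" by (simp add: coords_def)

lemma sum_coords: "(\<Sum>i\<in>coords. h i) = h 0 + (\<Sum>j\<in>{2..m}. h j)"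
  by (simp add: coords_def)

lemma regular_coordinate: "i \<in> coords \<Longrightarrow> regular (coordinate i)"
  by (cases "i = 0") (auto simp: coords_def coordinate_def[abs_def] intro: regular_z regular_y)

lemma laurent_coordinate: "i \<in> coords \<Longrightarrow> laurent (coordinate i) = lmonom (single i 1)"
  using laurent_z laurent_y[of i] by (cases "i = 0") (auto simp: coords_def coordinate_def[abs_def])

lemma regular_induct [consumes 1, case_names const base fibre add mult cong]:
  assumes "regular f"
    and "\<And>c. Q (\<lambda>p. c)" "\<And>i. i \<in> coords \<Longrightarrow> Q (coordinate i)" "Q (\<lambda>p. fst p 1)"
    and "\<And>f g. regular f \<Longrightarrow> regular g \<Longrightarrow> Q f \<Longrightarrow> Q g \<Longrightarrow> Q (\<lambda>p. f p + g p)"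
    and "\<And>f g. regular f \<Longrightarrow> regular g \<Longrightarrow> Q f \<Longrightarrow> Q g \<Longrightarrow> Q (\<lambda>p. f p * g p)"
    and "\<And>f g. Q f \<Longrightarrow> (\<And>p. p \<in> Y \<Longrightarrow> f p = g p) \<Longrightarrow> Q g"
  shows "Q f"
proof -
  have "Q g" if "g \<in> polynomial_funs m" for g
    using that
  proof induction
    case (coord_y i)
    show ?case
    proof (cases "i = 1")
      case False
      then have "coordinate i = (\<lambda>p. fst p i)" "i \<in> coords" using coord_y by (auto simp: coordinate_def coords_def)
      then show ?thesis using assms(3)[of i] by simp
    qed (use assms(4) in simp)
  next
    case coord_z
    have "coordinate 0 = (\<lambda>p. snd p)" "0 \<in> coords" by (auto simp: coordinate_def coords_def)
    then show ?case using assms(3)[of 0] by simp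
  qed (auto intro: assms(2,5,6) regular_polynomial)
  moreover obtain g where "g \<in> polynomial_funs m" "\<forall>p\<in>Y. f p = g p" using assms(1) by (auto simp: regular_def)
  ultimately show ?thesis using assms(7)[of g f] by auto
qed

text \<open>
  With \<open>x i\<close> the coordinates, a derivation reads \<open>D = \<Sum> (D (x i) / x i) \<cdot> x i \<partial> / \<partial> x i\<close> on Laurent polynomials,
  and the Euler derivations \<open>x i \<partial> / \<partial> x i\<close> act diagonally on monomials. The symbol collects the
  coefficients.
\<close>

definition symbol :: "(('a point \<Rightarrow> 'a) \<Rightarrow> 'a point \<Rightarrow> 'a) \<Rightarrow> nat \<Rightarrow> 'a laurent" where
  "symbol D i = laurent (D (restrict (coordinate i) Y)) * lmonom (- single i 1)"

definition lift_deriv :: "(('a point \<Rightarrow> 'a) \<Rightarrow> 'a point \<Rightarrow> 'a) \<Rightarrow> 'a laurent \<Rightarrow> 'a laurent" where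
  "lift_deriv D b = (\<Sum>i\<in>coords. symbol D i * euler i b)"

lemma laurent_deriv_coordinate:
  "laurent (D (restrict (coordinate i) Y)) = symbol D i * lmonom (single i 1)"
  by (simp add: symbol_def mult.assoc mult_single)

lemma lift_deriv_add: "lift_deriv D (b + c) = lift_deriv D b + lift_deriv D c"
  by (simp add: lift_deriv_def euler_add algebra_simps sum.distrib)

lemma lift_deriv_mult: "lift_deriv D (b * c) = lift_deriv D b * c + b * lift_deriv D c"
  by (simp add: lift_deriv_def euler_mult algebra_simps sum.distrib sum_distrib_left)

lemma lift_deriv_single_coordinate:
  assumes "i \<in> coords" shows "lift_deriv D (lmonom (single i 1)) = symbol D i * lmonom (single i 1)"
proof -
  have "lift_deriv D (lmonom (single i 1)) = (\<Sum>j\<in>coords. if j = i then symbol D i * lmonom (single i 1) else 0)"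
    unfolding lift_deriv_def euler_single by (rule sum.cong) (auto simp: lookup_single_if)
  then show ?thesis using assms by simp
qed

lemma lift_deriv_scal: "lift_deriv D (scal c) = 0"
  by (simp add: lift_deriv_def)

lemma laurent_derivation:
  assumes D: "D \<in> derivations m Y" and f: "regular f"
  shows "laurent (D (restrict f Y)) = lift_deriv D (laurent f)"
proof -
  have reg: "regular (D (restrict f Y))" if "regular f" for f using derivation_regular[OF D that] .
  define Q where "Q f \<longleftrightarrow> regular f \<and> laurent (D (restrict f Y)) = lift_deriv D (laurent f)" for f
  have Qc: "Q g" if "Q f" "\<And>p. p \<in> Y \<Longrightarrow> f p = g p" for f g
  proof -
    have "restrict f Y = restrict g Y" using that(2) by auto
    moreover have "regular g" using that by (auto simp: Q_def intro: regular_cong)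
    ultimately show ?thesis using that laurent_cong[of f g] by (simp add: Q_def)
  qed
  have Qadd: "Q (\<lambda>p. f p + g p)" if "Q f" "Q g" for f g
  proof -
    have r: "regular f" "regular g" using that by (auto simp: Q_def)
    have "laurent (\<lambda>p\<in>Y. D (restrict f Y) p + D (restrict g Y) p) =
        laurent (\<lambda>p. D (restrict f Y) p + D (restrict g Y) p)" by (rule laurent_cong) simp
    then show ?thesis using that derivation_add[OF D r]
      by (simp add: Q_def regular_add laurent_add reg lift_deriv_add)
  qed
  have Dmult: "laurent (D (\<lambda>p\<in>Y. f p * g p)) = laurent (D (restrict f Y)) * laurent g + laurent f * laurent (D (restrict g Y))"
    if r: "regular f" "regular g" for f g
  proof -
    have "laurent (\<lambda>p\<in>Y. D (restrict f Y) p * g p + f p * D (restrict g Y) p) =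
        laurent (\<lambda>p. D (restrict f Y) p * g p + f p * D (restrict g Y) p)" by (rule laurent_cong) simp
    then show ?thesis using derivation_mult[OF D r] r
      by (simp add: regular_mult laurent_add laurent_mult reg)
  qed
  have Qmult: "Q (\<lambda>p. f p * g p)" if "Q f" "Q g" for f g
    using that by (simp add: Q_def Dmult regular_mult laurent_mult lift_deriv_mult)
  have Qconst: "Q (\<lambda>p. c)" for c
    using laurent_cong[of "\<lambda>p\<in>Y. 0" "\<lambda>p. 0"]
    by (simp add: Q_def regular_const derivation_const[OF D] laurent_const lift_deriv_scal)
  have Qcoord: "Q (coordinate i)" if "i \<in> coords" for i
    using that by (simp add: Q_def regular_coordinate laurent_coordinate laurent_deriv_coordinate lift_deriv_single_coordinate del: single_one)
  have Qz: "Q (\<lambda>p. snd p)" using Qcoord[of 0] by (simp add: coordinate_def[abs_def] coords_def)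
  have Qy: "Q (\<lambda>p. fst p j)" if "j \<in> {2..m}" for j
    using Qcoord[of j] that by (simp add: coordinate_def[abs_def] coords_def)
  have Qpow: "Q (\<lambda>p. f p ^ n)" if "Q f" for f n
    by (induction n) (auto intro: Qconst Qmult that)
  have Qsum: "Q (\<lambda>p. \<Sum>i\<in>I. f i p)" if "\<And>i. i \<in> I \<Longrightarrow> Q (f i)" for f and I :: "nat set"
    using that by (induction I rule: infinite_finite_induct) (auto intro: Qconst Qadd)
  have Qprod: "Q (\<lambda>p. \<Prod>i\<in>I. f i p)" if "\<And>i. i \<in> I \<Longrightarrow> Q (f i)" for f and I :: "nat set"
    using that by (induction I rule: infinite_finite_induct) (auto intro: Qconst Qmult)
  have Qtail: "Q (\<lambda>p. tail (fst p))"
    unfolding monomial_tail_def by (intro Qprod Qpow Qy)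
  have QP: "Q (\<lambda>p. poly P (snd p))"
    unfolding poly_altdef by (intro Qsum Qmult Qconst Qpow Qz)
  \<comment> \<open>The tail and \<open>P z\<close> avoid \<open>y 1\<close>, so the claim for \<open>y 1\<close> follows by cancelling the tail.\<close>
  have Qy1: "Q (\<lambda>p. fst p 1)"
  proof -
    have r: "regular (\<lambda>p. fst p 1)" "regular (\<lambda>p. tail (fst p))" using m2 regular_tail by (auto intro: regular_y)
    have "Q (\<lambda>p. fst p 1 * tail (fst p))"
      using QP by (rule Qc) (use Y_eq in force)
    then have "laurent (D (\<lambda>p\<in>Y. fst p 1)) * laurent (\<lambda>p. tail (fst p)) =
        lift_deriv D (laurent (\<lambda>p. fst p 1)) * laurent (\<lambda>p. tail (fst p))"
      using Qtail unfolding Q_def Dmult[OF r] laurent_mult[OF r] lift_deriv_mult by simp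
    moreover have "laurent (\<lambda>p. tail (fst p)) \<noteq> 0"
      unfolding laurent_tail by (metis lookup_single_eq lookup_zero zero_neq_one)
    ultimately show ?thesis using r by (simp add: Q_def)
  qed
  have "Q f" using f by (rule regular_induct) (auto intro: Qconst Qcoord Qy1 Qadd Qmult Qc)
  then show ?thesis by (simp add: Q_def)
qed

lemma laurent_derivation_power:
  assumes D: "D \<in> derivations m Y" and f: "regular f"
  shows "laurent ((D ^^ n) (restrict f Y)) = (lift_deriv D ^^ n) (laurent f)"
proof -
  have "(D ^^ n) (restrict f Y) \<in> R \<and> laurent ((D ^^ n) (restrict f Y)) = (lift_deriv D ^^ n) (laurent f)"
  proof (induction n)
    case 0
    have "restrict f Y \<in> R" using f regular_iff by blast
    moreover have "laurent (restrict f Y) = laurent f" by (rule laurent_cong) simp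
    ultimately show ?case by (simp only: funpow_0)
  next
    case (Suc n)
    define g where "g = (D ^^ n) (restrict f Y)"
    have gR: "g \<in> R" "laurent g = (lift_deriv D ^^ n) (laurent f)" using Suc unfolding g_def by blast+
    then have g: "regular g" "restrict g Y = g" using coord_ring_iff coord_ring_restrict by blast+
    then have "D g \<in> R" "laurent (D g) = lift_deriv D (laurent g)"
      using derivation_closed[OF D g(1)] laurent_derivation[OF D g(1)] by auto
    then show ?case using gR(2) by (simp only: funpow.simps o_apply g_def[symmetric])
  qed
  then show ?thesis by simp
qed

subsection \<open>The extremal part of a derivation\<close>

text \<open>
  The linear form by which the part of degree \<open>e\<close> of a derivation multiplies monomials.
\<close>

definition pairing :: "(nat \<Rightarrow> 'a) \<Rightarrow> expo \<Rightarrow> 'a" where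
  "pairing p u = (\<Sum>i\<in>coords. of_int (lookup u i) * p i)"

lemma pairing_add: "pairing p (u + v) = pairing p u + pairing p v"
  by (simp add: pairing_def lookup_add algebra_simps sum.distrib)

lemma pairing_single: "i \<in> coords \<Longrightarrow> pairing p (single i 1) = p i"
proof -
  assume "i \<in> coords"
  moreover have "pairing p (single i 1) = (\<Sum>j\<in>coords. if j = i then p i else 0)"
    unfolding pairing_def by (rule sum.cong) (auto simp: lookup_single_if)
  ultimately show ?thesis by simp
qed

lemma lead_lift_deriv:
  assumes e: "\<And>i v. i \<in> coords \<Longrightarrow> v \<in> keys (symbol D i) \<Longrightarrow> v \<le> e" and b: "lead b u c"
  shows "lead (lift_deriv D b) (e + u) (pairing (\<lambda>i. lookup (symbol D i) e) u * c)"
proof -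
  have "lead (lift_deriv D b) (e + u) (\<Sum>i\<in>coords. lookup (symbol D i) e * (of_int (lookup u i) * c))"
    unfolding lift_deriv_def
  proof (rule lead_sum)
    fix i assume i: "i \<in> coords"
    have "lead (symbol D i) e (lookup (symbol D i) e)" using e[OF i] by (simp add: lead_def)
    moreover have "lead (euler i b) u (of_int (lookup u i) * c)"
      using b by (auto simp: lead_def lookup_euler in_keys_iff)
    ultimately show "lead (symbol D i * euler i b) (e + u) (lookup (symbol D i) e * (of_int (lookup u i) * c))"
      by (rule lead_mult)
  qed simp
  moreover have "(\<Sum>i\<in>coords. lookup (symbol D i) e * (of_int (lookup u i) * c)) = pairing (\<lambda>i. lookup (symbol D i) e) u * c"
    by (simp add: pairing_def sum_distrib_right sum_distrib_left mult_ac)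
  ultimately show ?thesis by simp
qed

text \<open>
  The leading exponent of the \<open>n\<close>-th iterate sits at \<open>u + n e\<close> as long as its coefficient, a product
  of pairings, has not vanished; nilpotency forces one of the factors to vanish.
\<close>

lemma nilpotent_pairing_vanishes:
  assumes D: "D \<in> lnds m Y"
    and e: "\<And>i v. i \<in> coords \<Longrightarrow> v \<in> keys (symbol D i) \<Longrightarrow> v \<le> e"
    and f: "regular f" "lead (laurent f) u c" "c \<noteq> 0"
  shows "\<exists>n::nat. pairing (\<lambda>i. lookup (symbol D i) e) u + of_nat n * pairing (\<lambda>i. lookup (symbol D i) e) e = 0"
proof (rule ccontr)
  let ?p = "pairing (\<lambda>i. lookup (symbol D i) e)"
  assume *: "\<not> ?thesis"
  have lnd: "D \<in> derivations m Y" "locally_nilpotent m Y D" using D by (auto simp: lnds_def)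
  have "\<exists>c v. c \<noteq> 0 \<and> lead ((lift_deriv D ^^ n) (laurent f)) v c \<and> ?p v = ?p u + of_nat n * ?p e" for n
  proof (induction n)
    case 0
    show ?case using f by auto
  next
    case (Suc n)
    then obtain c v where cv: "c \<noteq> 0" "lead ((lift_deriv D ^^ n) (laurent f)) v c" "?p v = ?p u + of_nat n * ?p e" by blast
    then have "lead ((lift_deriv D ^^ Suc n) (laurent f)) (e + v) (?p v * c)" using lead_lift_deriv[of D e, OF e cv(2)] by simp
    moreover have "?p v \<noteq> 0" using * cv(3) by auto
    moreover have "?p (e + v) = ?p u + of_nat (Suc n) * ?p e" by (simp add: pairing_add cv(3) algebra_simps)
    ultimately show ?case using cv(1)
      by (intro exI[of _ "?p v * c"] exI[of _ "e + v"]) simp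
  qed
  moreover obtain N where "(D ^^ N) (restrict f Y) = (\<lambda>p\<in>Y. 0)"
    using lnd(2) f(1) regular_iff by (auto simp: locally_nilpotent_def)
  then have "(lift_deriv D ^^ N) (laurent f) = 0"
    using laurent_derivation_power[OF lnd(1) f(1), of N] laurent_cong[of "\<lambda>p\<in>Y. 0" "\<lambda>p. 0"]
    by (simp add: laurent_const)
  ultimately show False by (metis lead_zero)
qed

text \<open>
  The pairing of \<open>n\<close> with a leading exponent is the sum of its pairings with the exponents of the
  factors \<open>y 1\<close>, \<open>z\<close> and \<open>y i\<close> of the normal monomial, none of which is negative.
\<close>

lemma lead_expos_pairing_ge:
  fixes n :: "nat \<Rightarrow> nat"
  assumes s: "s \<in> lead_expos" and j: "j \<in> {2..m}"
    and n: "(\<Sum>j\<in>{2..m}. int (k j) * int (n j)) \<le> int d * int (n 0)"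
  shows "(lookup s 0 mod int d) * int (n 0) + (lookup s j + int (k j) * (lookup s 0 div int d)) * int (n j)
    \<le> (\<Sum>i\<in>coords. lookup s i * int (n i))"
proof -
  define a r where "a = lookup s 0 div int d" and "r = lookup s 0 mod int d"
  have a: "a \<ge> 0" "lookup s 0 = a * int d + r" using lead_expos_div[OF s] by (auto simp: a_def r_def)
  have "(lookup s j + int (k j) * a) * int (n j) \<le> (\<Sum>i\<in>{2..m}. (lookup s i + int (k i) * a) * int (n i))"
    by (rule member_le_sum) (use s j in \<open>auto simp: lead_expos_def a_def\<close>)
  also have "\<dots> = (\<Sum>i\<in>{2..m}. lookup s i * int (n i)) + a * (\<Sum>j\<in>{2..m}. int (k j) * int (n j))"
    by (simp add: algebra_simps sum.distrib sum_distrib_left)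
  also have "\<dots> \<le> (\<Sum>i\<in>{2..m}. lookup s i * int (n i)) + a * (int d * int (n 0))"
    using n a by (simp add: mult_left_mono)
  finally have "r * int (n 0) + (lookup s j + int (k j) * a) * int (n j) \<le>
      (a * int d + r) * int (n 0) + (\<Sum>i\<in>{2..m}. lookup s i * int (n i))"
    by (simp add: algebra_simps)
  then show ?thesis unfolding sum_coords a(2)[symmetric] unfolding a_def r_def .
qed

text \<open>
  The exponents \<open>e\<close> and \<open>n\<close> describe an extremal part \<open>\<chi> u \<mapsto> \<langle>n, u\<rangle> \<chi> (u + e)\<close> that maps the leading
  exponents into themselves. If \<open>n j > 0\<close> for some \<open>j \<ge> 2\<close>, then \<open>e + z\<close> and \<open>e + y j\<close> are both leading
  exponents; the first forces \<open>e 0 + 1\<close> to be divisible by \<open>d\<close>, and \<open>k j, d \<ge> 2\<close> then give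
  \<open>n j < n 0 < n j\<close>.
\<close>

lemma extremal_part_vertical:
  fixes n :: "nat \<Rightarrow> nat"
  assumes e: "(\<Sum>i\<in>coords. lookup e i * int (n i)) = -1"
    and n: "(\<Sum>j\<in>{2..m}. int (k j) * int (n j)) \<le> int d * int (n 0)"
    and mem: "\<And>i. i \<in> coords \<Longrightarrow> n i \<noteq> 0 \<Longrightarrow> e + single i 1 \<in> lead_expos"
  shows "lookup e 0 = -1"
proof -
  have pair: "(\<Sum>i\<in>coords. lookup (e + single l 1) i * int (n i)) = int (n l) - 1" if "l \<in> coords" for l
  proof -
    have "(\<Sum>i\<in>coords. lookup (single l 1) i * int (n i)) = (\<Sum>i\<in>coords. if i = l then int (n l) else 0)"
      by (rule sum.cong) (auto simp: lookup_single_if)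
    then show ?thesis using e that by (simp add: lookup_add algebra_simps sum.distrib)
  qed
  have n0: "n 0 > 0"
  proof (rule ccontr)
    assume "\<not> n 0 > 0"
    then have z: "n 0 = 0" by simp
    have "n j = 0" if "j \<in> {2..m}" for j
    proof -
      have "int (k j) * int (n j) \<le> (\<Sum>j\<in>{2..m}. int (k j) * int (n j))"
        by (rule member_le_sum) (use that in auto)
      then have "int (k j) * int (n j) \<le> 0" using n z by simp
      then have "k j * n j = 0" by (simp flip: of_nat_mult del: mult_eq_0_iff)
      then show ?thesis using k2[OF that] by simp
    qed
    then show False using e z by (simp add: sum_coords)
  qed
  have c0: "0 \<in> coords" by (simp add: coords_def)
  define s where "s = e + single 0 1"
  have s: "s \<in> lead_expos" "lookup s 0 = lookup e 0 + 1"
    using mem[OF c0] n0 by (auto simp: s_def lookup_add lookup_single_if simp del: single_one)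
  have sj: "lookup s j = lookup e j" if "j \<in> {2..m}" for j
    using that by (auto simp: s_def lookup_add lookup_single_if simp del: single_one)
  have spair: "(\<Sum>i\<in>coords. lookup s i * int (n i)) = int (n 0) - 1" using pair[OF c0] by (simp add: s_def)
  have nonneg: "lookup s j + int (k j) * (lookup s 0 div int d) \<ge> 0" if "j \<in> {2..m}" for j
    using s that by (auto simp: lead_expos_def)
  have two: "2 \<in> {2..m}" using m2 by simp
  have "(lookup s 0 mod int d) * int (n 0) < 1 * int (n 0)"
    using lead_expos_pairing_ge[OF s(1) two n] nonneg[OF two] unfolding spair
    by (smt (verit) mult_nonneg_nonneg of_nat_0_le_iff)
  then have "lookup s 0 mod int d < 1" using n0 by (simp only: mult_less_cancel_right)
  moreover have "lookup s 0 mod int d \<ge> 0" using d2 by simp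
  ultimately have mod0: "lookup s 0 mod int d = 0" by simp
  define a where "a = lookup s 0 div int d"
  have sa: "lookup e 0 + 1 = a * int d" using mod0 s(2) by (simp add: a_def mod_0_imp_dvd)
  have e0: "lookup e 0 = int d * (a - 1) + (int d - 1)" using sa by (simp add: algebra_simps)
  have e0': "lookup e 0 div int d = a - 1" "lookup e 0 mod int d = int d - 1"
    by (rule int_div_pos_eq[OF e0] int_mod_pos_eq[OF e0]; use d2 in simp)+
  have nj: "n j = 0" if j: "j \<in> {2..m}" for j
  proof (rule ccontr)
    assume nj: "n j \<noteq> 0"
    have cj: "j \<in> coords" using j by (simp add: coords_def)
    define t where "t = e + single j 1"
    have t: "t \<in> lead_expos" "lookup t 0 = lookup e 0" "lookup t j = lookup e j + 1"
      using mem[OF cj nj] j by (auto simp: t_def lookup_add lookup_single_if)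
    have tn: "lookup t j + int (k j) * (lookup t 0 div int d) \<ge> 0" using t(1) j by (auto simp: lead_expos_def)
    then have "lookup e j + int (k j) * a \<ge> int (k j) - 1" unfolding t e0' by (simp add: algebra_simps)
    then have "1 \<le> lookup s j + int (k j) * (lookup s 0 div int d)" using k2[OF j] sj[OF j] by (simp add: a_def)
    then have "int (n j) \<le> (lookup s j + int (k j) * (lookup s 0 div int d)) * int (n j)"
      using mult_right_mono[of 1 _ "int (n j)"] by simp
    also have "\<dots> \<le> int (n 0) - 1"
      using lead_expos_pairing_ge[OF s(1) j n] unfolding spair mod0 by simp
    finally have 1: "int (n j) \<le> int (n 0) - 1" .
    have "(int d - 1) * int (n 0) \<le> int (n j) - 1"
      using lead_expos_pairing_ge[OF t(1) j n] mult_nonneg_nonneg[OF tn, of "int (n j)"] pair[OF cj]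
      unfolding t_def[symmetric] by (simp add: t(2) e0'(2))
    moreover have "1 * int (n 0) \<le> (int d - 1) * int (n 0)" using d2 by (intro mult_right_mono) auto
    ultimately show False using 1 by simp
  qed
  then have "lookup e 0 * int (n 0) = -1" using e by (simp add: sum_coords)
  then have "int (n 0) dvd 1" by (metis dvd_minus_iff dvd_triv_right)
  then have "int (n 0) = 1" by (simp add: zdvd1_eq)
  then show ?thesis using \<open>lookup e 0 * int (n 0) = -1\<close> by simp
qed

theorem lnd_vertical:
  assumes D: "D \<in> lnds m Y"
  shows "\<And>j. j \<in> {2..m} \<Longrightarrow> D (\<lambda>p\<in>Y. fst p j) = (\<lambda>p\<in>Y. 0)"
    and "\<And>u. u \<in> keys (laurent (D (\<lambda>p\<in>Y. snd p))) \<Longrightarrow> lookup u 0 \<le> 0"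
proof -
  have der: "D \<in> derivations m Y" using D by (simp add: lnds_def)
  have neg: "lookup v 0 \<le> -1" if iv: "i \<in> coords" "v \<in> keys (symbol D i)" for i v
  proof -
    define V where "V = (\<Union>i\<in>coords. keys (symbol D i))"
    define e where "e = Max V"
    have V: "finite V" "V \<noteq> {}" using iv by (auto simp: V_def simp del: keys_eq_empty)
    then have "e \<in> V" by (simp add: e_def)
    have e: "v \<le> e" if "i \<in> coords" "v \<in> keys (symbol D i)" for i v
      unfolding e_def by (rule Max_ge[OF V(1)]) (use that in \<open>auto simp: V_def\<close>)
    define p where "p i = lookup (symbol D i) e" for i
    define w where "w = pairing p e"
    have pair: "\<exists>n::nat. pairing p u + of_nat n * w = 0" if "regular f" "lead (laurent f) u c" "c \<noteq> 0" for f u c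
      using nilpotent_pairing_vanishes[OF D e that] by (simp add: p_def[abs_def] w_def)
    have "\<exists>n::nat. p i + of_nat n * w = 0" if "i \<in> coords" for i
      using pair[OF regular_coordinate[OF that], of "single i 1" 1] pairing_single[OF that, of p]
        lead_single[of "single i 1" "1::'a"] laurent_coordinate[OF that] by simp
    then obtain n :: "nat \<Rightarrow> nat" where n: "\<And>i. i \<in> coords \<Longrightarrow> p i = - of_nat (n i) * w"
      by (metis add_eq_0_iff2 mult_minus_left)
    have w: "w \<noteq> 0"
    proof
      assume "w = 0"
      then have "p i = 0" if "i \<in> coords" for i using n[OF that] by simp
      then show False using \<open>e \<in> V\<close> by (auto simp: V_def p_def in_keys_iff)
    qed
    have pn: "pairing p u = - of_int (\<Sum>i\<in>coords. lookup u i * int (n i)) * w" for u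
    proof -
      have "pairing p u = (\<Sum>i\<in>coords. - (of_int (lookup u i * int (n i)) * w))"
        unfolding pairing_def by (rule sum.cong) (simp_all add: n)
      then show ?thesis by (simp add: sum_negf sum_distrib_right)
    qed
    define X where "X = (\<Sum>i\<in>coords. lookup e i * int (n i))"
    have "w = - of_int X * w" using pn[of e] by (simp only: w_def X_def)
    then have "w + of_int X * w = 0" by (metis add.left_inverse mult_minus_left)
    then have "of_int (X + 1) * w = 0" by (simp add: algebra_simps)
    then have "X + 1 = 0" using w by (metis mult_eq_0_iff of_int_eq_0_iff)
    then have E: "(\<Sum>i\<in>coords. lookup e i * int (n i)) = -1" by (simp add: X_def)
    have y1: "regular (\<lambda>p. fst p 1)" using m2 by (intro regular_y) auto
    have "lead (laurent (\<lambda>p. fst p 1)) (expo (int d) (\<lambda>j. - int (k j))) 1"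
      unfolding laurent_y1 using lead_mult[OF lead_single lead_P, of "expo 0 (\<lambda>j. - int (k j))" 1]
      by (simp add: expo_add)
    from pair[OF y1 this] obtain n1 :: nat where "pairing p (expo (int d) (\<lambda>j. - int (k j))) + of_nat n1 * w = 0" by auto
    then have "of_int (\<Sum>i\<in>coords. lookup (expo (int d) (\<lambda>j. - int (k j))) i * int (n i)) = (of_int (int n1) :: 'a)"
      using w unfolding pn by (simp add: algebra_simps)
    then have "(\<Sum>i\<in>coords. lookup (expo (int d) (\<lambda>j. - int (k j))) i * int (n i)) = int n1"
      by (simp only: of_int_eq_iff)
    then have N: "(\<Sum>j\<in>{2..m}. int (k j) * int (n j)) \<le> int d * int (n 0)"
      by (simp add: sum_coords lookup_expo sum_negf)
    have mem: "e + single i 1 \<in> lead_expos" if i: "i \<in> coords" and ni: "n i \<noteq> 0" for i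
    proof (rule lead_in_lead_expos)
      show "regular (D (restrict (coordinate i) Y))" by (rule derivation_regular[OF der regular_coordinate[OF i]])
      have "lead (symbol D i) e (p i)" using e[OF i] by (simp add: lead_def p_def)
      from lead_mult[OF this lead_single[of "single i 1" 1]]
      show "lead (laurent (D (restrict (coordinate i) Y))) (e + single i 1) (p i)"
        unfolding laurent_deriv_coordinate by simp
      show "p i \<noteq> 0" using n[OF i] ni w by simp
    qed
    have "lookup e 0 = -1" by (rule extremal_part_vertical[OF E N mem])
    then show ?thesis using lex_le_0[OF e[OF iv]] by simp
  qed
  have deg: "\<exists>v\<in>keys (symbol D i). u = v + single i 1"
    if "u \<in> keys (laurent (D (restrict (coordinate i) Y)))" for i u
    using that Poly_Mapping.keys_mult[of "symbol D i" "lmonom (single i 1)"]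
    unfolding laurent_deriv_coordinate by auto
  show "D (\<lambda>p\<in>Y. fst p j) = (\<lambda>p\<in>Y. 0)" if j: "j \<in> {2..m}" for j
  proof (rule extensionalityI[of _ Y])
    have cj: "j \<in> coords" and c: "coordinate j = (\<lambda>p. fst p j)" using j by (auto simp: coords_def coordinate_def)
    have reg: "regular (D (restrict (coordinate j) Y))" by (rule derivation_regular[OF der regular_coordinate[OF cj]])
    have "laurent (D (restrict (coordinate j) Y)) = 0"
    proof (rule ccontr)
      assume "laurent (D (restrict (coordinate j) Y)) \<noteq> 0"
      from lead_laurent[OF reg this] obtain s a where s: "s \<in> lead_expos" "a \<noteq> 0"
        "lead (laurent (D (restrict (coordinate j) Y))) s a" by blast
      then have "s \<in> keys (laurent (D (restrict (coordinate j) Y)))" by (auto simp: lead_def in_keys_iff)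
      from deg[OF this] obtain v where "v \<in> keys (symbol D j)" "s = v + single j 1" by blast
      then have "lookup s 0 \<le> -1" using neg[OF cj] j by (auto simp: lookup_add lookup_single_if)
      then show False using s(1) by (simp add: lead_expos_def)
    qed
    from laurent_eq_0D[OF reg this]
    show "D (\<lambda>p\<in>Y. fst p j) p = (\<lambda>p\<in>Y. 0) p" if "p \<in> Y" for p using that c by simp
    show "D (\<lambda>p\<in>Y. fst p j) \<in> extensional Y"
      using derivation_closed[OF der regular_coordinate[OF cj]] c coord_ring_iff by metis
  qed auto
  show "lookup u 0 \<le> 0" if u: "u \<in> keys (laurent (D (\<lambda>p\<in>Y. snd p)))" for u
  proof -
    have c: "0 \<in> coords" "coordinate 0 = (\<lambda>p. snd p)" by (auto simp: coords_def coordinate_def)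
    from deg[of u 0] u obtain v where v: "v \<in> keys (symbol D 0)" "u = v + single 0 1"
      unfolding c(2) by blast
    then show ?thesis using neg[OF c(1) v(1)] by (auto simp: lookup_add lookup_single_if simp del: single_one)
  qed
qed

end

section \<open>The shape of an automorphism\<close>

text \<open>
  A nonzero term \<open>V j l * W l j\<close> of the diagonal entry is the only possible one: nonnegativity and the
  vanishing of the off-diagonal entries clear the rest of row \<open>l\<close> of \<open>W\<close> and of row \<open>j\<close> of \<open>V\<close>.
\<close>

lemma nat_matrix_inverse_permutation:
  fixes V W :: "'i \<Rightarrow> 'i \<Rightarrow> nat"
  assumes "finite I"
    and VW: "\<And>i j. i \<in> I \<Longrightarrow> j \<in> I \<Longrightarrow> (\<Sum>l\<in>I. V j l * W l i) = (if i = j then 1 else 0)"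
    and WV: "\<And>i j. i \<in> I \<Longrightarrow> j \<in> I \<Longrightarrow> (\<Sum>l\<in>I. W j l * V l i) = (if i = j then 1 else 0)"
  shows "\<exists>\<sigma>. \<sigma> permutes I \<and> (\<forall>j\<in>I. \<forall>i\<in>I. V j i = (if i = \<sigma> j then 1 else 0))"
proof -
  have "\<exists>l\<in>I. (\<forall>i\<in>I. V j i = (if i = l then 1 else 0)) \<and> (\<forall>i\<in>I. W l i \<noteq> 0 \<longleftrightarrow> i = j)" if j: "j \<in> I" for j
  proof -
    have "(\<Sum>l\<in>I. V j l * W l j) \<noteq> 0" using VW[OF j j] by simp
    then obtain l where l: "l \<in> I" "V j l * W l j \<noteq> 0" by (meson sum.neutral)
    have W0: "W l i = 0" if i: "i \<in> I" "i \<noteq> j" for i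
    proof -
      have "V j l * W l i \<le> (\<Sum>l\<in>I. V j l * W l i)" by (rule member_le_sum) (use l assms(1) in auto)
      then have "V j l * W l i = 0" using VW[OF i(1) j] i(2) by simp
      then show ?thesis using l by simp
    qed
    have "W l j * V j i = (if i = l then 1 else 0)" if i: "i \<in> I" for i
    proof -
      have "(\<Sum>r\<in>I. W l r * V r i) = (\<Sum>r\<in>I. if r = j then W l j * V j i else 0)"
        by (rule sum.cong) (auto simp: W0)
      then show ?thesis using WV[OF i l(1)] j assms(1) by simp
    qed
    then have "V j i = (if i = l then 1 else 0)" if "i \<in> I" for i
      using that l(2) by (cases "i = l") (force split: if_splits)+
    moreover have "W l i \<noteq> 0 \<longleftrightarrow> i = j" if "i \<in> I" for i using l(2) W0 that by (cases "i = j") auto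
    ultimately show ?thesis using l(1) by blast
  qed
  then have "\<forall>j\<in>I. \<exists>l. l \<in> I \<and> (\<forall>i\<in>I. V j i = (if i = l then 1 else 0)) \<and> (\<forall>i\<in>I. W l i \<noteq> 0 \<longleftrightarrow> i = j)"
    by blast
  from bchoice[OF this] obtain s where "\<forall>j\<in>I. s j \<in> I \<and>
    (\<forall>i\<in>I. V j i = (if i = s j then 1 else 0)) \<and> (\<forall>i\<in>I. W (s j) i \<noteq> 0 \<longleftrightarrow> i = j)" by blast
  then have s: "\<And>j. j \<in> I \<Longrightarrow> s j \<in> I"
    "\<And>i j. j \<in> I \<Longrightarrow> i \<in> I \<Longrightarrow> V j i = (if i = s j then 1 else 0)"
    "\<And>i j. j \<in> I \<Longrightarrow> i \<in> I \<Longrightarrow> W (s j) i \<noteq> 0 \<longleftrightarrow> i = j" by blast+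
  define \<sigma> where "\<sigma> j = (if j \<in> I then s j else j)" for j
  have "inj_on s I" by (rule inj_onI) (metis s(3))
  then have "bij_betw s I I" using s(1) assms(1) by (intro bij_betw_imageI endo_inj_surj) auto
  then have "bij_betw \<sigma> I I" by (rule bij_betw_cong[THEN iffD1, rotated]) (simp add: \<sigma>_def)
  then have "\<sigma> permutes I" by (rule bij_imp_permutes) (simp add: \<sigma>_def)
  then show ?thesis using s(2) by (intro exI[of _ \<sigma>]) (auto simp: \<sigma>_def)
qed

context suspension
begin

subsection \<open>Degrees in \<open>z\<close>\<close>

lemma symbol_flow_deriv:
  "symbol flow_deriv 0 = lmonom (expo 0 (\<lambda>j. int (k j))) * lmonom (- single 0 1)"
  "j \<in> {2..m} \<Longrightarrow> symbol flow_deriv j = 0"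
proof -
  have c: "coordinate 0 = (\<lambda>p. snd p)" by (auto simp: coordinate_def)
  have "laurent (\<lambda>p\<in>Y. tail (fst p)) = lmonom (expo 0 (\<lambda>j. int (k j)))"
    unfolding laurent_tail[symmetric] by (rule laurent_cong) simp
  then show "symbol flow_deriv 0 = lmonom (expo 0 (\<lambda>j. int (k j))) * lmonom (- single 0 1)"
    unfolding symbol_def c flow_deriv_z by simp
  assume j: "j \<in> {2..m}"
  then have c: "coordinate j = (\<lambda>p. fst p j)" by (auto simp: coordinate_def)
  have "laurent (\<lambda>p\<in>Y. 0) = laurent (\<lambda>p. 0)" by (rule laurent_cong) simp
  then show "symbol flow_deriv j = 0"
    unfolding symbol_def c flow_deriv_base[OF base_polys.coord[OF j]] by (simp add: laurent_const)
qed

lemma laurent_vertical: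
  assumes D: "D \<in> lnds m Y" and f: "regular f"
  shows "laurent (D (restrict f Y)) = symbol D 0 * euler 0 (laurent f)"
proof -
  have der: "D \<in> derivations m Y" using D by (simp add: lnds_def)
  have "symbol D j = 0" if j: "j \<in> {2..m}" for j
  proof -
    have c: "coordinate j = (\<lambda>p. fst p j)" using j by (auto simp: coordinate_def)
    have "laurent (\<lambda>p\<in>Y. 0) = laurent (\<lambda>p. 0)" by (rule laurent_cong) simp
    then show ?thesis unfolding symbol_def c lnd_vertical(1)[OF D j] by (simp add: laurent_const)
  qed
  then show ?thesis unfolding laurent_derivation[OF der f] lift_deriv_def sum_coords by simp
qed

lemma laurent_tail_mult_keys:
  assumes f: "regular f" and g: "\<And>p. p \<in> Y \<Longrightarrow> tail (fst p) * f p = g p"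
    and u: "u \<in> keys (laurent f)"
  shows "\<exists>v\<in>keys (laurent g). lookup v 0 = lookup u 0"
proof -
  let ?\<kappa> = "expo 0 (\<lambda>j. int (k j))"
  have "laurent g = lmonom ?\<kappa> * laurent f"
    using laurent_mult[OF regular_tail f] laurent_cong[OF g] by (simp add: laurent_tail)
  then have "laurent f = lmonom (- ?\<kappa>) * laurent g" by (simp add: mult_single flip: mult.assoc)
  then have "u \<in> keys (lmonom (- ?\<kappa>) * laurent g)" using u by simp
  then obtain v where "v \<in> keys (laurent g)" "u = - ?\<kappa> + v"
    using Poly_Mapping.keys_mult[of "lmonom (- ?\<kappa>)" "laurent g"] by auto
  then show ?thesis by (intro bexI[of _ v]) (auto simp: lookup_add lookup_minus lookup_expo)
qed

text \<open>
  On Laurent polynomials \<open>\<partial>\<close> is a unit times the Euler derivation of \<open>z\<close>.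
\<close>

lemma kernel_degree_zero:
  assumes f: "regular f" and k: "\<And>p. p \<in> Y \<Longrightarrow> flow_deriv (restrict f Y) p = 0" and u: "u \<in> keys (laurent f)"
  shows "lookup u 0 = 0"
proof -
  have "laurent (flow_deriv (restrict f Y)) = laurent (\<lambda>p. 0)" by (rule laurent_cong) (rule k)
  then have "symbol flow_deriv 0 * euler 0 (laurent f) = 0"
    using laurent_vertical[OF flow_deriv_lnd f] by (simp add: laurent_const)
  moreover have "symbol flow_deriv 0 \<noteq> 0"
    unfolding symbol_flow_deriv mult_single by (metis lookup_single_eq lookup_zero mult_1 zero_neq_one)
  ultimately have "euler 0 (laurent f) = 0" by simp
  then have "of_int (lookup u 0) * lookup (laurent f) u = 0" by (metis lookup_euler lookup_zero)
  then show ?thesis using u by (simp add: in_keys_iff)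
qed

lemma base_keys: "b \<in> base_polys m \<Longrightarrow> u \<in> keys (laurent (\<lambda>p. b (fst p))) \<Longrightarrow> lookup u 0 = 0"
  by (rule kernel_degree_zero[OF regular_base]) (simp_all add: flow_deriv_base)

lemma kernel_base:
  assumes f: "regular f" and k: "\<And>p. p \<in> Y \<Longrightarrow> flow_deriv (restrict f Y) p = 0"
  obtains b where "b \<in> base_polys m" "\<And>p. p \<in> Y \<Longrightarrow> f p = b (fst p)"
proof (rule regular_degree_zero[OF f])
  show "lookup u 0 \<le> 0" if "u \<in> keys (laurent f)" for u using kernel_degree_zero[OF f k that] by simp
qed (use that in blast)

lemma base_expansion_keys:
  assumes b: "\<And>i. i < n \<Longrightarrow> b i \<in> base_polys m"
    and u: "u \<in> keys (laurent (\<lambda>p. \<Sum>i<n. b i (fst p) * snd p ^ i))"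
  shows "lookup u 0 < int n"
proof -
  have "laurent (\<lambda>p. \<Sum>i<n. b i (fst p) * snd p ^ i) =
      (\<Sum>i<n. laurent (\<lambda>p. b i (fst p)) * lmonom (expo (int i) (\<lambda>_. 0)))"
    by (rule laurent_eqI) (simp add: leval_sum leval_mult leval_laurent[OF regular_base[OF b]] char_val_expo)
  then obtain i where i: "i < n" "u \<in> keys (laurent (\<lambda>p. b i (fst p)) * lmonom (expo (int i) (\<lambda>_. 0)))"
    using u Poly_Mapping.keys_sum[of "\<lambda>i. laurent (\<lambda>p. b i (fst p)) * lmonom (expo (int i) (\<lambda>_. 0))" "{..<n}"] by auto
  then obtain v where "v \<in> keys (laurent (\<lambda>p. b i (fst p)))" "u = v + expo (int i) (\<lambda>_. 0)"
    using Poly_Mapping.keys_mult[of "laurent (\<lambda>p. b i (fst p))" "lmonom (expo (int i) (\<lambda>_. 0))"] by auto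
  then show ?thesis using i(1) base_keys[OF b[OF i(1)]] by (simp add: lookup_add lookup_expo)
qed

text \<open>
  Comparing coefficients of \<open>z\<close> is possible over each fixed point of the torus of the base.
\<close>

lemma base_expansion_coeff:
  assumes b: "\<And>i. i < n \<Longrightarrow> b i \<in> base_polys m" and c: "\<And>i. i < n \<Longrightarrow> c i \<in> base_polys m"
    and eq: "\<And>p. p \<in> Y \<Longrightarrow> (\<Sum>i<n. b i (fst p) * snd p ^ i) = (\<Sum>i<n. c i (fst p) * snd p ^ i)"
    and t: "nonvanishing t" and i: "i < n"
  shows "b i t = c i t"
proof -
  define q where "q h = (\<Sum>i<n. monom (h i t) i)" for h :: "nat \<Rightarrow> (nat \<Rightarrow> 'a) \<Rightarrow> 'a"
  have "poly (q b) x = poly (q c) x" if x: "x \<noteq> 0" for x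
  proof -
    define s where "s = t(0 := x)"
    have s: "nonvanishing s" using t x by (auto simp: nonvanishing_def s_def)
    have h: "h (fst (torus_point s)) = h t" if "h \<in> base_polys m" for h
      by (rule base_polys_cong[OF that]) (auto simp: s_def)
    have "(\<Sum>i<n. b i t * x ^ i) = (\<Sum>i<n. c i t * x ^ i)"
      using eq[OF torus_point_in_Y[OF s]] h[OF b] h[OF c] by (simp add: s_def)
    then show ?thesis by (simp add: q_def poly_sum poly_monom)
  qed
  then have "q b = q c" by (rule poly_eq_on_nonzero)
  moreover have "coeff (q h) i = h i t" for h
    using i by (simp add: q_def coeff_sum coeff_monom)
  ultimately show ?thesis by metis
qed

lemma base_eq_on_torus:
  assumes "b \<in> base_polys m" "c \<in> base_polys m" "\<And>t. nonvanishing t \<Longrightarrow> b t = c t" "p \<in> Y"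
  shows "b (fst p) = c (fst p)"
proof (rule regular_eq_on_torus[OF regular_base[OF assms(1)] regular_base[OF assms(2)] _ assms(4)])
  fix t :: "nat \<Rightarrow> 'a" assume t: "nonvanishing t"
  have "h (fst (torus_point t)) = h t" if "h \<in> base_polys m" for h
    by (rule base_polys_cong[OF that]) auto
  from this[OF assms(1)] this[OF assms(2)] show "b (fst (torus_point t)) = c (fst (torus_point t))"
    using assms(3)[OF t] by simp
qed

lemma base_torus_point: "b \<in> base_polys m \<Longrightarrow> b (fst (torus_point t)) = b t"
  by (erule base_polys_cong) auto

lemma torus_monomial_inject:
  fixes a b :: 'a
  assumes "\<And>t. nonvanishing t \<Longrightarrow> a * (\<Prod>j\<in>{2..m}. t j ^ e j) = b * (\<Prod>j\<in>{2..m}. t j ^ f j)"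
    and "a \<noteq> 0" "j \<in> {2..m}"
  shows "e j = f j"
proof -
  have "single (expo 0 (\<lambda>j. int (e j))) a = single (expo 0 (\<lambda>j. int (f j))) b"
    by (rule leval_inject) (simp add: char_val_expo assms(1))
  from arg_cong[OF this, of "\<lambda>b. lookup b (expo 0 (\<lambda>j. int (e j)))"]
  have "expo 0 (\<lambda>j. int (e j)) = expo 0 (\<lambda>j. int (f j))"
    using assms(2) unfolding lookup_single_if by (simp split: if_splits)
  then have "lookup (expo 0 (\<lambda>j. int (e j))) j = lookup (expo 0 (\<lambda>j. int (f j))) j" by simp
  then show ?thesis using assms(3) by (simp add: lookup_expo)
qed

subsection \<open>Conjugates of the canonical derivation\<close>

text \<open>
  What is needed of an automorphism and its inverse, in a form symmetric in the two, so that every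
  result can be applied to the inverse as well.
\<close>

definition inverse_pair :: "('a point \<Rightarrow> 'a point) \<Rightarrow> ('a point \<Rightarrow> 'a point) \<Rightarrow> bool" where
  "inverse_pair \<phi> \<psi> \<longleftrightarrow> (\<forall>p\<in>Y. \<phi> p \<in> Y \<and> \<psi> p \<in> Y \<and> \<psi> (\<phi> p) = p \<and> \<phi> (\<psi> p) = p) \<and>
     (\<forall>f. regular f \<longrightarrow> regular (\<lambda>p. f (\<phi> p)) \<and> regular (\<lambda>p. f (\<psi> p)))"

lemma inverse_pair_sym: "inverse_pair \<phi> \<psi> \<Longrightarrow> inverse_pair \<psi> \<phi>"
  by (auto simp: inverse_pair_def)

lemma regular_comp:
  assumes "\<phi> \<in> regular_maps m Y" "regular f" shows "regular (\<lambda>p. f (\<phi> p))"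
proof -
  have "compose Y (restrict f Y) \<phi> \<in> R"
    using assms regular_iff by (intro coord_ring_comp_regular) auto
  moreover have "compose Y (restrict f Y) \<phi> = (\<lambda>p\<in>Y. f (\<phi> p))"
    using assms(1) by (auto simp: compose_def regular_maps_def intro!: restrict_ext)
  ultimately show ?thesis by (simp add: regular_iff)
qed

lemma automorphism_inverse_pair:
  assumes \<phi>: "\<phi> \<in> automorphisms m Y"
  obtains \<psi> where "inverse_pair \<phi> \<psi>"
proof
  have bij: "bij_betw \<phi> Y Y" using \<phi> by (simp add: automorphisms_def Bij_def)
  have r: "\<phi> \<in> regular_maps m Y" "restrict (inv_into Y \<phi>) Y \<in> regular_maps m Y"
    using \<phi> by (simp_all add: automorphisms_def)
  have "\<phi> p \<in> Y" "restrict (inv_into Y \<phi>) Y p \<in> Y" "restrict (inv_into Y \<phi>) Y (\<phi> p) = p"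
    "\<phi> (restrict (inv_into Y \<phi>) Y p) = p" if "p \<in> Y" for p
    using that bij by (auto simp: bij_betw_def inv_into_into f_inv_into_f)
  then show "inverse_pair \<phi> (restrict (inv_into Y \<phi>) Y)"
    using regular_comp[OF r(1)] regular_comp[OF r(2)] unfolding inverse_pair_def by blast
qed

definition conjugate :: "('a point \<Rightarrow> 'a point) \<Rightarrow> ('a point \<Rightarrow> 'a point) \<Rightarrow> ('a point \<Rightarrow> 'a) \<Rightarrow> 'a point \<Rightarrow> 'a" where
  "conjugate \<phi> \<psi> = (\<lambda>f\<in>R. \<lambda>p\<in>Y. flow_deriv (\<lambda>q\<in>Y. f (\<phi> q)) (\<psi> p))"

lemma conjugate_apply:
  assumes pair: "inverse_pair \<phi> \<psi>" and f: "regular f" and p: "p \<in> Y"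
  shows "conjugate \<phi> \<psi> (restrict f Y) p = flow_deriv (\<lambda>q\<in>Y. f (\<phi> q)) (\<psi> p)"
proof -
  have "restrict f Y \<in> R" using f regular_iff by blast
  moreover have "(\<lambda>q\<in>Y. restrict f Y (\<phi> q)) = (\<lambda>q\<in>Y. f (\<phi> q))"
    using pair by (auto simp: inverse_pair_def)
  ultimately show ?thesis using p by (simp add: conjugate_def)
qed

lemma conjugate_eqI:
  assumes pair: "inverse_pair \<phi> \<psi>" and f: "regular f"
    and g: "\<And>q. q \<in> Y \<Longrightarrow> flow_deriv (\<lambda>q\<in>Y. f (\<phi> q)) q = g (\<phi> q)"
  shows "conjugate \<phi> \<psi> (restrict f Y) = (\<lambda>p\<in>Y. g p)"
proof (rule extensionalityI[of _ Y])
  have "restrict f Y \<in> R" using f regular_iff by blast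
  then show "conjugate \<phi> \<psi> (restrict f Y) \<in> extensional Y" by (simp add: conjugate_def)
  fix p assume p: "p \<in> Y"
  then have "\<psi> p \<in> Y" "\<phi> (\<psi> p) = p" using pair by (auto simp: inverse_pair_def)
  then show "conjugate \<phi> \<psi> (restrict f Y) p = (\<lambda>p\<in>Y. g p) p"
    unfolding conjugate_apply[OF pair f p] using g[of "\<psi> p"] p by simp
qed auto

lemma conjugate_comp:
  assumes pair: "inverse_pair \<phi> \<psi>" and f: "regular f" and q: "q \<in> Y"
  shows "conjugate \<phi> \<psi> (restrict f Y) (\<phi> q) = flow_deriv (\<lambda>q\<in>Y. f (\<phi> q)) q"
  using conjugate_apply[OF pair f, of "\<phi> q"] pair q by (auto simp: inverse_pair_def)

lemma conjugate_lnd: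
  assumes pair: "inverse_pair \<phi> \<psi>"
  shows "conjugate \<phi> \<psi> \<in> lnds m Y"
proof -
  let ?D = "conjugate \<phi> \<psi>"
  have Y: "\<phi> p \<in> Y" "\<psi> p \<in> Y" "\<psi> (\<phi> p) = p" "\<phi> (\<psi> p) = p" if "p \<in> Y" for p
    using pair that by (auto simp: inverse_pair_def)
  have comp: "regular (\<lambda>p. f (\<phi> p))" "regular (\<lambda>p. f (\<psi> p))" if "regular f" for f
    using pair that by (auto simp: inverse_pair_def)
  have R: "regular f" "restrict f Y = f" if "f \<in> R" for f
    using that coord_ring_iff coord_ring_restrict by blast+
  have closed: "?D f \<in> R" if f: "f \<in> R" for f
  proof -
    have "regular (flow_deriv (\<lambda>q\<in>Y. f (\<phi> q)))"
      by (rule derivation_regular[OF flow_deriv_derivation comp(1)[OF R(1)[OF f]]])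
    from comp(2)[OF this] have "(\<lambda>p\<in>Y. flow_deriv (\<lambda>q\<in>Y. f (\<phi> q)) (\<psi> p)) \<in> R"
      using regular_iff by blast
    then show ?thesis using f by (simp add: conjugate_def)
  qed
  have D: "?D f (\<phi> q) = flow_deriv (\<lambda>q\<in>Y. f (\<phi> q)) q" if "f \<in> R" "q \<in> Y" for f q
    using conjugate_comp[OF pair R(1)[OF that(1)] that(2)] R(2)[OF that(1)] by simp
  have "?D \<in> derivations m Y"
    unfolding derivations_def mem_Collect_eq
  proof (intro conjI ballI allI)
    show "?D \<in> R \<rightarrow>\<^sub>E R" using closed by (auto simp: conjugate_def)
  next
    fix f g assume f: "f \<in> R" and g: "g \<in> R"
    note r = comp(1)[OF R(1)[OF f]] comp(1)[OF R(1)[OF g]]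
    show "?D (\<lambda>p\<in>Y. f p + g p) = (\<lambda>p\<in>Y. ?D f p + ?D g p)"
      by (rule conjugate_eqI[OF pair regular_add[OF R(1)[OF f] R(1)[OF g]]])
        (simp only: derivation_add[OF flow_deriv_derivation r] restrict_apply' D[OF f] D[OF g])
    show "?D (\<lambda>p\<in>Y. f p * g p) = (\<lambda>p\<in>Y. ?D f p * g p + f p * ?D g p)"
      by (rule conjugate_eqI[OF pair regular_mult[OF R(1)[OF f] R(1)[OF g]]])
        (simp only: derivation_mult[OF flow_deriv_derivation r] restrict_apply' D[OF f] D[OF g])
  next
    fix c f assume f: "f \<in> R"
    note r = comp(1)[OF R(1)[OF f]]
    show "?D (\<lambda>p\<in>Y. c * f p) = (\<lambda>p\<in>Y. c * ?D f p)"
    proof (rule conjugate_eqI[OF pair regular_mult[OF regular_const R(1)[OF f]]])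
      fix q assume q: "q \<in> Y"
      show "flow_deriv (\<lambda>q\<in>Y. c * f (\<phi> q)) q = c * ?D f (\<phi> q)"
        unfolding derivation_mult[OF flow_deriv_derivation regular_const r] restrict_apply'[OF q]
          derivation_const[OF flow_deriv_derivation] D[OF f q] by simp
    qed
  qed
  moreover have "\<exists>n. (?D ^^ n) f = (\<lambda>p\<in>Y. 0)" if f: "f \<in> R" for f
  proof -
    let ?g = "\<lambda>q\<in>Y. f (\<phi> q)"
    have "?g \<in> R" using comp(1)[OF R(1)[OF f]] regular_iff by blast
    then obtain n where n: "(flow_deriv ^^ n) ?g = (\<lambda>p\<in>Y. 0)"
      using flow_deriv_lnd by (auto simp: lnds_def locally_nilpotent_def)
    have "(?D ^^ n) f \<in> R \<and> (\<forall>q\<in>Y. (?D ^^ n) f (\<phi> q) = (flow_deriv ^^ n) ?g q)" for n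
    proof (induction n)
      case 0
      show ?case using f by simp
    next
      case (Suc n)
      let ?h = "(?D ^^ n) f"
      have h: "?h \<in> R" using Suc by blast
      have "(\<lambda>q\<in>Y. ?h (\<phi> q)) = (flow_deriv ^^ n) ?g"
      proof (rule extensionalityI[of _ Y])
        show "(flow_deriv ^^ n) ?g \<in> extensional Y"
          using flow_deriv_power(1)[OF \<open>?g \<in> R\<close>] coord_ring_iff by blast
        show "(\<lambda>q\<in>Y. ?h (\<phi> q)) q = (flow_deriv ^^ n) ?g q" if "q \<in> Y" for q
          using Suc that unfolding restrict_apply'[OF that] by blast
      qed (rule restrict_extensional)
      then have "?D ?h (\<phi> q) = flow_deriv ((flow_deriv ^^ n) ?g) q" if "q \<in> Y" for q
        using D[OF h that] by (simp only:)
      then show ?case using closed[OF h] unfolding funpow.simps o_apply by blast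
    qed
    from this[of n] have zero: "(?D ^^ n) f (\<phi> q) = 0" "(?D ^^ n) f \<in> R" if "q \<in> Y" for q
      using n that by auto
    have "(?D ^^ n) f = (\<lambda>p\<in>Y. 0)"
    proof (rule extensionalityI[of _ Y])
      show "(?D ^^ n) f \<in> extensional Y"
        using \<open>(?D ^^ n) f \<in> R \<and> _\<close> coord_ring_iff by blast
      show "(?D ^^ n) f p = (\<lambda>p\<in>Y. 0) p" if "p \<in> Y" for p
        using zero(1)[OF Y(2)[OF that]] Y(4)[OF that] that by simp
    qed auto
    then show ?thesis by blast
  qed
  ultimately show ?thesis by (simp add: lnds_def locally_nilpotent_def)
qed

text \<open>
  The conjugate of \<open>\<partial>\<close> annihilates \<open>y j\<close>, so \<open>\<partial>\<close> annihilates its pullback.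
\<close>

lemma automorphism_base:
  assumes pair: "inverse_pair \<phi> \<psi>" and j: "j \<in> {2..m}"
  obtains b where "b \<in> base_polys m" "\<And>p. p \<in> Y \<Longrightarrow> fst (\<phi> p) j = b (fst p)"
proof (rule kernel_base)
  have rj: "regular (\<lambda>p. fst p j)" using j by (intro regular_y) auto
  then show "regular (\<lambda>p. fst (\<phi> p) j)" using pair unfolding inverse_pair_def by blast
  show "flow_deriv (\<lambda>p\<in>Y. fst (\<phi> p) j) q = 0" if q: "q \<in> Y" for q
    using conjugate_comp[OF pair rj q] lnd_vertical(1)[OF conjugate_lnd[OF pair] j] pair q
    by (auto simp: inverse_pair_def)
qed (use that in blast)

lemma automorphism_tail_base:
  assumes pair: "inverse_pair \<phi> \<psi>"
  obtains b where "b \<in> base_polys m" "\<And>p. p \<in> Y \<Longrightarrow> tail (fst (\<phi> p)) = b (fst p)"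
proof -
  have "\<forall>j\<in>{2..m}. \<exists>b. b \<in> base_polys m \<and> (\<forall>p\<in>Y. fst (\<phi> p) j = b (fst p))"
    using automorphism_base[OF pair] by metis
  then obtain B where B: "\<And>j. j \<in> {2..m} \<Longrightarrow> B j \<in> base_polys m"
    "\<And>j p. j \<in> {2..m} \<Longrightarrow> p \<in> Y \<Longrightarrow> fst (\<phi> p) j = B j (fst p)" by metis
  have "(\<lambda>y. \<Prod>j\<in>{2..m}. B j y ^ k j) \<in> base_polys m"
    by (intro base_polys_prod base_polys_power B)
  then show ?thesis by (rule that) (simp add: monomial_tail_def B(2))
qed

text \<open>
  The conjugate \<open>D\<close> of the canonical derivation is proportional to it: \<open>tail \<sqdot> D = (D z) \<sqdot> \<partial>\<close> with \<open>D z\<close> a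
  function on the base. Evaluated at the pullback of \<open>z\<close> this bounds the degree of that pullback in
  \<open>z\<close> by one, and evaluated at \<open>y 1\<close> it shows that the tail divides \<open>D z\<close>.
\<close>

lemma automorphism_affine_in_z:
  assumes pair: "inverse_pair \<phi> \<psi>"
  obtains \<alpha> \<beta> h where "\<alpha> \<in> base_polys m" "\<beta> \<in> base_polys m" "h \<in> base_polys m"
    "\<And>p. p \<in> Y \<Longrightarrow> snd (\<psi> p) = \<beta> (fst p) + \<alpha> (fst p) * snd p"
    "\<And>p. p \<in> Y \<Longrightarrow> tail (fst (\<psi> p)) = h (fst p) * \<alpha> (fst p) * tail (fst p)"
proof -
  let ?D = "conjugate \<phi> \<psi>"
  have Y: "\<phi> p \<in> Y" "\<psi> p \<in> Y" "\<psi> (\<phi> p) = p" "\<phi> (\<psi> p) = p" if "p \<in> Y" for p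
    using pair that by (auto simp: inverse_pair_def)
  have comp: "regular (\<lambda>p. f (\<phi> p))" "regular (\<lambda>p. f (\<psi> p))" if "regular f" for f
    using pair that by (auto simp: inverse_pair_def)
  have lnd: "?D \<in> lnds m Y" and der: "?D \<in> derivations m Y" using conjugate_lnd[OF pair] by (auto simp: lnds_def)
  have Dz: "regular (?D (\<lambda>p\<in>Y. snd p))" by (rule derivation_regular[OF der regular_z])
  obtain h0 where h0: "h0 \<in> base_polys m" "\<And>p. p \<in> Y \<Longrightarrow> ?D (\<lambda>p\<in>Y. snd p) p = h0 (fst p)"
    using regular_degree_zero[OF Dz lnd_vertical(2)[OF lnd]] by blast
  \<comment> \<open>Both derivations annihilate the base, so they differ by the ratio of their values at \<open>z\<close>.\<close>
  have proportional: "tail (fst p) * ?D (restrict f Y) p = h0 (fst p) * flow_deriv (restrict f Y) p"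
    if f: "regular f" and p: "p \<in> Y" for f p
  proof (rule laurent_inject[OF _ _ _ p])
    have r: "regular (?D (restrict f Y))" "regular (flow_deriv (restrict f Y))"
      using derivation_regular[OF der f] derivation_regular[OF flow_deriv_derivation f] .
    show "regular (\<lambda>p. tail (fst p) * ?D (restrict f Y) p)" "regular (\<lambda>p. h0 (fst p) * flow_deriv (restrict f Y) p)"
      using r regular_mult regular_tail regular_base[OF h0(1)] by blast+
    have c: "coordinate 0 = (\<lambda>p. snd p)" by (auto simp: coordinate_def)
    have "laurent (\<lambda>p. h0 (fst p)) = laurent (?D (\<lambda>p\<in>Y. snd p))"
      by (rule laurent_cong) (simp add: h0(2))
    then show "laurent (\<lambda>p. tail (fst p) * ?D (restrict f Y) p) = laurent (\<lambda>p. h0 (fst p) * flow_deriv (restrict f Y) p)"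
      unfolding laurent_mult[OF regular_tail r(1)] laurent_mult[OF regular_base[OF h0(1)] r(2)]
        laurent_vertical[OF lnd f] laurent_vertical[OF flow_deriv_lnd f] symbol_flow_deriv laurent_tail
      by (simp add: symbol_def c mult_ac)
  qed
  define \<zeta> where "\<zeta> p = snd (\<psi> p)" for p
  have r\<zeta>: "regular \<zeta>" unfolding \<zeta>_def using comp(2)[OF regular_z] .
  have "(\<lambda>q\<in>Y. \<zeta> (\<phi> q)) = (\<lambda>q\<in>Y. snd q)" using Y by (auto simp: \<zeta>_def)
  then have D\<zeta>: "?D (restrict \<zeta> Y) p = tail (fst (\<psi> p))" if "p \<in> Y" for p
    unfolding conjugate_apply[OF pair r\<zeta> that] using Y(2)[OF that] by (simp add: flow_deriv_z)
  then have eq: "tail (fst p) * tail (fst (\<psi> p)) = h0 (fst p) * flow_deriv (restrict \<zeta> Y) p" if "p \<in> Y" for p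
    using proportional[OF r\<zeta> that] that by simp
  obtain T where T: "T \<in> base_polys m" "\<And>p. p \<in> Y \<Longrightarrow> tail (fst (\<psi> p)) = T (fst p)"
    using automorphism_tail_base[OF inverse_pair_sym[OF pair]] by blast
  define G where "G = flow_deriv (restrict \<zeta> Y)"
  have rG: "regular G" unfolding G_def by (rule derivation_regular[OF flow_deriv_derivation r\<zeta>])
  have TT: "(\<lambda>y. tail y * T y) \<in> base_polys m" by (intro base_polys.mult base_polys_tail T)
  have lG: "laurent (\<lambda>p. h0 (fst p)) * laurent G = laurent (\<lambda>p. tail (fst p) * T (fst p))"
    unfolding laurent_mult[OF regular_base[OF h0(1)] rG, symmetric]
    by (rule laurent_cong) (simp add: G_def eq[symmetric] T)
  have T0: "laurent (\<lambda>p. tail (fst p) * T (fst p)) \<noteq> 0"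
  proof
    assume "laurent (\<lambda>p. tail (fst p) * T (fst p)) = 0"
    then have z: "tail (fst p) * T (fst p) = 0" if "p \<in> Y" for p
      using laurent_eq_0D[OF regular_base[OF TT]] that by blast
    have "T (fst p) = 0" if "p \<in> Y" for p
    proof (rule base_eq_on_torus[OF T(1) base_polys.const _ that, of 0])
      show "T t = 0" if t: "nonvanishing t" for t
        using z[OF torus_point_in_Y[OF t]] tail_nonzero[OF t] base_torus_point[OF T(1)] by simp
    qed
    then have "tail (fst (\<psi> (\<phi> p))) = 0" if "p \<in> Y" for p using T(2)[OF Y(1)[OF that]] Y(1)[OF that] by simp
    then have "tail (fst p) = 0" if "p \<in> Y" for p using Y(3)[OF that] that by metis
    from this[OF torus_point_in_Y[of "\<lambda>_. 1"]] show False
      using tail_nonzero[of "\<lambda>_. 1"] by (simp add: nonvanishing_def)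
  qed
  \<comment> \<open>Degrees in \<open>z\<close> add up, and those of \<open>h0\<close> and of the product are zero.\<close>
  have G0: "lookup u 0 \<le> 0" if u: "u \<in> keys (laurent G)" for u
  proof -
    have nz: "laurent (\<lambda>p. h0 (fst p)) \<noteq> 0" "laurent G \<noteq> 0" using lG T0 by auto
    obtain s a where s: "s \<in> lead_expos" "a \<noteq> 0" "lead (laurent (\<lambda>p. h0 (fst p))) s a"
      using lead_laurent[OF regular_base[OF h0(1)] nz(1)] by blast
    obtain s' a' where s': "s' \<in> lead_expos" "a' \<noteq> 0" "lead (laurent G) s' a'"
      using lead_laurent[OF rG nz(2)] by blast
    have "lead (laurent (\<lambda>p. tail (fst p) * T (fst p))) (s + s') (a * a')"
      using lead_mult[OF s(3) s'(3)] lG by simp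
    then have "s + s' \<in> keys (laurent (\<lambda>p. tail (fst p) * T (fst p)))"
      using s(2) s'(2) by (auto simp: lead_def in_keys_iff)
    then have "lookup (s + s') 0 = 0" using base_keys[OF TT] by simp
    then have "lookup s' 0 \<le> 0" using s(1) by (simp add: lookup_add lead_expos_def)
    then show ?thesis using lex_le_0[OF lead_keys_le[OF s'(3) u]] by simp
  qed
  have small: "lookup u 0 < int 2" if u: "u \<in> keys (laurent \<zeta>)" for u
  proof (rule ccontr)
    assume big: "\<not> lookup u 0 < int 2"
    let ?\<kappa> = "expo 0 (\<lambda>j. int (k j))"
    have "laurent G = (lmonom ?\<kappa> * lmonom (- single 0 1)) * euler 0 (laurent \<zeta>)"
      unfolding G_def laurent_vertical[OF flow_deriv_lnd r\<zeta>] symbol_flow_deriv ..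
    then have "euler 0 (laurent \<zeta>) = lmonom (single 0 1 - ?\<kappa>) * laurent G"
      by (simp add: mult_single flip: mult.assoc)
    moreover have "u \<in> keys (euler 0 (laurent \<zeta>))" using u big by (simp add: in_keys_iff lookup_euler)
    ultimately obtain v where "v \<in> keys (laurent G)" "u = single 0 1 - ?\<kappa> + v"
      using Poly_Mapping.keys_mult[of "lmonom (single 0 1 - ?\<kappa>)" "laurent G"] by auto
    then show False using G0[of v] big by (auto simp: lookup_add lookup_minus lookup_expo lookup_single_if simp del: single_one)
  qed
  obtain r where r: "\<And>i. r i \<in> base_polys m" "\<And>p. p \<in> Y \<Longrightarrow> \<zeta> p = (\<Sum>i<2. r i (fst p) * snd p ^ i)"
    using regular_small_degree[OF r\<zeta> small d2] by blast
  have r01: "\<zeta> p = r 0 (fst p) + r 1 (fst p) * snd p" if "p \<in> Y" for p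
    using r(2)[OF that] by (simp add: numeral_2_eq_2)
  have G: "G p = r 1 (fst p) * tail (fst p)" if p: "p \<in> Y" for p
  proof -
    have "taylor \<zeta> p = [:r 0 (fst p) + r 1 (fst p) * snd p, r 1 (fst p) * tail (fst p):]"
    proof (rule taylor_eqI)
      fix \<tau>
      show "poly [:r 0 (fst p) + r 1 (fst p) * snd p, r 1 (fst p) * tail (fst p):] \<tau> = \<zeta> (flow \<tau> p)"
        unfolding r01[OF flow_in_Y[OF p]] base_flow[OF r(1)] snd_flow by (simp add: algebra_simps)
    qed
    then show ?thesis unfolding G_def flow_deriv_apply[OF r\<zeta> p] by simp
  qed
  have ry1: "regular (\<lambda>p. fst p 1)" using m2 by (intro regular_y) auto
  have y1: "tail (fst p) * ?D (\<lambda>p\<in>Y. fst p 1) p = (\<Sum>i<d. (h0 (fst p) * coeff (pderiv P) i) * snd p ^ i)" if p: "p \<in> Y" for p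
  proof -
    have "degree (pderiv P) < d" using d2 deg_P degree_pderiv[of P] by simp
    then have "poly (pderiv P) x = (\<Sum>i<d. coeff (pderiv P) i * x ^ i)" for x
      unfolding poly_altdef by (intro sum.mono_neutral_left) (auto simp: coeff_eq_0)
    moreover have "flow_deriv (\<lambda>p\<in>Y. fst p 1) p = poly (pderiv P) (snd p)"
      unfolding flow_deriv_y1 by (simp add: p)
    ultimately show ?thesis unfolding proportional[OF ry1 p] by (simp add: sum_distrib_left mult.assoc)
  qed
  have hP: "(\<lambda>y. h0 y * coeff (pderiv P) i) \<in> base_polys m" for i by (intro base_polys.mult h0 base_polys.const)
  have rD: "regular (?D (\<lambda>p\<in>Y. fst p 1))" by (rule derivation_regular[OF der ry1])
  have "lookup u 0 < int d" if u: "u \<in> keys (laurent (?D (\<lambda>p\<in>Y. fst p 1)))" for u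
  proof -
    obtain v where v: "v \<in> keys (laurent (\<lambda>p. \<Sum>i<d. h0 (fst p) * coeff (pderiv P) i * snd p ^ i))" "lookup v 0 = lookup u 0"
      using laurent_tail_mult_keys[OF rD y1 u] by blast
    show ?thesis using base_expansion_keys[of d "\<lambda>i y. h0 y * coeff (pderiv P) i", OF hP v(1)] v(2) by simp
  qed
  then obtain w where w: "\<And>i. w i \<in> base_polys m"
    "\<And>p. p \<in> Y \<Longrightarrow> ?D (\<lambda>p\<in>Y. fst p 1) p = (\<Sum>i<d. w i (fst p) * snd p ^ i)"
    using regular_small_degree[OF rD _ order_refl] by blast
  have tw: "(\<lambda>y. tail y * w i y) \<in> base_polys m" for i by (intro base_polys.mult base_polys_tail w)
  \<comment> \<open>The leading coefficient of the derivative of \<open>P\<close> is the nonzero constant \<open>d\<close>.\<close>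
  have "tail t * w (d - 1) t = h0 t * coeff (pderiv P) (d - 1)" if t: "nonvanishing t" for t
  proof (rule base_expansion_coeff[of d "\<lambda>i y. tail y * w i y" "\<lambda>i y. h0 y * coeff (pderiv P) i", OF tw hP _ t])
    show "(\<Sum>i<d. tail (fst p) * w i (fst p) * snd p ^ i) = (\<Sum>i<d. h0 (fst p) * coeff (pderiv P) i * snd p ^ i)"
      if "p \<in> Y" for p
      using y1[OF that] w(2)[OF that] by (simp add: sum_distrib_left mult.assoc)
  qed (use d2 in auto)
  moreover have cd: "coeff (pderiv P) (d - 1) = of_nat d" using d2 monic deg_P by (simp add: coeff_pderiv)
  moreover have d0: "of_nat d \<noteq> (0::'a)" using d2 by simp
  ultimately have h0t: "h0 t = w (d - 1) t * (1 / of_nat d) * tail t" if "nonvanishing t" for t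
    using that by (simp add: field_simps)
  define h where "h y = w (d - 1) y * (1 / of_nat d)" for y
  have h: "h \<in> base_polys m" unfolding h_def[abs_def] by (intro base_polys.mult w base_polys.const)
  have hr: "(\<lambda>y. h y * r 1 y * tail y) \<in> base_polys m" by (intro base_polys.mult h r base_polys_tail)
  have final: "T (fst p) = h (fst p) * r 1 (fst p) * tail (fst p)" if "p \<in> Y" for p
  proof (rule base_eq_on_torus[OF T(1) hr _ that])
    fix t :: "nat \<Rightarrow> 'a" assume t: "nonvanishing t"
    have "tail t * T t = h0 t * (r 1 t * tail t)"
      using eq[OF torus_point_in_Y[OF t]] G[OF torus_point_in_Y[OF t]] T(2)[OF torus_point_in_Y[OF t]]
      by (simp add: G_def base_torus_point T(1) r(1) h0(1))
    then have "tail t * T t = tail t * (h t * r 1 t * tail t)" by (simp add: h0t[OF t] h_def mult_ac)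
    then show "T t = h t * r 1 t * tail t" using mult_left_cancel[OF tail_nonzero[OF t]] by blast
  qed
  show ?thesis
    by (rule that[OF r(1)[of 1] r(1)[of 0] h])
      (simp_all only: \<zeta>_def[symmetric] r01 T(2) final)
qed

end

lemma coeff_linear_power:
  fixes a b :: "'a::comm_ring_1"
  shows "coeff ([:b, a:] ^ n) n = a ^ n"
    and "coeff ([:b, a:] ^ Suc n) n = of_nat (Suc n) * b * a ^ n"
proof -
  have 0: "coeff ([:b, a:] ^ n) i = 0" if "i > n" for n i
    by (rule coeff_eq_0) (use that degree_power_le[of "[:b, a:]" n] degree_pCons_le[of b "[:a:]"] in
      \<open>auto intro: le_less_trans order_trans[OF degree_power_le] split: if_splits\<close>)
  show 1: "coeff ([:b, a:] ^ n) n = a ^ n" for n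
    by (induction n) (auto simp: 0)
  show "coeff ([:b, a:] ^ Suc n) n = of_nat (Suc n) * b * a ^ n"
  proof (induction n)
    case (Suc n)
    have "coeff ([:b, a:] ^ Suc (Suc n)) (Suc n) = b * coeff ([:b, a:] ^ Suc n) (Suc n) + a * coeff ([:b, a:] ^ Suc n) n"
      by (subst power_Suc) simp
    then show ?case unfolding 1 Suc by (simp add: algebra_simps)
  qed simp
qed

context suspension
begin

text \<open>
  Composing the relations for \<open>\<phi>\<close> and for its inverse shows that the factor by which \<open>\<phi>\<close> multiplies the
  tail is invertible, hence constant, and so is each of its factors.
\<close>

lemma automorphism_constants:
  assumes pair: "inverse_pair \<phi> \<psi>"
  shows "\<exists>a c. \<exists>\<beta>\<in>base_polys m. a \<noteq> 0 \<and> c \<noteq> 0 \<and>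
    (\<forall>p\<in>Y. snd (\<phi> p) = \<beta> (fst p) + a * snd p) \<and> (\<forall>p\<in>Y. tail (fst (\<phi> p)) = c * tail (fst p))"
proof -
  have Y: "\<phi> p \<in> Y" "\<psi> (\<phi> p) = p" if "p \<in> Y" for p
    using pair that by (auto simp: inverse_pair_def)
  obtain \<alpha> \<beta> h where f: "\<alpha> \<in> base_polys m" "\<beta> \<in> base_polys m" "h \<in> base_polys m"
    "\<And>p. p \<in> Y \<Longrightarrow> snd (\<phi> p) = \<beta> (fst p) + \<alpha> (fst p) * snd p"
    "\<And>p. p \<in> Y \<Longrightarrow> tail (fst (\<phi> p)) = h (fst p) * \<alpha> (fst p) * tail (fst p)"
    using automorphism_affine_in_z[OF inverse_pair_sym[OF pair]] by blast
  obtain \<alpha>' \<beta>' h' where g: "\<alpha>' \<in> base_polys m" "\<beta>' \<in> base_polys m" "h' \<in> base_polys m"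
    "\<And>p. p \<in> Y \<Longrightarrow> snd (\<psi> p) = \<beta>' (fst p) + \<alpha>' (fst p) * snd p"
    "\<And>p. p \<in> Y \<Longrightarrow> tail (fst (\<psi> p)) = h' (fst p) * \<alpha>' (fst p) * tail (fst p)"
    using automorphism_affine_in_z[OF pair] by blast
  define u where "u p = h (fst p) * \<alpha> (fst p)" for p :: "'a point"
  define v where "v p = h' (fst (\<phi> p)) * \<alpha>' (fst (\<phi> p))" for p
  have ru: "regular u" unfolding u_def[abs_def] by (intro regular_mult regular_base f)
  have rv: "regular v" using pair regular_mult[OF regular_base[OF g(3)] regular_base[OF g(1)]]
    unfolding v_def[abs_def] inverse_pair_def by blast
  have uv: "u p * v p = 1" if "p \<in> Y" for p
  proof (rule regular_eq_on_torus[OF regular_mult[OF ru rv] regular_const _ that])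
    fix t :: "nat \<Rightarrow> 'a" assume t: "nonvanishing t"
    let ?p = "torus_point t"
    have p: "?p \<in> Y" by (rule torus_point_in_Y[OF t])
    have "tail (fst ?p) = v ?p * (u ?p * tail (fst ?p))"
      using g(5)[OF Y(1)[OF p]] f(5)[OF p] unfolding Y(2)[OF p] by (simp add: u_def v_def)
    then show "u ?p * v ?p = 1" using tail_nonzero[OF t] by (simp add: mult_ac)
  qed
  obtain c where c: "c \<noteq> 0" "\<And>p. p \<in> Y \<Longrightarrow> u p = c" using regular_unit_const[OF ru rv uv] by blast
  have "\<alpha> (fst p) * (h (fst p) * (1 / c)) = 1" if "p \<in> Y" for p
    using c(1) c(2)[OF that] by (simp add: u_def field_simps)
  then obtain a where a: "a \<noteq> 0" "\<And>p. p \<in> Y \<Longrightarrow> \<alpha> (fst p) = a"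
    using regular_unit_const[OF regular_base[OF f(1)] regular_mult[OF regular_base[OF f(3)] regular_const]] by blast
  have "snd (\<phi> p) = \<beta> (fst p) + a * snd p" "tail (fst (\<phi> p)) = c * tail (fst p)" if "p \<in> Y" for p
    using f(4,5)[OF that] a(2)[OF that] c(2)[OF that] by (simp_all add: u_def)
  then show ?thesis using a(1) c(1) f(2) by blast
qed

text \<open>
  The product of the powers of the pulled back \<open>y j\<close> is a multiple of the tail, a monomial.
\<close>

lemma automorphism_monomial:
  assumes pair: "inverse_pair \<phi> \<psi>"
  shows "\<exists>C V. \<forall>j\<in>{2..m}. C j \<noteq> 0 \<and> (\<forall>p\<in>Y. fst (\<phi> p) j = C j * (\<Prod>i\<in>{2..m}. fst p i ^ V j i))"
proof -
  obtain c where c: "c \<noteq> 0" "\<And>p. p \<in> Y \<Longrightarrow> tail (fst (\<phi> p)) = c * tail (fst p)"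
    using automorphism_constants[OF pair] by blast
  define F where "F j = laurent (\<lambda>p. fst (\<phi> p) j)" for j
  have r: "regular (\<lambda>p. fst (\<phi> p) j)" if "j \<in> {2..m}" for j
    using pair regular_y[of j] that unfolding inverse_pair_def by auto
  let ?\<kappa> = "expo 0 (\<lambda>j. int (k j))"
  have prod: "(\<Prod>j\<in>{2..m}. F j ^ k j) = single ?\<kappa> c"
  proof (rule leval_inject)
    fix t :: "nat \<Rightarrow> 'a" assume t: "nonvanishing t"
    have "leval t (\<Prod>j\<in>{2..m}. F j ^ k j) = tail (fst (\<phi> (torus_point t)))"
      by (simp add: leval_prod[OF t] leval_power[OF t] F_def leval_laurent[OF r t] monomial_tail_def)
    then show "leval t (\<Prod>j\<in>{2..m}. F j ^ k j) = leval t (single ?\<kappa> c)"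
      using c(2)[OF torus_point_in_Y[OF t]] by (simp add: char_val_expo monomial_tail_def)
  qed
  have "\<exists>C v. C \<noteq> 0 \<and> (\<forall>p\<in>Y. fst (\<phi> p) j = C * (\<Prod>i\<in>{2..m}. fst p i ^ v i))" if j: "j \<in> {2..m}" for j
  proof -
    have "F j * (F j ^ (k j - 1) * (\<Prod>i\<in>{2..m} - {j}. F i ^ k i)) = single ?\<kappa> c"
      using prod prod.remove[of "{2..m}" j "\<lambda>j. F j ^ k j"] j k2[OF j] power_minus_mult[of "k j" "F j"]
      by (simp add: mult_ac)
    from factor_of_monomial[OF this c(1)] obtain v C where C: "C \<noteq> 0" "F j = single v C" by blast
    have v: "v \<in> lead_expos" using lead_in_lead_expos[OF r[OF j], of v C] C lead_single[of v C] by (simp add: F_def)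
    obtain B where B: "B \<in> base_polys m" "\<And>p. p \<in> Y \<Longrightarrow> fst (\<phi> p) j = B (fst p)"
      using automorphism_base[OF pair j] by blast
    have FB: "F j = laurent (\<lambda>p. B (fst p))" unfolding F_def by (rule laurent_cong) (rule B(2))
    have "v \<in> keys (F j)" using C by simp
    then have v0: "lookup v 0 = 0" unfolding FB by (rule base_keys[OF B(1)])
    have ve: "v = expo 0 (\<lambda>i. int (nat (lookup v i)))"
      using v v0 by (intro poly_mapping_eqI) (auto simp: lookup_expo lead_expos_def)
    have "fst (\<phi> p) j = C * (\<Prod>i\<in>{2..m}. fst p i ^ nat (lookup v i))" if p: "p \<in> Y" for p
    proof (rule regular_eq_on_torus[OF r[OF j] _ _ p])
      show "regular (\<lambda>p. C * (\<Prod>i\<in>{2..m}. fst p i ^ nat (lookup v i)))"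
        by (intro regular_mult regular_const regular_prod regular_power regular_y) auto
      fix t :: "nat \<Rightarrow> 'a" assume t: "nonvanishing t"
      have "fst (\<phi> (torus_point t)) j = leval t (single v C)"
        using leval_laurent[OF r[OF j] t] C by (simp add: F_def)
      also have "\<dots> = C * (\<Prod>i\<in>{2..m}. t i ^ nat (lookup v i))"
        by (subst ve) (simp only: leval_single char_val_expo power_int_of_nat power_int_0_right mult_1_left)
      finally show "fst (\<phi> (torus_point t)) j = C * (\<Prod>i\<in>{2..m}. fst (torus_point t) i ^ nat (lookup v i))"
        by simp
    qed
    then show ?thesis using C(1) by (intro exI[of _ C] exI[of _ "\<lambda>i. nat (lookup v i)"] conjI ballI)
  qed
  then have "\<forall>j\<in>{2..m}. \<exists>C v. C \<noteq> 0 \<and> (\<forall>p\<in>Y. fst (\<phi> p) j = C * (\<Prod>i\<in>{2..m}. fst p i ^ v i))" by (rule ballI)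
  from bchoice[OF this] obtain C where
    "\<forall>j\<in>{2..m}. \<exists>v. C j \<noteq> 0 \<and> (\<forall>p\<in>Y. fst (\<phi> p) j = C j * (\<Prod>i\<in>{2..m}. fst p i ^ v i))" by (rule exE)
  from bchoice[OF this] show ?thesis by (rule exI[of _ C])
qed

lemma monomial_composition:
  assumes pair: "inverse_pair \<phi> \<psi>"
    and V: "\<And>j p. j \<in> {2..m} \<Longrightarrow> p \<in> Y \<Longrightarrow> fst (\<phi> p) j = C j * (\<Prod>i\<in>{2..m}. fst p i ^ V j i)"
    and W: "\<And>j p. j \<in> {2..m} \<Longrightarrow> p \<in> Y \<Longrightarrow> fst (\<psi> p) j = E j * (\<Prod>i\<in>{2..m}. fst p i ^ W j i)"
    and ij: "i \<in> {2..m}" "j \<in> {2..m}"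
  shows "(\<Sum>l\<in>{2..m}. W j l * V l i) = (if i = j then 1 else 0)"
proof -
  let ?K = "E j * (\<Prod>l\<in>{2..m}. C l ^ W j l)"
  have "1 * (\<Prod>i\<in>{2..m}. t i ^ (if i = j then 1 else 0)) = ?K * (\<Prod>i\<in>{2..m}. t i ^ (\<Sum>l\<in>{2..m}. W j l * V l i))"
    if t: "nonvanishing t" for t
  proof -
    let ?p = "torus_point t"
    have p: "?p \<in> Y" "\<phi> ?p \<in> Y" "\<psi> (\<phi> ?p) = ?p" using torus_point_in_Y[OF t] pair by (auto simp: inverse_pair_def)
    have "(\<Prod>i\<in>{2..m}. t i ^ (if i = j then 1 else 0)) = (\<Prod>i\<in>{2..m}. if i = j then t j else 1)"
      by (rule prod.cong) auto
    also have "\<dots> = t j" using ij by simp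
    also have "\<dots> = fst (\<psi> (\<phi> ?p)) j" using ij p by simp
    also have "\<dots> = E j * (\<Prod>l\<in>{2..m}. (C l * (\<Prod>i\<in>{2..m}. t i ^ V l i)) ^ W j l)"
      unfolding W[OF ij(2) p(2)] by (intro arg_cong2[of _ _ _ _ "(*)"] prod.cong refl) (simp add: V p)
    also have "\<dots> = ?K * (\<Prod>l\<in>{2..m}. \<Prod>i\<in>{2..m}. t i ^ (W j l * V l i))"
      by (simp add: power_mult_distrib prod.distrib prod_power_distrib flip: power_mult) (simp add: mult.commute)
    also have "(\<Prod>l\<in>{2..m}. \<Prod>i\<in>{2..m}. t i ^ (W j l * V l i)) = (\<Prod>i\<in>{2..m}. t i ^ (\<Sum>l\<in>{2..m}. W j l * V l i))"
      by (subst prod.swap) (simp add: power_sum)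
    finally show ?thesis by simp
  qed
  from torus_monomial_inject[OF this _ ij(1)] show ?thesis by simp
qed

text \<open>
  The matrices of exponents of \<open>\<phi>\<close> and of its inverse are inverse to each other, hence permutation
  matrices. Comparing exponents in \<open>tail \<circ> \<phi> = c \<cdot> tail\<close> shows that the permutation preserves \<open>k\<close>.
\<close>

lemma automorphism_permutation:
  assumes pair: "inverse_pair \<phi> \<psi>"
  shows "\<exists>C \<sigma>. \<sigma> permutes {2..m} \<and>
    (\<forall>j\<in>{2..m}. k (\<sigma> j) = k j \<and> C j \<noteq> 0 \<and> (\<forall>p\<in>Y. fst (\<phi> p) j = C j * fst p (\<sigma> j)))"
proof -
  let ?I = "{2..m}"
  obtain C V where V: "\<And>j. j \<in> ?I \<Longrightarrow> C j \<noteq> 0"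
    "\<And>j p. j \<in> ?I \<Longrightarrow> p \<in> Y \<Longrightarrow> fst (\<phi> p) j = C j * (\<Prod>i\<in>?I. fst p i ^ V j i)"
    using automorphism_monomial[OF pair] by blast
  obtain E W where W: "\<And>j. j \<in> ?I \<Longrightarrow> E j \<noteq> 0"
    "\<And>j p. j \<in> ?I \<Longrightarrow> p \<in> Y \<Longrightarrow> fst (\<psi> p) j = E j * (\<Prod>i\<in>?I. fst p i ^ W j i)"
    using automorphism_monomial[OF inverse_pair_sym[OF pair]] by blast
  have "\<exists>\<sigma>. \<sigma> permutes ?I \<and> (\<forall>j\<in>?I. \<forall>i\<in>?I. V j i = (if i = \<sigma> j then 1 else 0))"
    by (rule nat_matrix_inverse_permutation[OF finite_atLeastAtMost
          monomial_composition[OF inverse_pair_sym[OF pair] W(2) V(2)] monomial_composition[OF pair V(2) W(2)]])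
  then obtain \<sigma> where \<sigma>: "\<sigma> permutes ?I"
    "\<And>i j. j \<in> ?I \<Longrightarrow> i \<in> ?I \<Longrightarrow> V j i = (if i = \<sigma> j then 1 else 0)" by blast
  have \<sigma>I: "\<sigma> j \<in> ?I" if "j \<in> ?I" for j using permutes_in_image[OF \<sigma>(1)] that by blast
  have fy: "fst (\<phi> p) j = C j * fst p (\<sigma> j)" if j: "j \<in> ?I" and p: "p \<in> Y" for j p
  proof -
    have "(\<Prod>i\<in>?I. fst p i ^ V j i) = (\<Prod>i\<in>?I. if i = \<sigma> j then fst p (\<sigma> j) else 1)"
      by (rule prod.cong) (auto simp: \<sigma>(2)[OF j])
    then show ?thesis using V(2)[OF j p] \<sigma>I[OF j] by simp
  qed
  obtain c where c: "c \<noteq> 0" "\<And>p. p \<in> Y \<Longrightarrow> tail (fst (\<phi> p)) = c * tail (fst p)"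
    using automorphism_constants[OF pair] by blast
  have "k (\<sigma> j) = k j" if j: "j \<in> ?I" for j
  proof -
    have inv: "inv_into UNIV \<sigma> i \<in> ?I" if "i \<in> ?I" for i using permutes_in_image[OF permutes_inv[OF \<sigma>(1)]] that by blast
    have "c * (\<Prod>i\<in>?I. t i ^ k i) = (\<Prod>j\<in>?I. C j ^ k j) * (\<Prod>i\<in>?I. t i ^ k (inv_into UNIV \<sigma> i))" if t: "nonvanishing t" for t
    proof -
      have p: "torus_point t \<in> Y" by (rule torus_point_in_Y[OF t])
      have "c * (\<Prod>i\<in>?I. t i ^ k i) = tail (fst (\<phi> (torus_point t)))"
        using c(2)[OF p] by (simp add: monomial_tail_def)
      also have "\<dots> = (\<Prod>j\<in>?I. C j ^ k j) * (\<Prod>j\<in>?I. t (\<sigma> j) ^ k j)"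
        unfolding monomial_tail_def prod.distrib[symmetric]
      proof (rule prod.cong[OF refl])
        fix j assume j: "j \<in> ?I"
        show "fst (\<phi> (torus_point t)) j ^ k j = C j ^ k j * t (\<sigma> j) ^ k j"
          unfolding fy[OF j p] fst_torus_point[OF \<sigma>I[OF j]] by (rule power_mult_distrib)
      qed
      also have "(\<Prod>j\<in>?I. t (\<sigma> j) ^ k j) = (\<Prod>i\<in>?I. t i ^ k (inv_into UNIV \<sigma> i))"
        by (rule prod.reindex_bij_witness[of _ "inv_into UNIV \<sigma>" \<sigma>])
          (use inv \<sigma>I permutes_inverses[OF \<sigma>(1)] in auto)
      finally show ?thesis .
    qed
    from torus_monomial_inject[OF this c(1) \<sigma>I[OF j]] show ?thesis
      using permutes_inverses(2)[OF \<sigma>(1)] by simp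
  qed
  then show ?thesis using \<sigma>(1) V(1) fy by blast
qed

lemma pcompose_coeff_base:
  assumes "\<beta> \<in> base_polys m" shows "(\<lambda>y. coeff (pcompose q [:\<beta> y, a:]) i) \<in> base_polys m"
proof (induction q arbitrary: i)
  case 0
  show ?case by (simp add: base_polys.const)
next
  case (pCons c q)
  have "coeff (pcompose (pCons c q) [:\<beta> y, a:]) i = (case i of 0 \<Rightarrow> c | Suc j \<Rightarrow> 0) +
      (\<beta> y * coeff (pcompose q [:\<beta> y, a:]) i + (case i of 0 \<Rightarrow> 0 | Suc j \<Rightarrow> a * coeff (pcompose q [:\<beta> y, a:]) j))" for y
    by (cases i) (auto simp: pcompose_pCons)
  moreover have "(\<lambda>y. case i of 0 \<Rightarrow> 0 | Suc j \<Rightarrow> a * coeff (pcompose q [:\<beta> y, a:]) j) \<in> base_polys m"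
    using pCons.IH by (cases i) (auto intro: base_polys.const base_polys.mult)
  ultimately show ?case
    using pCons.IH[of i] assms by (auto intro!: base_polys.add base_polys.mult base_polys.const)
qed

text \<open>
  The equation \<open>y 1 \<sqdot> tail = P z\<close>, pulled back, makes the tail divide every coefficient of
  \<open>P (a z + \<beta>) - a ^ d P z\<close>. The coefficient of \<open>z ^ (d - 1)\<close> is \<open>d a ^ (d - 1) \<beta>\<close>, because that of \<open>P\<close>
  vanishes; so the tail divides \<open>\<beta>\<close>, and setting all \<open>y j\<close> to \<open>0\<close> in the others gives
  \<open>P (a z) = a ^ d P z\<close>.
\<close>

lemma automorphism_translation:
  assumes pair: "inverse_pair \<phi> \<psi>" and P0: "coeff P (d - 1) = 0"
    and ac: "a \<noteq> 0" "c \<noteq> 0" and \<beta>: "\<beta> \<in> base_polys m"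
    and z: "\<And>p. p \<in> Y \<Longrightarrow> snd (\<phi> p) = \<beta> (fst p) + a * snd p"
    and tl: "\<And>p. p \<in> Y \<Longrightarrow> tail (fst (\<phi> p)) = c * tail (fst p)"
  shows "\<exists>b\<in>base_polys m. (\<forall>p\<in>Y. \<beta> (fst p) = tail (fst p) * b (fst p))"
    and "pcompose P [:0, a:] = smult (a ^ d) P"
proof -
  define s where "s i y = coeff (pcompose P [:\<beta> y, a:]) i + (- (a ^ d)) * coeff P i" for i y
  have s: "s i \<in> base_polys m" for i
    unfolding s_def[abs_def] by (intro base_polys.add pcompose_coeff_base \<beta> base_polys.const)
  have deg: "degree (pcompose P [:b, a:]) = d" for b
    by (simp add: degree_pcompose ac(1) deg_P)
  have lead_c: "coeff (pcompose P [:b, a:]) d = a ^ d" for b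
    using lead_coeff_comp[of "[:b, a:]" P] ac(1) monic deg_P deg[of b] by simp
  have sd: "s i y = 0" if "i \<ge> d" for i y
    using that lead_c deg monic deg_P by (cases "i = d") (auto simp: s_def coeff_eq_0)
  have s_sum: "poly P (\<beta> y + a * x) = a ^ d * poly P x + (\<Sum>i<d. s i y * x ^ i)" for x y
  proof -
    have "poly P (\<beta> y + a * x) = poly (pcompose P [:\<beta> y, a:]) x" by (simp add: poly_pcompose mult.commute)
    also have "\<dots> = (\<Sum>i\<le>d. coeff (pcompose P [:\<beta> y, a:]) i * x ^ i)" by (simp only: poly_altdef deg)
    also have "\<dots> = (\<Sum>i\<le>d. a ^ d * (coeff P i * x ^ i) + s i y * x ^ i)"
      by (rule sum.cong) (auto simp: s_def algebra_simps)
    also have "\<dots> = a ^ d * poly P x + (\<Sum>i\<le>d. s i y * x ^ i)"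
      by (simp add: sum.distrib sum_distrib_left P_expand)
    also have "(\<Sum>i\<le>d. s i y * x ^ i) = (\<Sum>i<d. s i y * x ^ i)" by (simp add: lessThan_Suc_atMost[symmetric] sd)
    finally show ?thesis .
  qed
  have ry1: "regular (\<lambda>p. fst p 1)" using m2 by (intro regular_y) auto
  define f where "f p = c * fst (\<phi> p) 1 + (- (a ^ d)) * fst p 1" for p
  have rf: "regular f"
    using pair ry1 unfolding f_def[abs_def] inverse_pair_def
    by (intro regular_add regular_mult regular_const) blast+
  have tf: "tail (fst p) * f p = (\<Sum>i<d. s i (fst p) * snd p ^ i)" if p: "p \<in> Y" for p
  proof -
    have "fst (\<phi> p) 1 * (c * tail (fst p)) = poly P (\<beta> (fst p) + a * snd p)"
      using Y_eq[of "\<phi> p"] pair p tl[OF p] z[OF p] by (auto simp: inverse_pair_def)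
    then show ?thesis using Y_eq[OF p] unfolding s_sum f_def by (simp add: algebra_simps)
  qed
  have "lookup u 0 < int d" if u: "u \<in> keys (laurent f)" for u
  proof -
    obtain v where v: "v \<in> keys (laurent (\<lambda>p. \<Sum>i<d. s i (fst p) * snd p ^ i))" "lookup v 0 = lookup u 0"
      using laurent_tail_mult_keys[OF rf tf u] by blast
    show ?thesis using base_expansion_keys[of d s, OF s v(1)] v(2) by simp
  qed
  then obtain w where w: "\<And>i. w i \<in> base_polys m" "\<And>p. p \<in> Y \<Longrightarrow> f p = (\<Sum>i<d. w i (fst p) * snd p ^ i)"
    using regular_small_degree[OF rf _ order_refl] by blast
  have tw: "(\<lambda>y. tail y * w i y) \<in> base_polys m" for i by (intro base_polys.mult base_polys_tail w)
  have st: "tail t * w i t = s i t" if t: "nonvanishing t" and i: "i < d" for t i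
  proof (rule base_expansion_coeff[of d "\<lambda>i y. tail y * w i y" s, OF tw s _ t i])
    show "(\<Sum>i<d. tail (fst p) * w i (fst p) * snd p ^ i) = (\<Sum>i<d. s i (fst p) * snd p ^ i)" if "p \<in> Y" for p
      using tf[OF that] w(2)[OF that] by (simp add: sum_distrib_left mult.assoc)
  qed
  have s1: "s (d - 1) y = of_nat d * a ^ (d - 1) * \<beta> y" for y
  proof -
    have "coeff (pcompose P [:\<beta> y, a:]) (d - 1) = (\<Sum>i\<le>d. coeff P i * coeff ([:\<beta> y, a:] ^ i) (d - 1))"
      by (simp add: pcompose_altdef poly_altdef coeff_sum deg_P degree_map_poly coeff_map_poly)
    also have "\<dots> = (\<Sum>i\<le>d. if i = d then coeff ([:\<beta> y, a:] ^ d) (d - 1) else 0)"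
    proof (rule sum.cong[OF refl])
      fix i assume "i \<in> {..d}"
      then consider "i = d" | "i = d - 1" | "i < d - 1" by fastforce
      then show "coeff P i * coeff ([:\<beta> y, a:] ^ i) (d - 1) = (if i = d then coeff ([:\<beta> y, a:] ^ d) (d - 1) else 0)"
      proof cases
        case 1 then show ?thesis using monic deg_P by simp
      next
        case 2 then show ?thesis using P0 d2 by simp
      next
        case 3
        then have "degree ([:\<beta> y, a:] ^ i) < d - 1" using ac(1) by (simp add: degree_power_eq)
        then show ?thesis using 3 by (simp add: coeff_eq_0)
      qed
    qed
    also have "\<dots> = of_nat d * \<beta> y * a ^ (d - 1)"
      using coeff_linear_power(2)[of "\<beta> y" a "d - 1"] d2 by simp
    finally show ?thesis using P0 by (simp add: s_def mult_ac)
  qed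
  define N where "N = of_nat d * a ^ (d - 1)"
  have N: "N \<noteq> 0" using ac(1) d2 by (simp add: N_def)
  define b where "b y = w (d - 1) y * (1 / N)" for y
  have b: "b \<in> base_polys m" unfolding b_def[abs_def] by (intro base_polys.mult base_polys.const w)
  have bt: "\<beta> t = tail t * b t" if "nonvanishing t" for t
  proof -
    have "N * \<beta> t = tail t * w (d - 1) t" using st[OF that, of "d - 1"] d2 s1[of t] by (simp add: N_def)
    then show ?thesis using N by (simp add: b_def field_simps)
  qed
  have tb: "(\<lambda>y. tail y * b y) \<in> base_polys m" by (intro base_polys.mult base_polys_tail b)
  have "\<beta> (fst p) = tail (fst p) * b (fst p)" if "p \<in> Y" for p
    by (rule base_eq_on_torus[OF \<beta> tb _ that]) (rule bt)
  then show "\<exists>b\<in>base_polys m. (\<forall>p\<in>Y. \<beta> (fst p) = tail (fst p) * b (fst p))" using b by blast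
  show "pcompose P [:0, a:] = smult (a ^ d) P"
  proof -
    \<comment> \<open>An identity between functions on the base that holds on its torus extends along the diagonal to the origin.\<close>
    have at0: "f (\<lambda>_. 0) = g (\<lambda>_. 0)"
      if fg: "f \<in> base_polys m" "g \<in> base_polys m" "\<And>t. nonvanishing t \<Longrightarrow> f t = g t" for f g :: "(nat \<Rightarrow> 'a) \<Rightarrow> 'a"
    proof -
      obtain q r where qr: "\<And>\<tau>. f (\<lambda>_. \<tau>) = poly q \<tau>" "\<And>\<tau>. g (\<lambda>_. \<tau>) = poly r \<tau>"
        using base_polys_diagonal[OF fg(1)] base_polys_diagonal[OF fg(2)] by blast
      have "q = r" by (rule poly_eq_on_nonzero) (use fg(3) qr in \<open>force simp: nonvanishing_def\<close>)
      then show ?thesis using qr by simp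
    qed
    have two: "2 \<in> {2..m}" "k 2 \<noteq> 0" using m2 k2[of 2] by auto
    have t0: "tail (\<lambda>_. 0) = 0"
      unfolding monomial_tail_def by (rule prod_zero) (use two in \<open>auto intro!: bexI[of _ 2]\<close>)
    have "\<beta> (\<lambda>_. 0) = 0" using at0[OF \<beta> tb bt] t0 by simp
    moreover have "s i (\<lambda>_. 0) = 0" for i
      using at0[OF tw s st, of i] t0 sd[of i] by (cases "i < d") auto
    ultimately have "coeff (pcompose P [:0, a:]) i - a ^ d * coeff P i = 0" for i
      using s_def[of i "\<lambda>_. 0"] by simp
    then have "coeff (pcompose P [:0, a:]) i = a ^ d * coeff P i" for i by simp
    then show ?thesis by (intro poly_eqI) simp
  qed
qed

section \<open>The generators\<close>

definition scaling :: "(nat \<Rightarrow> 'a) \<Rightarrow> 'a point \<Rightarrow> 'a point" where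
  "scaling t p = ((\<lambda>i\<in>{1..m}. t i * fst p i), snd p)"

definition dilation :: "'a \<Rightarrow> 'a point \<Rightarrow> 'a point" where
  "dilation a p = ((\<lambda>i\<in>{1..m}. if i = 1 then a ^ degree P * fst p 1 else fst p i), a * snd p)"

definition permute_coords :: "(nat \<Rightarrow> nat) \<Rightarrow> 'a point \<Rightarrow> 'a point" where
  "permute_coords \<pi> p = ((\<lambda>i\<in>{1..m}. fst p (\<pi> i)), snd p)"

lemma Y_monomial: "p \<in> Y \<longleftrightarrow> fst p \<in> {1..m} \<rightarrow>\<^sub>E UNIV \<and> monomial m k (fst p) = poly P (snd p)"
  by (simp add: Y_iff monomial_def)

lemma monomial_cong:
  fixes y y' :: "nat \<Rightarrow> 'a"
  shows "(\<And>i. i \<in> {1..m} \<Longrightarrow> y i = y' i) \<Longrightarrow> monomial m k y = monomial m k y'"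
  using m2 tail_cong[of y y'] by (auto simp: monomial_def)

lemma monomial_mult:
  fixes t y :: "nat \<Rightarrow> 'a"
  shows "monomial m k (\<lambda>i. t i * y i) = monomial m k t * monomial m k y"
  by (simp add: monomial_def monomial_tail_def power_mult_distrib prod.distrib)

lemma Y_ext:
  assumes "p \<in> Y" "q \<in> Y" "\<And>i. i \<in> {1..m} \<Longrightarrow> fst p i = fst q i" "snd p = snd q"
  shows "p = q"
  by (rule Y_eqI) (use assms m2 in auto)

lemma scaling_automorphism:
  assumes t: "\<And>i. i \<in> {1..m} \<Longrightarrow> t i \<noteq> 0" and mt: "monomial m k t = 1"
  shows "restrict (scaling t) Y \<in> automorphisms m Y"
proof -
  have inY: "scaling s p \<in> Y" if "monomial m k s = 1" "p \<in> Y" for s p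
  proof -
    have "monomial m k (fst (scaling s p)) = monomial m k (\<lambda>i. s i * fst p i)"
      by (rule monomial_cong) (simp add: scaling_def)
    then show ?thesis using that by (simp add: Y_monomial monomial_mult) (simp add: scaling_def)
  qed
  have "monomial m k (\<lambda>i. t i * inverse (t i)) = monomial m k (\<lambda>i. 1 :: 'a)"
    by (rule monomial_cong) (simp add: t)
  then have mi: "monomial m k (\<lambda>i. inverse (t i)) = 1" unfolding monomial_mult mt
    by (simp add: monomial_def monomial_tail_def)
  have reg: "regular (\<lambda>p. fst (scaling s p) i)" "regular (\<lambda>p. snd (scaling s p))" if "i \<in> {1..m}" for s i
  proof -
    have "regular (\<lambda>p. s i * fst p i)" by (intro regular_mult regular_const regular_y that)
    then show "regular (\<lambda>p. fst (scaling s p) i)" using that by (simp add: scaling_def)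
    show "regular (\<lambda>p. snd (scaling s p))" using regular_z by (simp add: scaling_def)
  qed
  have 1: "1 \<in> {1..m}" using m2 by auto
  show ?thesis
  proof (rule automorphism_intro[of _ "scaling (\<lambda>i. inverse (t i))"])
    show "scaling (\<lambda>i. inverse (t i)) (scaling t p) = p" if "p \<in> Y" for p
      by (rule Y_ext) (use that in \<open>auto intro: inY mt mi simp: t\<close>, auto simp: scaling_def t)
    show "scaling t (scaling (\<lambda>i. inverse (t i)) p) = p" if "p \<in> Y" for p
      by (rule Y_ext) (use that in \<open>auto intro: inY mt mi simp: t\<close>, auto simp: scaling_def t)
  qed (use inY mt mi reg 1 in blast)+
qed

lemma dilation_automorphism:
  assumes a: "a \<noteq> 0" and P: "pcompose P [:0, a:] = smult (a ^ degree P) P"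
  shows "restrict (dilation a) Y \<in> automorphisms m Y"
proof -
  have hom: "poly P (a * x) = a ^ degree P * poly P x" for x
    using arg_cong[OF P, of "\<lambda>q. poly q x"] by (simp add: poly_pcompose mult.commute)
  have homi: "poly P (inverse a * x) = inverse a ^ degree P * poly P x" for x
    using hom[of "inverse a * x"] a by (simp add: field_simps)
  have inY: "dilation b p \<in> Y" if "\<And>x. poly P (b * x) = b ^ degree P * poly P x" and p: "p \<in> Y" for b p
  proof -
    have "tail (fst (dilation b p)) = tail (fst p)" by (rule tail_cong) (auto simp: dilation_def)
    moreover have "fst (dilation b p) 1 = b ^ degree P * fst p 1" using m2 by (simp add: dilation_def)
    ultimately have "fst (dilation b p) 1 * tail (fst (dilation b p)) = poly P (snd (dilation b p))"
      using Y_eq[OF p] that(1) by (simp add: mult.assoc) (simp add: dilation_def that(1))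
    then show ?thesis unfolding Y_iff by (simp add: dilation_def)
  qed
  have reg: "regular (\<lambda>p. fst (dilation b p) i)" "regular (\<lambda>p. snd (dilation b p))" if "i \<in> {1..m}" for b i
  proof -
    have "regular (\<lambda>p. b ^ degree P * fst p i)" by (intro regular_mult regular_const regular_y that)
    then show "regular (\<lambda>p. fst (dilation b p) i)"
      using that regular_y[OF that] by (cases "i = 1") (simp_all add: dilation_def)
    show "regular (\<lambda>p. snd (dilation b p))"
      using regular_mult[OF regular_const[of b] regular_z] by (simp add: dilation_def)
  qed
  have 1: "1 \<in> {1..m}" using m2 by auto
  show ?thesis
  proof (rule automorphism_intro[of _ "dilation (inverse a)"])
    show "dilation (inverse a) (dilation a p) = p" if "p \<in> Y" for p
      by (rule Y_ext) (use that inY hom homi in blast, use that in blast,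
        use a 1 in \<open>auto simp: dilation_def simp flip: power_mult_distrib mult.assoc\<close>)
    show "dilation a (dilation (inverse a) p) = p" if "p \<in> Y" for p
      by (rule Y_ext) (use that inY hom homi in blast, use that in blast,
        use a 1 in \<open>auto simp: dilation_def simp flip: power_mult_distrib mult.assoc\<close>)
  qed (use inY hom homi reg 1 in blast)+
qed

lemma permute_coords_automorphism:
  assumes \<pi>: "\<pi> permutes {1..m}"
    and mon: "\<forall>y :: nat \<Rightarrow> 'a. monomial m k (\<lambda>i. y (\<pi> i)) = monomial m k y"
  shows "restrict (permute_coords \<pi>) Y \<in> automorphisms m Y"
proof -
  have moni: "monomial m k (\<lambda>i. y (inv_into UNIV \<pi> i)) = monomial m k y" for y :: "nat \<Rightarrow> 'a"
    using mon[rule_format, of "\<lambda>i. y (inv_into UNIV \<pi> i)"] permutes_inverses[OF \<pi>] by simp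
  have \<pi>i: "inv_into UNIV \<pi> permutes {1..m}" by (rule permutes_inv[OF \<pi>])
  have inY: "permute_coords \<rho> p \<in> Y" if "\<forall>y :: nat \<Rightarrow> 'a. monomial m k (\<lambda>i. y (\<rho> i)) = monomial m k y" "p \<in> Y" for \<rho> p
  proof -
    have "monomial m k (fst (permute_coords \<rho> p)) = monomial m k (\<lambda>i. fst p (\<rho> i))"
      by (rule monomial_cong) (simp add: permute_coords_def)
    also have "\<dots> = monomial m k (fst p)" by (rule that(1)[rule_format])
    also have "\<dots> = poly P (snd (permute_coords \<rho> p))" using that(2) by (simp add: Y_monomial permute_coords_def)
    finally show ?thesis unfolding Y_monomial by (simp add: permute_coords_def)
  qed
  have mem: "\<rho> i \<in> {1..m}" if "\<rho> permutes {1..m}" "i \<in> {1..m}" for \<rho> i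
    unfolding permutes_in_image[OF that(1)] by (rule that(2))
  have reg: "regular (\<lambda>p. fst (permute_coords \<rho> p) i)" "regular (\<lambda>p. snd (permute_coords \<rho> p))"
    if "\<rho> permutes {1..m}" "i \<in> {1..m}" for \<rho> i
  proof -
    show "regular (\<lambda>p. fst (permute_coords \<rho> p) i)"
      using regular_y[OF mem[OF that]] that(2) by (simp add: permute_coords_def)
    show "regular (\<lambda>p. snd (permute_coords \<rho> p))" using regular_z by (simp add: permute_coords_def)
  qed
  have 1: "1 \<in> {1..m}" using m2 by auto
  show ?thesis
  proof (rule automorphism_intro[of _ "permute_coords (inv_into UNIV \<pi>)"])
    show "permute_coords (inv_into UNIV \<pi>) (permute_coords \<pi> p) = p" if "p \<in> Y" for p
    proof (rule Y_ext)
      show "permute_coords (inv_into UNIV \<pi>) (permute_coords \<pi> p) \<in> Y" using that inY mon moni by blast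
      show "fst (permute_coords (inv_into UNIV \<pi>) (permute_coords \<pi> p)) i = fst p i" if "i \<in> {1..m}" for i
        using that mem[OF \<pi>i that] permutes_inverses[OF \<pi>] by (simp add: permute_coords_def)
    qed (use that in \<open>simp_all add: permute_coords_def\<close>)
    show "permute_coords \<pi> (permute_coords (inv_into UNIV \<pi>) p) = p" if "p \<in> Y" for p
    proof (rule Y_ext)
      show "permute_coords \<pi> (permute_coords (inv_into UNIV \<pi>) p) \<in> Y" using that inY mon moni by blast
      show "fst (permute_coords \<pi> (permute_coords (inv_into UNIV \<pi>) p)) i = fst p i" if "i \<in> {1..m}" for i
        using that mem[OF \<pi> that] permutes_inverses[OF \<pi>] by (simp add: permute_coords_def)
    qed (use that in \<open>simp_all add: permute_coords_def\<close>)
  qed (use inY mon moni reg[OF \<pi>] reg[OF \<pi>i] 1 in blast)+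
qed

lemma proper_torus_eq:
  "proper_torus m k P = (\<lambda>t. restrict (scaling t) Y) ` {t \<in> {1..m} \<rightarrow>\<^sub>E (UNIV - {0}). monomial m k t = 1}"
  unfolding proper_torus_def case_prod_beta scaling_def[abs_def] ..

lemma additional_quasitorus_eq:
  "additional_quasitorus m k P = (\<lambda>t. restrict (dilation t) Y) ` {t. t \<noteq> 0 \<and> pcompose P [:0, t:] = smult (t ^ degree P) P}"
  unfolding additional_quasitorus_def case_prod_beta dilation_def[abs_def] ..

lemma symmetric_group_eq:
  "symmetric_group m k P = (\<lambda>\<pi>. restrict (permute_coords \<pi>) Y) `
     {\<pi>. \<pi> permutes {1..m} \<and> (\<forall>y :: nat \<Rightarrow> 'a. monomial m k (\<lambda>i. y (\<pi> i)) = monomial m k y)}"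
  unfolding symmetric_group_def case_prod_beta permute_coords_def[abs_def] ..

lemma carrier_Aut: "carrier (Aut m Y) = automorphisms m Y"
  by (simp add: Aut_def)

lemma mult_Aut: "\<phi> \<in> automorphisms m Y \<Longrightarrow> \<psi> \<in> automorphisms m Y \<Longrightarrow> \<phi> \<otimes>\<^bsub>Aut m Y\<^esub> \<psi> = compose Y \<phi> \<psi>"
  by (simp add: Aut_def BijGroup_def automorphisms_def)

text \<open>
  The scalars \<open>C j\<close> of the permuted coordinates give the torus element, whose entry at \<open>y 1\<close> is
  forced. The quasitorus acts after the exponential and multiplies the translation of \<open>z\<close> by \<open>a\<close>,
  which is why the exponential uses \<open>b / a\<close>.
\<close>

lemma automorphism_factorization:
  assumes \<phi>: "\<phi> \<in> automorphisms m Y" and P0: "coeff P (d - 1) = 0"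
  shows "\<exists>\<tau>\<in>proper_torus m k P. \<exists>\<sigma>\<in>symmetric_group m k P. \<exists>\<delta>\<in>additional_quasitorus m k P.
    \<exists>\<upsilon>\<in>big_unipotent m Y (canonical_lnd m k P). \<forall>p\<in>Y. \<phi> p = \<tau> (\<sigma> (\<delta> (\<upsilon> p)))"
proof -
  obtain \<psi> where pair: "inverse_pair \<phi> \<psi>" by (rule automorphism_inverse_pair[OF \<phi>])
  obtain a c \<beta> where ac: "a \<noteq> 0" "c \<noteq> 0" "\<beta> \<in> base_polys m"
    and z: "\<And>p. p \<in> Y \<Longrightarrow> snd (\<phi> p) = \<beta> (fst p) + a * snd p"
    and tl: "\<And>p. p \<in> Y \<Longrightarrow> tail (fst (\<phi> p)) = c * tail (fst p)"
    using automorphism_constants[OF pair] by blast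
  obtain C \<sigma> where \<sigma>: "\<sigma> permutes {2..m}" "\<And>j. j \<in> {2..m} \<Longrightarrow> k (\<sigma> j) = k j"
    and C: "\<And>j. j \<in> {2..m} \<Longrightarrow> C j \<noteq> 0"
    and y: "\<And>j p. j \<in> {2..m} \<Longrightarrow> p \<in> Y \<Longrightarrow> fst (\<phi> p) j = C j * fst p (\<sigma> j)"
    using automorphism_permutation[OF pair] by blast
  obtain b where b: "b \<in> base_polys m" and \<beta>: "\<And>p. p \<in> Y \<Longrightarrow> \<beta> (fst p) = tail (fst p) * b (fst p)"
    using automorphism_translation(1)[OF pair P0 ac z tl] by blast
  have Pa: "pcompose P [:0, a:] = smult (a ^ d) P"
    by (rule automorphism_translation(2)[OF pair P0 ac z tl])
  define g where "g y = b y * (1 / a)" for y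
  have g: "g \<in> base_polys m" unfolding g_def[abs_def] by (intro base_polys.mult b base_polys.const)
  define t where "t = (\<lambda>i\<in>{1..m}. if i = 1 then inverse (tail C) else C i)"
  have tC: "tail C \<noteq> 0" using C by (auto simp: monomial_tail_def)
  have "tail t = tail C" by (rule tail_cong) (simp add: t_def)
  then have mt: "monomial m k t = 1" using m2 tC by (simp add: monomial_def t_def)
  have t0: "t i \<noteq> 0" if "i \<in> {1..m}" for i using that C[of i] tC by (auto simp: t_def)
  have \<tau>: "restrict (scaling t) Y \<in> proper_torus m k P"
  proof -
    have "t i = undefined" if "i \<notin> {1..m}" for i
      unfolding t_def by (simp only: restrict_apply that if_False)
    then have "t \<in> {1..m} \<rightarrow>\<^sub>E (UNIV - {0})" using t0 by (intro PiE_I) blast+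
    then show ?thesis unfolding proper_torus_eq using mt by blast
  qed
  have \<delta>: "restrict (dilation a) Y \<in> additional_quasitorus m k P"
    unfolding additional_quasitorus_eq using Pa ac deg_P by auto
  have \<sigma>m: "\<sigma> permutes {1..m}" by (rule permutes_subset[OF \<sigma>(1)]) auto
  have \<sigma>1: "\<sigma> 1 = 1" using permutes_not_in[OF \<sigma>(1), of 1] by simp
  have \<sigma>mon: "monomial m k (\<lambda>i. y (\<sigma> i)) = monomial m k y" for y :: "nat \<Rightarrow> 'a"
  proof -
    have "(\<Prod>j\<in>{2..m}. y (\<sigma> j) ^ k j) = (\<Prod>j\<in>{2..m}. y (\<sigma> j) ^ k (\<sigma> j))"
      by (rule prod.cong) (simp_all add: \<sigma>(2))
    also have "\<dots> = (\<Prod>j\<in>{2..m}. y j ^ k j)"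
      using prod.permute[OF \<sigma>(1), of "\<lambda>j. y j ^ k j"] by (simp add: o_def)
    finally show ?thesis using \<sigma>1 by (simp add: monomial_def monomial_tail_def)
  qed
  have \<pi>: "restrict (permute_coords \<sigma>) Y \<in> symmetric_group m k P"
    unfolding symmetric_group_eq using \<sigma>m \<sigma>mon by blast
  note auts = scaling_automorphism[OF t0 mt] permute_coords_automorphism[OF \<sigma>m, OF allI, OF \<sigma>mon]
    dilation_automorphism[OF ac(1) Pa[folded deg_P]] shear_automorphism[OF g]
  define \<rho> where "\<rho> p = restrict (scaling t) Y (restrict (permute_coords \<sigma>) Y (restrict (dilation a) Y (shear g p)))" for p
  have maps: "\<chi> p \<in> Y" "\<And>f. regular f \<Longrightarrow> regular (\<lambda>p. f (\<chi> p))" if \<chi>: "\<chi> \<in> automorphisms m Y" "p \<in> Y" for \<chi> p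
  proof -
    obtain \<psi> where "inverse_pair \<chi> \<psi>" by (rule automorphism_inverse_pair[OF \<chi>(1)])
    then show "\<chi> p \<in> Y" "\<And>f. regular f \<Longrightarrow> regular (\<lambda>p. f (\<chi> p))"
      using \<chi>(2) unfolding inverse_pair_def by blast+
  qed
  have ne: "torus_point (\<lambda>_. 1) \<in> Y" by (rule torus_point_in_Y) (simp add: nonvanishing_def)
  have \<rho>Y: "\<rho> p \<in> Y" if "p \<in> Y" for p
    unfolding \<rho>_def by (intro maps(1)[OF auts(1)] maps(1)[OF auts(2)] maps(1)[OF auts(3)] maps(1)[OF auts(4)] that)
  have \<rho>_reg: "regular (\<lambda>p. f (\<rho> p))" if "regular f" for f
    unfolding \<rho>_def using that maps(2)[OF auts(1) ne] maps(2)[OF auts(2) ne] maps(2)[OF auts(3) ne] maps(2)[OF auts(4) ne]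
    by blast
  have \<rho>_eq: "\<rho> p = scaling t (permute_coords \<sigma> (dilation a (flow (g (fst p)) p)))" if p: "p \<in> Y" for p
  proof -
    have 1: "flow (g (fst p)) p \<in> Y" by (rule flow_in_Y[OF p])
    have 2: "dilation a (flow (g (fst p)) p) \<in> Y" using maps(1)[OF auts(3) 1] 1 by simp
    have 3: "permute_coords \<sigma> (dilation a (flow (g (fst p)) p)) \<in> Y" using maps(1)[OF auts(2) 2] 2 by simp
    show ?thesis using p 1 2 3 by (simp add: \<rho>_def shear_def)
  qed
  have \<rho>z: "snd (\<rho> p) = snd (\<phi> p)" if p: "p \<in> Y" for p
    unfolding \<rho>_eq[OF p] z[OF p] \<beta>[OF p]
    using ac(1) by (simp add: scaling_def permute_coords_def dilation_def snd_flow g_def algebra_simps)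
  have \<rho>y: "fst (\<rho> p) j = fst (\<phi> p) j" if p: "p \<in> Y" and j: "j \<in> {2..m}" for p j
  proof -
    have "\<sigma> j \<in> {2..m}" using permutes_in_image[OF \<sigma>(1)] j by blast
    then show ?thesis unfolding \<rho>_eq[OF p] y[OF j p]
      using j fst_flow[of "\<sigma> j"] by (auto simp: scaling_def permute_coords_def dilation_def t_def)
  qed
  have ry1: "regular (\<lambda>p. fst p 1)" using m2 by (intro regular_y) auto
  have \<phi>Y: "\<phi> p \<in> Y" if "p \<in> Y" for p using that pair by (auto simp: inverse_pair_def)
  have r\<phi>: "regular (\<lambda>p. fst (\<phi> p) 1)" using maps(2)[OF \<phi> ne ry1] .
  have \<rho>1: "fst (\<rho> p) 1 = fst (\<phi> p) 1" if p: "p \<in> Y" for p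
  proof (rule regular_eq_on_torus[OF \<rho>_reg[OF ry1] r\<phi> _ p])
    fix s :: "nat \<Rightarrow> 'a" assume s: "nonvanishing s"
    let ?p = "torus_point s"
    have p: "?p \<in> Y" by (rule torus_point_in_Y[OF s])
    have "tail (fst (\<rho> ?p)) = tail (fst (\<phi> ?p))" by (rule tail_cong) (rule \<rho>y[OF p])
    then have "fst (\<rho> ?p) 1 * tail (fst (\<phi> ?p)) = fst (\<phi> ?p) 1 * tail (fst (\<phi> ?p))"
      using Y_eq[OF \<rho>Y[OF p]] Y_eq[OF \<phi>Y[OF p]] \<rho>z[OF p] by simp
    moreover have "tail (fst (\<phi> ?p)) \<noteq> 0" using tl[OF p] ac(2) tail_nonzero[OF s] by simp
    ultimately show "fst (\<rho> ?p) 1 = fst (\<phi> ?p) 1" by simp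
  qed
  have "\<phi> p = \<rho> p" if p: "p \<in> Y" for p
    by (rule Y_eqI[OF \<phi>Y[OF p] \<rho>Y[OF p]]) (simp_all only: \<rho>1[OF p] \<rho>y[OF p] \<rho>z[OF p])
  then show ?thesis using \<tau> \<pi> \<delta> shear_big_unipotent[OF g] unfolding \<rho>_def by blast
qed

end

theorem proposition6p3:
  fixes m d :: nat and k :: "nat \<Rightarrow> nat"
    and P :: "'a::{alg_closed_field, field_char_0} poly"
  assumes "m \<ge> 2"
    and "\<And>j. j \<in> {2..m} \<Longrightarrow> k j \<ge> 2"
    and "degree P = d" and "d \<ge> 2" and "lead_coeff P = 1" and "coeff P (d - 1) = 0"
  shows "generate (Aut m (Y_var m k P))
           (proper_torus m k P \<union>
            big_unipotent m (Y_var m k P) (canonical_lnd m k P) \<union>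
            additional_quasitorus m k P \<union>
            symmetric_group m k P)
         = carrier (Aut m (Y_var m k P))"
proof -
  interpret suspension m k P d
    by unfold_locales (use assms in auto)
  interpret G: group "Aut m Y" by (rule group_Aut)
  let ?T = "proper_torus m k P" and ?U = "big_unipotent m Y (canonical_lnd m k P)"
    and ?D = "additional_quasitorus m k P" and ?S = "symmetric_group m k P"
  let ?H = "?T \<union> ?U \<union> ?D \<union> ?S"
  have T: "?T \<subseteq> automorphisms m Y"
    unfolding proper_torus_eq by (auto intro!: scaling_automorphism)
  have U: "?U \<subseteq> automorphisms m Y" by (auto simp: big_unipotent_def)
  have D: "?D \<subseteq> automorphisms m Y"
    unfolding additional_quasitorus_eq by (auto intro!: dilation_automorphism)
  have S: "?S \<subseteq> automorphisms m Y"
    unfolding symmetric_group_eq by (auto intro!: permute_coords_automorphism)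
  have H: "?H \<subseteq> carrier (Aut m Y)" unfolding carrier_Aut using T U D S by blast
  show ?thesis
  proof
    show "generate (Aut m Y) ?H \<subseteq> carrier (Aut m Y)" by (rule G.generate_incl[OF H])
    show "carrier (Aut m Y) \<subseteq> generate (Aut m Y) ?H"
    proof
      fix \<phi> assume "\<phi> \<in> carrier (Aut m Y)"
      then have \<phi>: "\<phi> \<in> automorphisms m Y" by (simp add: carrier_Aut)
      from automorphism_factorization[OF this assms(6)] obtain \<tau> \<sigma> \<delta> \<upsilon> where
        f: "\<tau> \<in> ?T" "\<sigma> \<in> ?S" "\<delta> \<in> ?D" "\<upsilon> \<in> ?U" "\<And>p. p \<in> Y \<Longrightarrow> \<phi> p = \<tau> (\<sigma> (\<delta> (\<upsilon> p)))" by blast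
      have a: "\<tau> \<in> automorphisms m Y" "\<sigma> \<in> automorphisms m Y" "\<delta> \<in> automorphisms m Y" "\<upsilon> \<in> automorphisms m Y"
        using f T U D S by blast+
      have cl: "x \<otimes>\<^bsub>Aut m Y\<^esub> y \<in> automorphisms m Y" if "x \<in> automorphisms m Y" "y \<in> automorphisms m Y" for x y
        using G.m_closed that unfolding carrier_Aut by blast
      have "\<phi> = \<tau> \<otimes>\<^bsub>Aut m Y\<^esub> (\<sigma> \<otimes>\<^bsub>Aut m Y\<^esub> (\<delta> \<otimes>\<^bsub>Aut m Y\<^esub> \<upsilon>))"
      proof (rule extensionalityI[of _ Y])
        show "\<phi> \<in> extensional Y" using \<phi> by (simp add: automorphisms_def Bij_def)
        show "\<tau> \<otimes>\<^bsub>Aut m Y\<^esub> (\<sigma> \<otimes>\<^bsub>Aut m Y\<^esub> (\<delta> \<otimes>\<^bsub>Aut m Y\<^esub> \<upsilon>)) \<in> extensional Y"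
          using cl[OF a(1) cl[OF a(2) cl[OF a(3,4)]]] by (simp add: automorphisms_def Bij_def)
        fix p assume p: "p \<in> Y"
        then show "\<phi> p = (\<tau> \<otimes>\<^bsub>Aut m Y\<^esub> (\<sigma> \<otimes>\<^bsub>Aut m Y\<^esub> (\<delta> \<otimes>\<^bsub>Aut m Y\<^esub> \<upsilon>))) p"
          using f(5)[OF p] mult_Aut[OF a(1) cl[OF a(2) cl[OF a(3,4)]]] mult_Aut[OF a(2) cl[OF a(3,4)]] mult_Aut[OF a(3,4)]
          by (simp add: compose_eq)
      qed
      moreover have "\<tau> \<in> generate (Aut m Y) ?H" "\<sigma> \<in> generate (Aut m Y) ?H"
        "\<delta> \<in> generate (Aut m Y) ?H" "\<upsilon> \<in> generate (Aut m Y) ?H"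
        using f by (auto intro: generate.incl)
      ultimately show "\<phi> \<in> generate (Aut m Y) ?H" by (auto intro: generate.eng)
    qed
  qed
qed

end
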